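(* Let $\zeta$ be a finite positive continuous measure on $SG$ such that for every word $w$ there is $C_w>0$ with $\|\Delta_\zeta u\|_2^2\ge C_w\|\Delta_\zeta(u\circ F_w)\|_2^2$ for all $u\in\operatorname{dom}_{L^2}\Delta_\zeta$. Let $E=\{x_1,\dots,x_n\}\subset V_m$ be a set of distinct points containing three points, labelled $x_1,x_2,x_3$, for which the matrix $(h_j(x_i))_{1\le i\le3,\,0\le j\le2}$ is invertible, and let $a_i,b_i\in\mathbb{R}$. Let $u$ be the minimizer of $T_\zeta(u)=\int_{SG}(\Delta_\zeta u)^2\,d\zeta$ among all $u\in\operatorname{dom}_{L^2}\Delta_\zeta$ with $u(x_i)=a_i$ and $\partial_nu(x_i)=b_i$ for all $i$ (this minimizer exists and is unique). Then $u$ is piecewise biharmonic on $V_m$, i.e. for every word $w$ of length $m$ the function $(\Delta_\zeta u)\circ F_w$ is (almost everywhere equal to) a harmonic function on $SG$.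
   Context: Let $q_0,q_1,q_2$ be the vertices of an equilateral triangle in the plane, $F_i(x)=\frac12(x+q_i)$, and let $SG$ (the Sierpinski gasket) be the unique nonempty compact set with $SG=\bigcup_{i}F_i(SG)$. For a word $w$ of length $m$ let $F_w=F_{w_1}\circ\cdots\circ F_{w_m}$; the sets $F_wSG$ are the cells. Put $V_0=\{q_0,q_1,q_2\}$, $V_m=\bigcup_iF_iV_{m-1}$; $x\sim_m y$ means $x\ne y$ and $x,y\in F_wV_0$ for some word $w$ of length $m$. The energy of a continuous $u:SG\to\mathbb{R}$ is $\mathcal{E}(u)=\lim_{m\to\infty}\left(\frac53\right)^m\sum_{\{x,y\}:x\sim_m y}(u(x)-u(y))^2$ (a nondecreasing limit), $\operatorname{dom}\mathcal{E}$ is the set of continuous $u$ with $\mathcal{E}(u)<\infty$, and $\mathcal{E}(u,v)$ is the associated bilinear form. A harmonic function is a function of least energy with given values on $V_0$; the harmonic functions are the linear combinations of $h_0,h_1,h_2$, where $h_j(q_i)=\delta_{ij}$. A finite positive continuous measure on $SG$ is a finite Borel measure with no atoms giving positive mass to every cell. $\operatorname{dom}_{L^2}\Delta_\zeta$ is the set of $u\in\operatorname{dom}\mathcal{E}$ for which there is $f\in L^2(\zeta)$ with $\mathcal{E}(u,v)=-\int fv\,d\zeta$ for all $v\in\operatorname{dom}\mathcal{E}$ with $v|_{V_0}=0$; then $\Delta_\zeta u:=f$; $\|\cdot\|_2$ is the $L^2(\zeta)$ norm. In the measure condition it is understood that $u\circ F_w\in\operatorname{dom}_{L^2}\Delta_\zeta$.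 Normal derivatives: for $y=F_wq_i$ with $|w|=m$, the normal derivative at $y$ with respect to the cell $F_wSG$ is $\lim_{k\to\infty}\left(\frac53\right)^{m+k}\bigl(2u(y)-u(F_wF_i^kq_{i+1})-u(F_wF_i^kq_{i-1})\bigr)$ (indices mod 3), which exists for $u\in\operatorname{dom}_{L^2}\Delta_\zeta$. A point of $V_m\setminus V_0$ lies in two $m$-cells, and the two normal derivatives there sum to $0$; $\partial_nu(y)$ denotes the normal derivative with respect to one fixed choice of $m$-cell containing $y$. *)

theory Defs
  imports "HOL-Analysis.Analysis"
begin

text \<open>
  Indices of the three vertices live in the type \<open>3\<close> of integers modulo \<open>3\<close>, so that
  \<open>i + 1\<close> and \<open>i - 1\<close> are the other two indices. Words are lists over this type. Functions on
  the gasket are total functions on the plane of which only the values on the gasket matter.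
\<close>

definition equilateral :: "(3 \<Rightarrow> complex) \<Rightarrow> bool" where
  "equilateral q \<longleftrightarrow> (\<exists>s>0. \<forall>i j. i \<noteq> j \<longrightarrow> dist (q i) (q j) = s)"

definition sg_map :: "(3 \<Rightarrow> complex) \<Rightarrow> 3 \<Rightarrow> complex \<Rightarrow> complex" where
  "sg_map q i x = (x + q i) / 2"

primrec sg_word :: "(3 \<Rightarrow> complex) \<Rightarrow> 3 list \<Rightarrow> complex \<Rightarrow> complex" where
  "sg_word q [] = id"
| "sg_word q (i # w) = sg_map q i \<circ> sg_word q w"

definition SG :: "(3 \<Rightarrow> complex) \<Rightarrow> complex set" where
  "SG q = (THE K. K \<noteq> {} \<and> compact K \<and> K = (\<Union>i. sg_map q i ` K))"

primrec sg_vertices :: "(3 \<Rightarrow> complex) \<Rightarrow> nat \<Rightarrow> complex set" where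
  "sg_vertices q 0 = range q"
| "sg_vertices q (Suc m) = (\<Union>i. sg_map q i ` sg_vertices q m)"

definition sg_adj :: "(3 \<Rightarrow> complex) \<Rightarrow> nat \<Rightarrow> complex \<Rightarrow> complex \<Rightarrow> bool" where
  "sg_adj q m x y \<longleftrightarrow> x \<noteq> y \<and>
     (\<exists>w. length w = m \<and> x \<in> sg_word q w ` sg_vertices q 0 \<and> y \<in> sg_word q w ` sg_vertices q 0)"

text \<open>The sum runs over ordered pairs, so every edge occurs twice; hence the factor \<open>1/2\<close>.\<close>

definition energy_level :: "(3 \<Rightarrow> complex) \<Rightarrow> nat \<Rightarrow> (complex \<Rightarrow> real) \<Rightarrow> real" where
  "energy_level q m u =
     (5/3) ^ m * ((1/2) * (\<Sum>(x, y)\<in>{(x, y). sg_adj q m x y}. (u x - u y)\<^sup>2))"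

definition energy :: "(3 \<Rightarrow> complex) \<Rightarrow> (complex \<Rightarrow> real) \<Rightarrow> ereal" where
  "energy q u = lim (\<lambda>m. ereal (energy_level q m u))"

definition dom_energy :: "(3 \<Rightarrow> complex) \<Rightarrow> (complex \<Rightarrow> real) set" where
  "dom_energy q = {u. continuous_on (SG q) u \<and> energy q u < \<infinity>}"

text \<open>The bilinear form is obtained from the quadratic form by polarization; it is only used on
  \<open>dom_energy\<close>, where all energies are finite.\<close>

definition energy_form :: "(3 \<Rightarrow> complex) \<Rightarrow> (complex \<Rightarrow> real) \<Rightarrow> (complex \<Rightarrow> real) \<Rightarrow> real" where
  "energy_form q u v =
     (real_of_ereal (energy q (\<lambda>x. u x + v x)) - real_of_ereal (energy q (\<lambda>x. u x - v x))) / 4"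

definition harmonic :: "(3 \<Rightarrow> complex) \<Rightarrow> (complex \<Rightarrow> real) \<Rightarrow> bool" where
  "harmonic q u \<longleftrightarrow> u \<in> dom_energy q \<and>
     (\<forall>v\<in>dom_energy q. (\<forall>p\<in>sg_vertices q 0. v p = u p) \<longrightarrow> energy q u \<le> energy q v)"

text \<open>Only the values on \<open>SG q\<close> of the chosen function are determined.\<close>

definition harmonic_basis :: "(3 \<Rightarrow> complex) \<Rightarrow> 3 \<Rightarrow> complex \<Rightarrow> real" where
  "harmonic_basis q j = (SOME h. harmonic q h \<and> (\<forall>i. h (q i) = (if i = j then 1 else 0)))"

definition finite_positive_continuous_measure ::
    "(3 \<Rightarrow> complex) \<Rightarrow> complex measure \<Rightarrow> bool" where
  "finite_positive_continuous_measure q \<zeta> \<longleftrightarrow>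
     sets \<zeta> = sets (restrict_space borel (SG q)) \<and>
     finite_measure \<zeta> \<and>
     (\<forall>x\<in>SG q. emeasure \<zeta> {x} = 0) \<and>
     (\<forall>w. emeasure \<zeta> (sg_word q w ` SG q) > 0)"

definition square_integrable :: "complex measure \<Rightarrow> (complex \<Rightarrow> real) \<Rightarrow> bool" where
  "square_integrable \<zeta> f \<longleftrightarrow> f \<in> borel_measurable \<zeta> \<and> integrable \<zeta> (\<lambda>x. (f x)\<^sup>2)"

definition l2norm :: "complex measure \<Rightarrow> (complex \<Rightarrow> real) \<Rightarrow> real" where
  "l2norm \<zeta> f = sqrt (\<integral>x. (f x)\<^sup>2 \<partial>\<zeta>)"

definition has_laplacian ::
    "(3 \<Rightarrow> complex) \<Rightarrow> complex measure \<Rightarrow> (complex \<Rightarrow> real) \<Rightarrow> (complex \<Rightarrow> real) \<Rightarrow> bool" where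
  "has_laplacian q \<zeta> u f \<longleftrightarrow> u \<in> dom_energy q \<and> square_integrable \<zeta> f \<and>
     (\<forall>v\<in>dom_energy q. (\<forall>p\<in>sg_vertices q 0. v p = 0) \<longrightarrow>
        energy_form q u v = - (\<integral>x. f x * v x \<partial>\<zeta>))"

definition dom_laplacian ::
    "(3 \<Rightarrow> complex) \<Rightarrow> complex measure \<Rightarrow> (complex \<Rightarrow> real) set" where
  "dom_laplacian q \<zeta> = {u. \<exists>f. has_laplacian q \<zeta> u f}"

text \<open>A representative of the \<open>L\<^sup>2\<close> class, which is unique up to \<open>\<zeta>\<close>-null sets.\<close>

definition laplacian ::
    "(3 \<Rightarrow> complex) \<Rightarrow> complex measure \<Rightarrow> (complex \<Rightarrow> real) \<Rightarrow> complex \<Rightarrow> real" where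
  "laplacian q \<zeta> u = (SOME f. has_laplacian q \<zeta> u f)"

definition cell_laplacian_bound :: "(3 \<Rightarrow> complex) \<Rightarrow> complex measure \<Rightarrow> bool" where
  "cell_laplacian_bound q \<zeta> \<longleftrightarrow>
     (\<forall>w. \<exists>C>0. \<forall>u\<in>dom_laplacian q \<zeta>.
        u \<circ> sg_word q w \<in> dom_laplacian q \<zeta> \<and>
        (l2norm \<zeta> (laplacian q \<zeta> u))\<^sup>2 \<ge> C * (l2norm \<zeta> (laplacian q \<zeta> (u \<circ> sg_word q w)))\<^sup>2)"

text \<open>The normal derivative at the point \<open>sg_word q w (q i)\<close> with respect to the cell of \<open>w\<close>.\<close>

definition normal_deriv ::
    "(3 \<Rightarrow> complex) \<Rightarrow> 3 list \<Rightarrow> 3 \<Rightarrow> (complex \<Rightarrow> real) \<Rightarrow> real" where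
  "normal_deriv q w i u =
     lim (\<lambda>k. (5/3) ^ (length w + k) *
       (2 * u (sg_word q w (q i))
        - u (sg_word q w ((sg_map q i ^^ k) (q (i + 1))))
        - u (sg_word q w ((sg_map q i ^^ k) (q (i - 1))))))"

definition bending ::
    "(3 \<Rightarrow> complex) \<Rightarrow> complex measure \<Rightarrow> (complex \<Rightarrow> real) \<Rightarrow> real" where
  "bending q \<zeta> u = (\<integral>x. (laplacian q \<zeta> u x)\<^sup>2 \<partial>\<zeta>)"

text \<open>The normal derivative at \<open>x i\<close> is taken with respect to the cell of the word \<open>c i\<close>, in which
  \<open>x i\<close> is the vertex with index \<open>s i\<close>.\<close>

definition interpolants ::
    "(3 \<Rightarrow> complex) \<Rightarrow> complex measure \<Rightarrow> nat \<Rightarrow> (nat \<Rightarrow> complex) \<Rightarrow> (nat \<Rightarrow> 3 list) \<Rightarrow> (nat \<Rightarrow> 3) \<Rightarrow>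
     (nat \<Rightarrow> real) \<Rightarrow> (nat \<Rightarrow> real) \<Rightarrow> (complex \<Rightarrow> real) set" where
  "interpolants q \<zeta> n x c s a b =
     {u \<in> dom_laplacian q \<zeta>. \<forall>i\<in>{1..n}. u (x i) = a i \<and> normal_deriv q (c i) (s i) u = b i}"

definition is_minimizer :: "('a \<Rightarrow> real) \<Rightarrow> 'a set \<Rightarrow> 'a \<Rightarrow> bool" where
  "is_minimizer T A u \<longleftrightarrow> u \<in> A \<and> (\<forall>v\<in>A. T u \<le> T v)"

text \<open>``Almost everywhere'' for a composition with \<open>sg_word q w\<close> refers to \<open>\<zeta>\<close> on the cell of
  \<open>w\<close>: the equation holds at every \<open>y\<close> whose image avoids some \<open>\<zeta>\<close>-null set.\<close>

definition piecewise_biharmonic ::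
    "(3 \<Rightarrow> complex) \<Rightarrow> complex measure \<Rightarrow> nat \<Rightarrow> (complex \<Rightarrow> real) \<Rightarrow> bool" where
  "piecewise_biharmonic q \<zeta> m u \<longleftrightarrow>
     (\<forall>w. length w = m \<longrightarrow>
        (\<exists>h. harmonic q h \<and>
           (AE x in \<zeta>. \<forall>y\<in>SG q. x = sg_word q w y \<longrightarrow> laplacian q \<zeta> u x = h y)))"

end

(*
  For an integrable f the Green potential G f is a uniformly convergent series of piecewise harmonic
  tents, and u has Laplacian f exactly when u - G f is harmonic; no completeness of the energy space
  is needed. Testing with the functions that are harmonic on the
  cells of level m shows that the values of u on V_m and its normal derivatives there are tied to f
  only through the moments of f against the functions g_{w,j}, where g_{w,j} is h_j transplanted to
  the cell of w and extended by zero; conversely any f with the same moments is the Laplacian of a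
  function with the same values and normal derivatives. Hence replacing the Laplacian of an interpolant
  by its L2-projection onto the span of the g_{w,j} keeps it an interpolant and strictly decreases T
  unless the Laplacian lies in this span already, i.e. is harmonic on every cell. What remains is
  the minimization of a norm over an affine subspace of a finite-dimensional space; two minimizers
  have the same Laplacian, so they differ by a harmonic function vanishing at x_1, x_2, x_3.
*)

theory Submission
  imports Defs
begin

section \<open>Geometry of the gasket\<close>

text \<open>The measure is not assumed self-similar, so pulling \<open>f\<close> back to a cell
  leads out of the class of potentials for the given measure. Therefore \<open>f\<close> stays fixed
  and the cell becomes a parameter: \<open>L f w v\<close> integrates \<open>f\<close> against
  \<open>v\<close> transplanted to the cell of \<open>w\<close>, and \<open>green f w\<close> is the
  rescaled part of the potential in that cell. This family satisfies a closed recursion in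
  \<open>w\<close>, so the identities follow by induction on the level. An energy of level n sees
  only values on V_n. Replacing a test function by its piecewise harmonic interpolant
  \<open>spline n v\<close> makes the finite-level identity for the potential exact, with no error
  term; only the test function has to pass to a limit. Values and moments are linked by
  \<open>flux\<close>, a discrete normal derivative corrected by a moment. At level m all values and
  all one-sided fluxes can be prescribed, provided that the fluxes cancel at each vertex outside
  V_0. This rests on independence of the functions g_{w,j}, hence on positive mass of every cell.
  Absence of atoms makes the finitely many junction points negligible and turns fluxes into normal
  derivatives.\<close>

lemma UNIV_3_eq: "(UNIV :: 3 set) = {0, 1, 2}"
proof -
  have "x = 0 \<or> x = 1 \<or> x = 2" for x :: 3
    using exhaust_3[of x] by auto
  then show ?thesis by auto
qed

lemma distinct_3 [simp]:
  "(0::3) \<noteq> 1" "(1::3) \<noteq> 0" "(0::3) \<noteq> 2" "(2::3) \<noteq> 0" "(1::3) \<noteq> 2" "(2::3) \<noteq> 1"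
  by (simp_all)

lemma sum_UNIV_3: "sum f (UNIV :: 3 set) = f 0 + f 1 + (f 2 :: 'a :: comm_monoid_add)"
proof -
  have "sum f {0, 1, 2::3} = f 0 + (f 1 + f 2)" by simp
  then show ?thesis unfolding UNIV_3_eq[symmetric] by (simp only: add.assoc)
qed

lemma all_3: "(\<forall>i::3. P i) \<longleftrightarrow> P 0 \<and> P 1 \<and> P 2"
proof -
  have "(\<forall>i\<in>(UNIV::3 set). P i) \<longleftrightarrow> P 0 \<and> P 1 \<and> P 2" unfolding UNIV_3_eq by blast
  then show ?thesis by simp
qed

lemma sg_word_append: "sg_word q (v @ w) = sg_word q v \<circ> sg_word q w"
  by (induction v) auto

lemma sg_word_replicate: "sg_word q (replicate k i) = sg_map q i ^^ k"
  by (induction k) auto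

section \<open>Barycentric coordinates of the triangle\<close>

definition barycenter :: "(3 \<Rightarrow> complex) \<Rightarrow> complex" where
  "barycenter q = (q 0 + q 1 + q 2) / 3"

locale gasket =
  fixes q :: "3 \<Rightarrow> complex"
  assumes equilateral: "equilateral q"
begin

abbreviation F :: "3 \<Rightarrow> complex \<Rightarrow> complex" where "F \<equiv> sg_map q"
abbreviation FW :: "3 list \<Rightarrow> complex \<Rightarrow> complex" where "FW \<equiv> sg_word q"
abbreviation K :: "complex set" where "K \<equiv> SG q"

definition side :: real where "side = dist (q 0) (q 1)"

lemma dist_q: "i \<noteq> j \<Longrightarrow> dist (q i) (q j) = side" and side_pos: "side > 0"
proof -
  obtain d where d: "d > 0" "\<And>i j. i \<noteq> j \<Longrightarrow> dist (q i) (q j) = d"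
    using equilateral unfolding equilateral_def by blast
  have "side = d" unfolding side_def by (rule d) simp
  with d show "side > 0" "i \<noteq> j \<Longrightarrow> dist (q i) (q j) = side" by blast+
qed

text \<open>The barycentric coordinates. In an equilateral triangle the vectors from the centroid to
  the vertices have inner products \<open>side^2/3\<close> with themselves and
  \<open>-side^2/6\<close> with each other; the constants 1/3 and \<open>2/side^2\<close> turn these
  into 1 and 0.\<close>

definition bary :: "3 \<Rightarrow> complex \<Rightarrow> real" where
  "bary i x = 1/3 + 2 / side\<^sup>2 * ((x - barycenter q) \<bullet> (q i - barycenter q))"

lemma bary_q: "bary i (q j) = (if i = j then 1 else 0)"
proof -
  have dn: "(q k - q l) \<bullet> (q k - q l) = side\<^sup>2" if "k \<noteq> l" for k l
    using dist_q[OF that] by (simp add: dist_norm dot_square_norm)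
  have eqs: "(q 1 - q 0) \<bullet> (q 1 - q 0) = side\<^sup>2" "(q 2 - q 0) \<bullet> (q 2 - q 0) = side\<^sup>2"
    by (simp_all add: dn)
  have "(q 2 - q 0) - (q 1 - q 0) = q 2 - q 1" by simp
  then have "((q 2 - q 0) - (q 1 - q 0)) \<bullet> ((q 2 - q 0) - (q 1 - q 0)) = side\<^sup>2" by (simp only: dn[OF distinct_3(6)])
  note eqs = eqs this
  define a b where "a = q 1 - q 0" and "b = q 2 - q 0"
  have ab: "a \<bullet> a = side\<^sup>2" "b \<bullet> b = side\<^sup>2" "a \<bullet> b = side\<^sup>2 / 2" "b \<bullet> a = side\<^sup>2 / 2"
    using eqs unfolding a_def[symmetric] b_def[symmetric]
    by (simp_all only: inner_diff inner_commute[of b a])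
  have p: "q 0 - barycenter q = (-1/3) *\<^sub>R a + (-1/3) *\<^sub>R b"
    "q 1 - barycenter q = (2/3) *\<^sub>R a + (-1/3) *\<^sub>R b"
    "q 2 - barycenter q = (-1/3) *\<^sub>R a + (2/3) *\<^sub>R b"
    by (simp_all add: a_def b_def barycenter_def scaleR_conv_of_real field_simps)
  have "\<forall>i j. (q j - barycenter q) \<bullet> (q i - barycenter q) = (if i = j then side\<^sup>2/3 else - (side\<^sup>2/6))"
    unfolding all_3 p inner_add inner_scaleR_left inner_scaleR_right ab by simp
  then have "(q j - barycenter q) \<bullet> (q i - barycenter q) = (if i = j then side\<^sup>2/3 else - (side\<^sup>2/6))"
    by blast
  then show ?thesis unfolding bary_def using side_pos by (simp split: if_splits)
qed

lemma sum_bary: "(\<Sum>i\<in>UNIV. bary i x) = 1"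
proof -
  have "(\<Sum>i\<in>UNIV. (x - barycenter q) \<bullet> (q i - barycenter q)) =
     (x - barycenter q) \<bullet> (\<Sum>i\<in>UNIV. q i - barycenter q)" by (simp add: inner_sum_right)
  also have "(\<Sum>i\<in>UNIV. q i - barycenter q) = 0" by (simp add: sum_UNIV_3 barycenter_def field_simps)
  finally have "(\<Sum>i\<in>UNIV. 2 / side\<^sup>2 * ((x - barycenter q) \<bullet> (q i - barycenter q))) = 0"
    unfolding sum_distrib_left[symmetric] by simp
  then show ?thesis
    unfolding bary_def sum.distrib by simp
qed

lemma bary_F: "bary j (F i x) = (bary j x + (if i = j then 1 else 0)) / 2"
proof -
  have "F i x - barycenter q = (1/2) *\<^sub>R (x - barycenter q) + (1/2) *\<^sub>R (q i - barycenter q)"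
    by (simp add: sg_map_def scaleR_conv_of_real field_simps)
  then have "bary j (F i x) = (bary j x + bary j (q i)) / 2"
    unfolding bary_def by (simp add: inner_add add_divide_distrib distrib_left)
  then show ?thesis by (auto simp: bary_q)
qed

lemma continuous_on_bary: "continuous_on S (bary i)"
  unfolding bary_def by (intro continuous_intros)

lemma q_eq_iff [simp]: "q i = q j \<longleftrightarrow> i = j"
  using dist_q[of i j] side_pos by (cases "i = j") auto

lemma F_eq_iff [simp]: "F i x = F i y \<longleftrightarrow> x = y"
  by (simp add: sg_map_def)

lemma F_q_self [simp]: "F i (q i) = q i" by (simp add: sg_map_def)
lemma F_q_commute: "F i (q j) = F j (q i)" by (simp add: sg_map_def add.commute)

lemma continuous_on_F: "continuous_on S (F i)"
  unfolding sg_map_def by (intro continuous_intros) auto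

section \<open>The set of all vertices, and the gasket as its closure\<close>

definition V :: "complex set" where "V = (\<Union>m. sg_vertices q m)"

lemma vertices_Suc_mono: "sg_vertices q m \<subseteq> sg_vertices q (Suc m)"
proof (induction m)
  case 0
  have "q i \<in> (\<Union>i. F i ` range q)" for i by (rule UN_I[of i], simp, rule image_eqI[of _ _ "q i"]) simp_all
  then show ?case by auto
next
  case (Suc m)
  show ?case
  proof
    fix x assume "x \<in> sg_vertices q (Suc m)"
    then obtain i y where "y \<in> sg_vertices q m" "x = F i y" by auto
    then show "x \<in> sg_vertices q (Suc (Suc m))"
      using Suc unfolding sg_vertices.simps(2)[of q "Suc m"] by blast
  qed
qed

lemma V_unfold: "V = (\<Union>i. F i ` V)"
proof -
  have "V = (\<Union>m. sg_vertices q (Suc m))"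
  proof
    show "V \<subseteq> (\<Union>m. sg_vertices q (Suc m))"
      unfolding V_def using vertices_Suc_mono by blast
    show "(\<Union>m. sg_vertices q (Suc m)) \<subseteq> V"
      unfolding V_def by (intro UN_least UN_upper) simp
  qed
  also have "\<dots> = (\<Union>i. F i ` V)" unfolding V_def by auto
  finally show ?thesis .
qed

lemma closure_F_image: "closure (F i ` S) = F i ` closure S"
proof -
  have *: "F i ` S = (+) (q i / 2) ` ((*\<^sub>R) (1/2) ` S)" for S
    unfolding image_image by (intro image_cong) (auto simp: sg_map_def scaleR_conv_of_real field_simps)
  show ?thesis
    unfolding * by (simp only: closure_scaleR closure_translation)
qed

text \<open>The closed triangle. Both conditions are closed and stable under the maps
  \<open>F i\<close>, so they reach the gasket from the three corners by induction over V and
  passage to the closure.\<close>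

definition S0 :: "complex set" where "S0 = {x. (\<forall>i. bary i x \<ge> 0) \<and> x = (\<Sum>i\<in>UNIV. of_real (bary i x) * q i)}"

lemma S0_nonneg: "x \<in> S0 \<Longrightarrow> bary i x \<ge> 0"
  unfolding S0_def by blast

lemma S0_eq: "x \<in> S0 \<Longrightarrow> x = (\<Sum>i\<in>UNIV. of_real (bary i x) * q i)"
  unfolding S0_def by blast

lemma S0_I: "(\<And>i. bary i x \<ge> 0) \<Longrightarrow> x = (\<Sum>i\<in>UNIV. of_real (bary i x) * q i) \<Longrightarrow> x \<in> S0"
  unfolding S0_def by (intro CollectI conjI allI)

lemma closed_S0: "closed S0"
proof -
  have "S0 = (\<Inter>i. {x. bary i x \<ge> 0}) \<inter> {x. x = (\<Sum>i\<in>UNIV. of_real (bary i x) * q i)}"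
    unfolding S0_def by blast
  moreover have "closed {x. x = (\<Sum>i\<in>UNIV. of_real (bary i x) * q i)}"
    by (intro closed_Collect_eq continuous_intros continuous_on_bary)
  moreover have "closed (\<Inter>i. {x. bary i x \<ge> 0})"
    by (intro closed_INT ballI closed_Collect_le continuous_intros continuous_on_bary)
  ultimately show ?thesis by (simp add: closed_Int)
qed

lemma F_S0: "x \<in> S0 \<Longrightarrow> F i x \<in> S0"
proof -
  assume x: "x \<in> S0"
  have "(\<Sum>j\<in>UNIV. of_real (bary j (F i x)) * q j) = (\<Sum>j\<in>UNIV. (of_real (bary j x) * q j + (if i = j then q j else 0)) / 2)"
    by (intro sum.cong) (auto simp: bary_F field_simps)
  also have "\<dots> = ((\<Sum>j\<in>UNIV. of_real (bary j x) * q j) + q i) / 2"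
    unfolding sum_divide_distrib[symmetric] sum.distrib by simp
  also have "(\<Sum>j\<in>UNIV. of_real (bary j x) * q j) = x" using S0_eq[OF x] by (rule sym)
  finally have "F i x = (\<Sum>j\<in>UNIV. of_real (bary j (F i x)) * q j)" by (simp add: sg_map_def)
  moreover have "bary j (F i x) \<ge> 0" for j using S0_nonneg[OF x] by (simp add: bary_F)
  ultimately show ?thesis by (intro S0_I)
qed

lemma V_S0: "V \<subseteq> S0"
proof -
  have "sg_vertices q m \<subseteq> S0" for m
  proof (induction m)
    case 0
    have "q i = (\<Sum>j\<in>UNIV. of_real (bary j (q i)) * q j)" for i
    proof -
      have "(\<Sum>j\<in>UNIV. of_real (bary j (q i)) * q j) = (\<Sum>j\<in>UNIV. if j = i then q j else 0)"
        by (intro sum.cong) (auto simp: bary_q)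
      then show ?thesis by simp
    qed
    moreover have "bary j (q i) \<ge> 0" for i j by (simp add: bary_q)
    ultimately have "q i \<in> S0" for i by (intro S0_I)
    then show ?case by auto
  qed (auto simp: F_S0)
  then show ?thesis by (auto simp: V_def)
qed

lemma S0_bounded: "bounded S0"
proof -
  have "S0 \<subseteq> cball 0 (\<Sum>i\<in>UNIV. norm (q i))"
  proof
    fix x assume x: "x \<in> S0"
    have nn: "\<And>i. bary i x \<ge> 0" using S0_nonneg[OF x] .
    have "x = (\<Sum>i\<in>UNIV. of_real (bary i x) * q i)" using x by (rule S0_eq)
    then have "norm x = norm (\<Sum>i\<in>UNIV. of_real (bary i x) * q i)" by (rule arg_cong)
    also have "\<dots> \<le> (\<Sum>i\<in>UNIV. norm (q i))"
    proof (intro sum_norm_le)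
      fix i
      have "bary i x \<le> (\<Sum>i\<in>UNIV. bary i x)" using nn by (intro member_le_sum) auto
      then have "bary i x \<le> 1" by (simp add: sum_bary)
      then show "norm (of_real (bary i x) * q i) \<le> norm (q i)" using nn
        by (auto simp: norm_mult intro!: mult_left_le_one_le)
    qed
    finally show "x \<in> cball 0 (\<Sum>i\<in>UNIV. norm (q i))" by simp
  qed
  then show ?thesis by (rule bounded_subset[OF bounded_cball])
qed

text \<open>Take a point of \<open>A\<close> farthest from \<open>B\<close> and write it as
  \<open>F i y\<close> with \<open>y\<close> in \<open>A\<close>. Since \<open>F i\<close> halves
  distances and maps \<open>B\<close> into itself, the largest distance is at most half of itself,
  hence 0.\<close>

lemma attractor_subset:
  assumes "A \<noteq> {}" "compact A" "A = (\<Union>i. F i ` A)" "B \<noteq> {}" "compact B" "B = (\<Union>i. F i ` B)"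
  shows "A \<subseteq> B"
proof -
  obtain x where x: "x \<in> A" "\<And>y. y \<in> A \<Longrightarrow> infdist y B \<le> infdist x B"
    using continuous_attains_sup[OF assms(2,1), of "\<lambda>x. infdist x B", OF continuous_on_infdist[OF continuous_on_id]]
    by auto
  obtain i y where y: "y \<in> A" "x = F i y" using equalityD1[OF assms(3), THEN subsetD, OF x(1)] by blast
  have cl: "closed B" using assms(5) compact_imp_closed by blast
  obtain z where z: "z \<in> B" "infdist y B = dist y z"
    using infdist_attains_inf[OF cl assms(4)] by metis
  have "infdist x B \<le> dist x (F i z)"
    by (rule infdist_le, rule equalityD2[OF assms(6), THEN subsetD]) (use z in blast)
  also have "\<dots> = dist y z / 2"
    by (simp add: y dist_norm sg_map_def diff_divide_distrib[symmetric] norm_divide)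
  also have "\<dots> \<le> infdist x B / 2" using x(2)[OF y(1)] z by simp
  finally have "infdist x B \<le> 0" by simp
  then have "infdist y B = 0" if "y \<in> A" for y using x(2)[OF that] infdist_nonneg[of y B] by linarith
  then show ?thesis using in_closed_iff_infdist_zero[OF cl assms(4)] by blast
qed

lemma closure_V_unfold: "closure V = (\<Union>i. closure (F i ` V))"
proof -
  have "closure V = closure (\<Union>i. F i ` V)" by (rule arg_cong[OF V_unfold])
  also have "\<dots> = closure (F 0 ` V \<union> F 1 ` V \<union> F 2 ` V)"
    unfolding UNIV_3_eq by (simp only: UN_insert UN_empty Un_empty_right Un_assoc)
  also have "\<dots> = (\<Union>i. closure (F i ` V))"
    unfolding UNIV_3_eq by (simp only: UN_insert UN_empty Un_empty_right Un_assoc closure_Un)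
  finally show ?thesis .
qed

text \<open>\<open>SG\<close> is a definite description, so nothing is known about it before
  existence and uniqueness are shown: the closure of V is an invariant compact set, and
  \<open>attractor_subset\<close> in both directions makes it the only one.\<close>

lemma SG_eq_closure: "K = closure V"
proof -
  have 1: "closure V \<noteq> {}"
  proof -
    have "q 0 \<in> V" unfolding V_def by (rule UN_I[of 0]) simp_all
    then show ?thesis using closure_subset by blast
  qed
  have 2: "compact (closure V)"
    using bounded_subset[OF S0_bounded V_S0] by (simp add: compact_closure)
  have 3: "closure V = (\<Union>i. F i ` closure V)"
    unfolding closure_F_image[symmetric]
    by (rule closure_V_unfold)
  show ?thesis
    unfolding SG_def
  proof (rule the_equality)
    fix A assume A: "A \<noteq> {} \<and> compact A \<and> A = (\<Union>i. F i ` A)"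
    show "A = closure V"
      using attractor_subset[OF conjunct1[OF A] conjunct1[OF conjunct2[OF A]] conjunct2[OF conjunct2[OF A]] 1 2 3]
        attractor_subset[OF 1 2 3 conjunct1[OF A] conjunct1[OF conjunct2[OF A]] conjunct2[OF conjunct2[OF A]]]
      by (rule equalityI)
  qed (intro conjI 1 2 3)
qed

lemma compact_SG: "compact K"
  using bounded_subset[OF S0_bounded V_S0] by (simp add: compact_closure SG_eq_closure)

lemma closed_SG: "closed K" using compact_SG compact_imp_closed by blast

lemma SG_unfold: "K = (\<Union>i. F i ` K)"
  unfolding SG_eq_closure closure_F_image[symmetric] by (rule closure_V_unfold)

lemma F_in_SG [intro, simp]: "x \<in> K \<Longrightarrow> F i x \<in> K"
  by (rule equalityD2[OF SG_unfold, THEN subsetD]) blast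

lemma V_subset_SG: "V \<subseteq> K" by (simp add: SG_eq_closure closure_subset)

lemma SG_subset_S0: "K \<subseteq> S0"
  unfolding SG_eq_closure by (rule closure_minimal[OF V_S0 closed_S0])

lemma vertices_subset_SG: "sg_vertices q m \<subseteq> K" using V_subset_SG unfolding V_def by blast

lemma q_in_SG [intro, simp]: "q i \<in> K" using vertices_subset_SG[of 0] by auto

lemma FW_in_SG [intro, simp]: "x \<in> K \<Longrightarrow> FW w x \<in> K" by (induction w) auto

text \<open>Two level-one cells meet only at the common midpoint. The coordinate
  \<open>bary j\<close> is at least 1/2 on the cell of \<open>j\<close>, while on the cell of
  \<open>i\<close> it is half of \<open>bary j x\<close>; hence \<open>bary j x\<close> is at least
  1 and \<open>x\<close> is the corner \<open>q j\<close>.\<close>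

lemma F_eq_F:
  assumes "x \<in> K" "y \<in> K" "F i x = F j y" "i \<noteq> j"
  shows "x = q j" "y = q i"
proof -
  have *: "x = q j" if "x \<in> K" "y \<in> K" "F i x = F j y" "i \<noteq> j" for x y i j
  proof -
    have S: "x \<in> S0" "y \<in> S0" using that SG_subset_S0 by blast+
    note nn = S0_nonneg[OF S(1)] S0_nonneg[OF S(2)] and x = S0_eq[OF S(1)]
    have "bary j (F i x) = bary j (F j y)" using that by simp
    then have "bary j x \<ge> 1" using nn(2)[of j] that(4) by (simp add: bary_F)
    moreover have "(\<Sum>k\<in>UNIV. bary k x) = bary j x + (\<Sum>k\<in>UNIV-{j}. bary k x)"
      by (subst sum.remove[of _ j]) auto
    ultimately have "(\<Sum>k\<in>UNIV-{j}. bary k x) \<le> 0" using sum_bary[of x] by linarith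
    moreover have "(\<Sum>k\<in>UNIV-{j}. bary k x) \<ge> 0" by (simp add: nn sum_nonneg)
    ultimately have 0: "(\<Sum>k\<in>UNIV-{j}. bary k x) = 0" by linarith
    then have "\<forall>k\<in>UNIV-{j}. bary k x = 0" using nn
      by (subst (asm) sum_nonneg_eq_0_iff) auto
    moreover have "bary j x = 1" using sum_bary[of x] 0
       \<open>(\<Sum>k\<in>UNIV. bary k x) = bary j x + (\<Sum>k\<in>UNIV-{j}. bary k x)\<close> by linarith
    ultimately have "x = (\<Sum>i\<in>UNIV. if i = j then q i else 0)"
      by (subst x) (intro sum.cong, auto)
    then show ?thesis by simp
  qed
  show "x = q j" using *[OF assms] .
  show "y = q i" using *[of y x j i] assms by auto
qed

end

section \<open>Energy\<close>

definition Qform :: "(3 \<Rightarrow> real) \<Rightarrow> (3 \<Rightarrow> real) \<Rightarrow> real" where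
  "Qform a b = (a 0 - a 1) * (b 0 - b 1) + (a 1 - a 2) * (b 1 - b 2) + (a 2 - a 0) * (b 2 - b 0)"

lemma Qform_add_left: "Qform (\<lambda>j. a j + b j) c = Qform a c + Qform b c"
  and Qform_scale_left: "Qform (\<lambda>j. r * a j) c = r * Qform a c"
  and Qform_commute: "Qform a b = Qform b a"
  by (simp_all add: Qform_def algebra_simps)

lemma Qform_nonneg: "0 \<le> Qform a a"
  unfolding Qform_def by (intro add_nonneg_nonneg zero_le_square)

lemma Qform_eq_0_imp_const: "Qform a a \<le> 0 \<Longrightarrow> a i = a j"
proof -
  assume Q: "Qform a a \<le> 0"
  have "(a 0 - a 1)\<^sup>2 + (a 1 - a 2)\<^sup>2 + (a 2 - a 0)\<^sup>2 \<le> 0"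
    using Q by (simp add: Qform_def power2_eq_square)
  then have "(a 0 - a 1)\<^sup>2 = 0" "(a 1 - a 2)\<^sup>2 = 0"
    using zero_le_power2[of "a 0 - a 1"] zero_le_power2[of "a 1 - a 2"] zero_le_power2[of "a 2 - a 0"]
    by linarith+
  then have "\<forall>i j. a i = a j" unfolding all_3 by simp
  then show ?thesis by blast
qed

text \<open>The \<open>1/5\<close>-\<open>2/5\<close> rule: boundary values on the cell of \<open>i\<close> of the harmonic function with boundary values \<open>a\<close>.\<close>

definition harm_cell :: "3 \<Rightarrow> (3 \<Rightarrow> real) \<Rightarrow> 3 \<Rightarrow> real" where
  "harm_cell i a j = (if j = i then a i else (a i + a j + (a 0 + a 1 + a 2)) / 5)"

lemma harm_cell_self [simp]: "harm_cell i a i = a i" by (simp add: harm_cell_def)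

lemma harm_cell_commute: "harm_cell i a j = harm_cell j a i"
  by (simp add: harm_cell_def)

text \<open>Here \<open>b i j\<close> is the value of a function at \<open>F i (q j)\<close>; the
  hypotheses say that it has corner values \<open>c\<close> and that its values at shared midpoints
  agree. The midpoint values drop out because the 1/5-2/5 rule makes the discrete Laplacian vanish
  at the midpoints, and 5/3 is the factor that keeps the energy of the extension unchanged.\<close>

lemma Qform_harm_cell:
  assumes "\<And>i. b i i = c i" "\<And>i j. b i j = b j i"
  shows "5/3 * (\<Sum>i\<in>UNIV. Qform (harm_cell i a) (b i)) = Qform a c"
proof -
  have e: "b 1 0 = b 0 1" "b 2 0 = b 0 2" "b 2 1 = b 1 2" by (rule assms(2))+
  show ?thesis
    unfolding sum_UNIV_3 Qform_def harm_cell_def e assms(1) by (simp add: field_simps)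
qed

text \<open>The energy of \<open>b\<close> minus the harmonic extension of its corner values is
  nonnegative, and by \<open>Qform_harm_cell\<close> the cross term and the energy of the extension
  both equal \<open>Qform c c\<close>.\<close>

lemma Qform_subdivide_ge:
  assumes "\<And>i. b i i = c i" "\<And>i j. b i j = b j i"
  shows "Qform c c \<le> 5/3 * (\<Sum>i\<in>UNIV. Qform (b i) (b i))"
proof -
  have expand: "Qform (\<lambda>j. x j + (-1) * y j) (\<lambda>j. x j + (-1) * y j) = Qform x x - 2 * Qform y x + Qform y y" for x y
    by (simp add: Qform_def algebra_simps)
  have "0 \<le> 5/3 * (\<Sum>i\<in>UNIV. Qform (\<lambda>j. b i j + (-1) * harm_cell i c j) (\<lambda>j. b i j + (-1) * harm_cell i c j))"
    by (intro mult_nonneg_nonneg sum_nonneg Qform_nonneg) simp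
  also have "\<dots> = 5/3 * (\<Sum>i\<in>UNIV. Qform (b i) (b i)) - 2 * (5/3 * (\<Sum>i\<in>UNIV. Qform (harm_cell i c) (b i)))
      + 5/3 * (\<Sum>i\<in>UNIV. Qform (harm_cell i c) (harm_cell i c))"
    unfolding expand by (simp add: sum.distrib sum_subtractf sum_distrib_left algebra_simps)
  also have "\<dots> = 5/3 * (\<Sum>i\<in>UNIV. Qform (b i) (b i)) - Qform c c"
    using Qform_harm_cell[OF assms, of c] Qform_harm_cell[of "\<lambda>i. harm_cell i c" c c, OF harm_cell_self harm_cell_commute]
    by simp
  finally show ?thesis by simp
qed

context gasket
begin

section \<open>Gluing functions across the three cells, and the recursive energy\<close>

definition Finv :: "3 \<Rightarrow> complex \<Rightarrow> complex" where "Finv i x = 2 * x - q i"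

lemma Finv_F [simp]: "Finv i (F i x) = x" by (simp add: Finv_def sg_map_def field_simps)

lemma continuous_on_Finv: "continuous_on S (Finv i)"
  unfolding Finv_def by (intro continuous_intros)

lemma SG_cases:
  assumes "x \<in> K" obtains i y where "y \<in> K" "x = F i y"
  using equalityD1[OF SG_unfold, THEN subsetD, OF assms] by blast

text \<open>A junction point lies in two cells and the choice between them is arbitrary; the
  compatibility hypothesis of \<open>glue_F\<close> makes it irrelevant.\<close>

definition glue :: "(3 \<Rightarrow> complex \<Rightarrow> real) \<Rightarrow> complex \<Rightarrow> real" where
  "glue g x = (let i = (SOME i. x \<in> F i ` K) in g i (Finv i x))"

lemma glue_F:
  assumes "\<And>i j. i \<noteq> j \<Longrightarrow> g i (q j) = g j (q i)" "x \<in> K"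
  shows "glue g (F i x) = g i x"
proof -
  define k where "k = (SOME k. F i x \<in> F k ` K)"
  have "F i x \<in> F k ` K" unfolding k_def by (rule someI[of _ i]) (use assms(2) in blast)
  then obtain y where y: "y \<in> K" "F i x = F k y" by blast
  have gl: "glue g (F i x) = g k y"
    unfolding glue_def Let_def k_def[symmetric] by (simp add: y(2))
  show ?thesis
  proof (cases "i = k")
    case True then show ?thesis using gl y by simp
  next
    case False
    have "x = q k" "y = q i" using F_eq_F[OF assms(2) y(1) y(2) False] by auto
    then show ?thesis using gl assms(1)[OF False] by simp
  qed
qed

lemma continuous_on_glue:
  assumes "\<And>i j. i \<noteq> j \<Longrightarrow> g i (q j) = g j (q i)" "\<And>i. continuous_on K (g i)"
  shows "continuous_on K (glue g)"
proof -
  have 1: "continuous_on (F i ` K) (glue g)" for i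
  proof -
    have "continuous_on (F i ` K) (g i \<circ> Finv i)"
      by (intro continuous_on_compose continuous_on_Finv) (simp add: image_image assms)
    then show ?thesis
      by (rule continuous_on_eq) (auto simp: glue_F[of g, OF assms(1)])
  qed
  have 2: "closed (F i ` K)" for i
    by (intro compact_imp_closed compact_continuous_image continuous_on_F compact_SG)
  have "continuous_on (\<Union>i\<in>UNIV. F i ` K) (glue g)"
    by (intro continuous_on_closed_Union 1 2) simp
  then show ?thesis by (rule continuous_on_subset[OF _ equalityD1[OF SG_unfold]])
qed

text \<open>The level energy as a bilinear form that recurses over the first letter of a word.
  Statements about level m+1 thus reduce to three statements about level m;
  \<open>energy_level_eq\<close> identifies it with the sum over edges.\<close>

primrec en :: "nat \<Rightarrow> (complex \<Rightarrow> real) \<Rightarrow> (complex \<Rightarrow> real) \<Rightarrow> real" where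
  "en 0 u v = Qform (u \<circ> q) (v \<circ> q)"
| "en (Suc m) u v = 5/3 * (\<Sum>i\<in>UNIV. en m (u \<circ> F i) (v \<circ> F i))"

lemma en_cong:
  assumes "\<And>x. x \<in> sg_vertices q m \<Longrightarrow> u x = u' x" "\<And>x. x \<in> sg_vertices q m \<Longrightarrow> v x = v' x"
  shows "en m u v = en m u' v'"
  using assms
proof (induction m arbitrary: u v u' v')
  case 0
  then have "u \<circ> q = u' \<circ> q" "v \<circ> q = v' \<circ> q" by auto
  then show ?case by simp
next
  case (Suc m)
  have "en m (u \<circ> F i) (v \<circ> F i) = en m (u' \<circ> F i) (v' \<circ> F i)" for i
    by (rule Suc.IH) (simp; rule Suc.prems; simp; blast)+
  then show ?case by simp
qed

lemma en_cong_SG: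
  assumes "\<And>x. x \<in> K \<Longrightarrow> u x = u' x" "\<And>x. x \<in> K \<Longrightarrow> v x = v' x"
  shows "en m u v = en m u' v'"
  by (rule en_cong) (use vertices_subset_SG assms in blast)+

lemma en_add_left: "en m (\<lambda>x. u x + v x) w = en m u w + en m v w"
proof (induction m arbitrary: u v w)
  case 0 then show ?case using Qform_add_left[of "u \<circ> q" "v \<circ> q" "w \<circ> q"] by (simp add: o_def)
next
  case (Suc m)
  then show ?case by (simp add: o_def sum.distrib distrib_left)
qed

lemma en_scale_left: "en m (\<lambda>x. r * u x) w = r * en m u w"
proof (induction m arbitrary: u w)
  case 0 then show ?case using Qform_scale_left[of r "u \<circ> q" "w \<circ> q"] by (simp add: o_def)
next
  case (Suc m)
  then show ?case by (simp add: o_def sum_distrib_left algebra_simps)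
qed

lemma en_commute: "en m u v = en m v u"
proof (induction m arbitrary: u v)
  case 0 then show ?case by (simp add: Qform_commute)
next
  case (Suc m)
  have "en m (u \<circ> F i) (v \<circ> F i) = en m (v \<circ> F i) (u \<circ> F i)" for i by (rule Suc.IH)
  then show ?case by simp
qed

lemma en_add_right: "en m w (\<lambda>x. u x + v x) = en m w u + en m w v"
  unfolding en_commute[of m w] by (rule en_add_left)
lemma en_scale_right: "en m w (\<lambda>x. r * u x) = r * en m w u"
  unfolding en_commute[of m w] by (rule en_scale_left)

lemma en_diff_left: "en m (\<lambda>x. u x - v x) w = en m u w - en m v w"
  using en_add_left[of m u "\<lambda>x. (-1) * v x" w] en_scale_left[of m "-1" v w] by simp
lemma en_diff_right: "en m w (\<lambda>x. u x - v x) = en m w u - en m w v"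
  unfolding en_commute[of m w] by (rule en_diff_left)

lemma en_nonneg: "0 \<le> en m u u"
  by (induction m arbitrary: u) (auto simp: Qform_nonneg intro!: mult_nonneg_nonneg sum_nonneg)

lemma en_Suc_mono: "en m u u \<le> en (Suc m) u u"
proof (induction m arbitrary: u)
  case 0
  show ?case unfolding en.simps
    by (rule Qform_subdivide_ge[of "\<lambda>i. u \<circ> F i \<circ> q"]) (simp_all add: F_q_commute)
next
  case (Suc m)
  show ?case unfolding en.simps(2)[of "Suc m"] en.simps(2)[of m u]
    by (intro mult_left_mono sum_mono Suc) simp
qed

lemma en_mono: "m \<le> n \<Longrightarrow> en m u u \<le> en n u u"
  by (rule lift_Suc_mono_le[of "\<lambda>m. en m u u"]) (rule en_Suc_mono)

text \<open>By monotonicity in the level, \<open>d\<close> has zero level-0 energy on each cell, so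
  it is constant on the corners of the cell of \<open>i\<close>. One of these is
  \<open>F i (q i) = q i\<close>, where \<open>d\<close> vanishes; hence zero boundary values pass
  to the cells.\<close>

lemma en_le_0_imp_vanish:
  assumes "en m d d \<le> 0" "\<And>i. d (q i) = 0" "x \<in> sg_vertices q m"
  shows "d x = 0"
  using assms
proof (induction m arbitrary: d x)
  case 0 then show ?case by auto
next
  case (Suc m)
  have sm: "(\<Sum>i\<in>UNIV. en m (d \<circ> F i) (d \<circ> F i)) \<le> 0" using Suc.prems(1) by simp
  have le: "en m (d \<circ> F i) (d \<circ> F i) \<le> 0" for i
    using member_le_sum[of i UNIV "\<lambda>i. en m (d \<circ> F i) (d \<circ> F i)"] sm en_nonneg by fastforce
  from Suc.prems(3) obtain i y where y: "y \<in> sg_vertices q m" "x = F i y" by auto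
  have "en 0 (d \<circ> F i) (d \<circ> F i) \<le> 0" using en_mono[of 0 m "d \<circ> F i"] le[of i] by simp
  then have "Qform (d \<circ> F i \<circ> q) (d \<circ> F i \<circ> q) \<le> 0" by simp
  then have "(d \<circ> F i \<circ> q) j = (d \<circ> F i \<circ> q) i" for j
    by (rule Qform_eq_0_imp_const)
  then have "(d \<circ> F i) (q j) = 0" for j using Suc.prems(2) by simp
  then have "(d \<circ> F i) y = 0" by (intro Suc.IH[OF le _ y(1)])
  then show ?case using y by simp
qed

lemma continuous_on_SG_eqI:
  fixes u v :: "complex \<Rightarrow> real"
  assumes "continuous_on K u" "continuous_on K v" "\<And>x. x \<in> V \<Longrightarrow> u x = v x" "x \<in> K"
  shows "u x = v x"
proof -
  have "continuous_on (closure V) (\<lambda>x. u x - v x)"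
    using assms SG_eq_closure by (intro continuous_intros) auto
  then have "u x - v x = 0"
    by (rule continuous_constant_on_closure[where S=V]) (use assms SG_eq_closure in auto)
  then show ?thesis by simp
qed

lemma zero_energy_imp_vanish:
  assumes "continuous_on K d" "\<And>m. en m d d \<le> 0" "\<And>i. d (q i) = 0" "x \<in> K"
  shows "d x = 0"
  by (rule continuous_on_SG_eqI[of d "\<lambda>_. 0"])
    (use assms en_le_0_imp_vanish[OF assms(2,3)] in \<open>auto simp: V_def\<close>)

section \<open>Agreement of the recursive energy with the sum over edges, and limit energies\<close>

definition edges :: "nat \<Rightarrow> (complex \<times> complex) set" where
  "edges m = {(x, y). sg_adj q m x y}"

lemma edges_0: "edges 0 = (\<lambda>(i, j). (q i, q j)) ` {(i, j). i \<noteq> j}"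
  by (auto simp: edges_def sg_adj_def)

lemma edges_Suc: "edges (Suc m) = (\<Union>i. (\<lambda>(x, y). (F i x, F i y)) ` edges m)"
proof -
  have "sg_adj q (Suc m) x y \<longleftrightarrow> (\<exists>i a b. x = F i a \<and> y = F i b \<and> sg_adj q m a b)" for x y
  proof
    assume "sg_adj q (Suc m) x y"
    then obtain w where w: "length w = Suc m" "x \<noteq> y" "x \<in> FW w ` range q" "y \<in> FW w ` range q"
      by (auto simp: sg_adj_def)
    then obtain i w' where w': "w = i # w'" "length w' = m" by (auto simp: length_Suc_conv)
    from w w' obtain j k where "x = F i (FW w' (q j))" "y = F i (FW w' (q k))" by auto
    with w w' show "\<exists>i a b. x = F i a \<and> y = F i b \<and> sg_adj q m a b"
      unfolding sg_adj_def by (intro exI[of _ i] exI[of _ "FW w' (q j)"] exI[of _ "FW w' (q k)"]) auto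
  next
    assume "\<exists>i a b. x = F i a \<and> y = F i b \<and> sg_adj q m a b"
    then obtain i a b w where *: "x = F i a" "y = F i b" "a \<noteq> b" "length w = m"
      "a \<in> FW w ` range q" "b \<in> FW w ` range q"
      by (auto simp: sg_adj_def)
    then have "x \<noteq> y" "length (i # w) = Suc m" "x \<in> FW (i # w) ` range q" "y \<in> FW (i # w) ` range q"
      by auto
    then show "sg_adj q (Suc m) x y" unfolding sg_adj_def sg_vertices.simps by blast
  qed
  then show ?thesis unfolding edges_def by fastforce
qed

lemma edges_SG: "(x, y) \<in> edges m \<Longrightarrow> x \<in> K \<and> y \<in> K \<and> x \<noteq> y"
  by (auto simp: edges_def sg_adj_def)

lemma finite_edges: "finite (edges m)"
  by (induction m) (auto simp: edges_0 edges_Suc)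

lemma sum_edges: "(\<Sum>(x, y)\<in>edges m. (u x - u y)\<^sup>2) = 2 * (3/5) ^ m * en m u u"
proof (induction m arbitrary: u)
  case 0
  have P: "{(i, j). i \<noteq> (j::3)} = {(0,1),(0,2),(1,0),(1,2),(2,0),(2,1)}"
  proof -
    have "\<forall>i j. (i, j) \<in> {(i, j). i \<noteq> (j::3)} \<longleftrightarrow> (i, j) \<in> {(0,1),(0,2),(1,0),(1,2),(2,0),(2,1)}"
      unfolding all_3 by simp
    then show ?thesis by auto
  qed
  have "(\<Sum>(x, y)\<in>edges 0. (u x - u y)\<^sup>2) = (\<Sum>(i, j)\<in>{(i, j). i \<noteq> j}. (u (q i) - u (q j))\<^sup>2)"
    unfolding edges_0 by (subst sum.reindex) (auto simp: inj_on_def case_prod_unfold)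
  also have "\<dots> = 2 * en 0 u u"
    unfolding P by (simp add: Qform_def power2_eq_square algebra_simps)
  finally show ?case by simp
next
  case (Suc m)
  let ?g = "\<lambda>i (x, y). (F i x, F i y)"
  have "(\<Sum>(x, y)\<in>edges (Suc m). (u x - u y)\<^sup>2) = (\<Sum>i\<in>UNIV. \<Sum>(x, y)\<in>?g i ` edges m. (u x - u y)\<^sup>2)"
    unfolding edges_Suc
  proof (rule sum.UNION_disjoint)
    show "\<forall>i\<in>UNIV. \<forall>j\<in>UNIV. i \<noteq> j \<longrightarrow> ?g i ` edges m \<inter> ?g j ` edges m = {}"
    proof (intro ballI impI)
      fix i j :: 3 assume ij: "i \<noteq> j"
      \<comment> \<open>An edge common to two cells would have both endpoints at their only common
        point.\<close>
      have False if "(a, b) \<in> edges m" "(c, d) \<in> edges m" "F i a = F j c" "F i b = F j d" for a b c d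
        using F_eq_F(1)[of a c i j] F_eq_F(1)[of b d i j] edges_SG[OF that(1)] edges_SG[OF that(2)] that ij
        by simp
      then show "?g i ` edges m \<inter> ?g j ` edges m = {}" by fastforce
    qed
  qed (auto simp: finite_edges)
  also have "\<dots> = (\<Sum>i\<in>UNIV. \<Sum>(x, y)\<in>edges m. ((u \<circ> F i) x - (u \<circ> F i) y)\<^sup>2)"
  proof (rule sum.cong[OF refl])
    fix i :: 3
    have "inj_on (?g i) (edges m)" by (auto simp: inj_on_def)
    then show "(\<Sum>(x, y)\<in>?g i ` edges m. (u x - u y)\<^sup>2) = (\<Sum>(x, y)\<in>edges m. ((u \<circ> F i) x - (u \<circ> F i) y)\<^sup>2)"
      by (subst sum.reindex) (auto simp: case_prod_unfold)
  qed
  also have "\<dots> = (\<Sum>i\<in>UNIV. 2 * (3/5) ^ m * en m (u \<circ> F i) (u \<circ> F i))"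
    by (simp only: Suc.IH)
  also have "\<dots> = 2 * (3/5) ^ Suc m * en (Suc m) u u" by (simp add: sum_distrib_left mult.assoc)
  finally show ?case .
qed

lemma energy_level_eq: "energy_level q m u = en m u u"
  unfolding energy_level_def edges_def[symmetric] sum_edges
  by (simp add: power_mult_distrib[symmetric] mult.assoc[symmetric])

lemma tendsto_energy_ereal: "(\<lambda>m. ereal (en m u u)) \<longlonglongrightarrow> energy q u"
proof -
  have "incseq (\<lambda>m. ereal (en m u u))" using en_mono by (auto simp: incseq_def)
  then have *: "(\<lambda>m. ereal (en m u u)) \<longlonglongrightarrow> (SUP m. ereal (en m u u))" by (rule LIMSEQ_SUP)
  then show ?thesis unfolding energy_def energy_level_eq limI[OF *] .
qed

lemma en_le_energy: "ereal (en m u u) \<le> energy q u"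
  by (rule Lim_bounded2[OF tendsto_energy_ereal, of m]) (use en_mono in auto)

lemma energy_finite_iff: "energy q u < \<infinity> \<longleftrightarrow> (\<exists>B. \<forall>m. en m u u \<le> B)"
proof
  assume *: "energy q u < \<infinity>"
  have "0 \<le> energy q u" using en_le_energy[of 0 u] en_nonneg[of 0 u] by (metis ereal_less_eq(5) order_trans)
  then obtain B where "energy q u = ereal B" using * by (cases "energy q u") auto
  then show "\<exists>B. \<forall>m. en m u u \<le> B" using en_le_energy[of _ u] by (intro exI[of _ B] allI) simp
next
  assume "\<exists>B. \<forall>m. en m u u \<le> B"
  then obtain B where "\<forall>m. en m u u \<le> B" by blast
  then have "energy q u \<le> ereal B" by (intro Lim_bounded[OF tendsto_energy_ereal, of 0]) simp
  also have "ereal B < \<infinity>" by simp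
  finally show "energy q u < \<infinity>" .
qed

lemma dom_energy_iff: "u \<in> dom_energy q \<longleftrightarrow> continuous_on K u \<and> (\<exists>B. \<forall>m. en m u u \<le> B)"
  unfolding dom_energy_def energy_finite_iff by simp

lemma dom_energy_continuous: "u \<in> dom_energy q \<Longrightarrow> continuous_on K u"
  by (simp add: dom_energy_iff)

lemma tendsto_energy:
  assumes "u \<in> dom_energy q"
  shows "(\<lambda>m. en m u u) \<longlonglongrightarrow> real_of_ereal (energy q u)" "energy q u = ereal (real_of_ereal (energy q u))"
proof -
  have "0 \<le> energy q u" using en_le_energy[of 0 u] en_nonneg[of 0 u] by (metis ereal_less_eq(5) order_trans)
  then show 1: "energy q u = ereal (real_of_ereal (energy q u))" using assms
    by (cases "energy q u") (auto simp: dom_energy_def)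
  show "(\<lambda>m. en m u u) \<longlonglongrightarrow> real_of_ereal (energy q u)"
    using tendsto_energy_ereal[of u] by (subst (asm) 1) simp
qed

lemma dom_energy_scale: "u \<in> dom_energy q \<Longrightarrow> (\<lambda>x. r * u x) \<in> dom_energy q"
proof -
  assume "u \<in> dom_energy q"
  then obtain B where B: "continuous_on K u" "\<And>m. en m u u \<le> B" by (auto simp: dom_energy_iff)
  have "en m (\<lambda>x. r * u x) (\<lambda>x. r * u x) \<le> r * (r * B)" for m
    unfolding en_scale_left en_scale_right using mult_left_mono[OF B(2)[of m] zero_le_square[of r]]
    by (simp add: mult.assoc)
  then show ?thesis using B(1) by (auto simp: dom_energy_iff intro!: continuous_intros)
qed

lemma dom_energy_add:
  assumes "u \<in> dom_energy q" "v \<in> dom_energy q" shows "(\<lambda>x. u x + v x) \<in> dom_energy q"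
proof -
  obtain B C where B: "continuous_on K u" "\<And>m. en m u u \<le> B" "continuous_on K v" "\<And>m. en m v v \<le> C"
    using assms by (auto simp: dom_energy_iff)
  have "en m (\<lambda>x. u x + v x) (\<lambda>x. u x + v x) \<le> 2 * B + 2 * C" for m
  proof -
    have "0 \<le> en m (\<lambda>x. u x - v x) (\<lambda>x. u x - v x)" by (rule en_nonneg)
    then show ?thesis using B(2,4)[of m]
      unfolding en_add_left en_add_right en_diff_left en_diff_right en_commute[of m v u] by linarith
  qed
  then show ?thesis using B by (auto simp: dom_energy_iff intro!: continuous_intros)
qed

lemma dom_energy_diff:
  "u \<in> dom_energy q \<Longrightarrow> v \<in> dom_energy q \<Longrightarrow> (\<lambda>x. u x - v x) \<in> dom_energy q"
  using dom_energy_add[of u "\<lambda>x. (-1) * v x"] dom_energy_scale[of v "-1"] by simp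

lemma tendsto_energy_form:
  assumes "u \<in> dom_energy q" "v \<in> dom_energy q"
  shows "(\<lambda>m. en m u v) \<longlonglongrightarrow> energy_form q u v"
proof -
  have "en m u v = (en m (\<lambda>x. u x + v x) (\<lambda>x. u x + v x) - en m (\<lambda>x. u x - v x) (\<lambda>x. u x - v x)) / 4" for m
    unfolding en_add_left en_add_right en_diff_left en_diff_right en_commute[of m v u] by simp
  then show ?thesis unfolding energy_form_def
    by (simp only:) (intro tendsto_intros tendsto_energy dom_energy_add dom_energy_diff assms; simp)
qed

end

section \<open>Harmonic functions and splines\<close>

lemma harm_cell_linear:
  "harm_cell i (\<lambda>j. r * a j + b j) = (\<lambda>j. r * harm_cell i a j + harm_cell i b j)"
  by (rule ext) (simp add: harm_cell_def field_simps)

lemma harm_cell_bounds: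
  assumes "\<And>j. lo \<le> a j" "\<And>j. a j \<le> hi"
  shows "lo \<le> harm_cell i a j" "harm_cell i a j \<le> hi"
  using assms(1)[of 0] assms(1)[of 1] assms(1)[of 2] assms(1)[of i] assms(1)[of j]
    assms(2)[of 0] assms(2)[of 1] assms(2)[of 2] assms(2)[of i] assms(2)[of j]
  by (auto simp: harm_cell_def)

text \<open>A seminorm measuring oscillation of boundary values. It contracts by 3/5 from a cell to
  its subcells, which is what makes the series for harmonic functions converge
  geometrically.\<close>

definition osc3 :: "(3 \<Rightarrow> real) \<Rightarrow> real" where
  "osc3 a = \<bar>a 0 - a 1\<bar> + \<bar>a 1 - a 2\<bar> + \<bar>a 2 - a 0\<bar>"

lemma osc3_harm_cell: "osc3 (harm_cell i a) \<le> 3/5 * osc3 a"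
proof -
  have "\<forall>i. osc3 (harm_cell i a) \<le> 3/5 * osc3 a"
    unfolding all_3 osc3_def harm_cell_def
    by (auto simp: field_simps abs_if)
  then show ?thesis by blast
qed

context gasket
begin

text \<open>The iterates of the system form a series dominated by a geometric one with ratio \<open>\<theta>\<close>.
  It is used with \<open>\<rho> = 1\<close> to build the harmonic functions and with \<open>\<rho> = 3/5\<close> to build Green potentials,
  with the cells of the gasket as index set.\<close>

lemma self_similar_system_exists:
  fixes child :: "'a \<Rightarrow> 3 \<Rightarrow> 'a" and g :: "'a \<Rightarrow> 3 \<Rightarrow> complex \<Rightarrow> real" and N :: "'a \<Rightarrow> real"
  assumes cont: "\<And>k i. continuous_on K (g k i)"
    and compat: "\<And>k i j. i \<noteq> j \<Longrightarrow> g k i (q j) = g k j (q i)"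
    and zero: "\<And>k i. g k i (q i) = 0"
    and bound: "\<And>k i x. x \<in> K \<Longrightarrow> \<bar>g k i x\<bar> \<le> N k"
    and decay: "\<And>k i. \<rho> * N (child k i) \<le> \<theta> * N k"
    and params: "0 \<le> \<rho>" "0 \<le> \<theta>" "\<theta> < 1"
  shows "\<exists>u. \<forall>k. continuous_on K (u k) \<and> (\<forall>i. u k (q i) = 0) \<and>
           (\<forall>i. \<forall>x\<in>K. u k (F i x) = g k i x + \<rho> * u (child k i) x)"
proof -
  \<comment> \<open>The n-th term of the series: unfolding the equation for \<open>u k\<close> n
    times leaves the forcing term \<open>g\<close>, carried to the cells of level n and weighted by
    the n-th power of \<rho>. It vanishes at the three corners, which keeps each glueing
    compatible.\<close>
  define d where "d = rec_nat (\<lambda>k. glue (g k)) (\<lambda>n D k. glue (\<lambda>i x. \<rho> * D (child k i) x))"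
  have d0: "d 0 k = glue (g k)" for k by (simp add: d_def)
  have dS: "d (Suc n) k = glue (\<lambda>i x. \<rho> * d n (child k i) x)" for n k by (simp add: d_def)
  have d0F: "d 0 k (F i x) = g k i x" if "x \<in> K" for k i x
    unfolding d0 using that by (intro glue_F compat)
  have all: "continuous_on K (d n k) \<and> (\<forall>i. d n k (q i) = 0) \<and> (\<forall>x\<in>K. \<bar>d n k x\<bar> \<le> \<theta> ^ n * N k)" for n k
  proof (induction n arbitrary: k)
    case 0
    have "continuous_on K (d 0 k)" unfolding d0 by (intro continuous_on_glue compat cont)
    moreover have "d 0 k (q i) = 0" for i using d0F[of "q i" k i] zero by simp
    moreover have "\<bar>d 0 k x\<bar> \<le> \<theta> ^ 0 * N k" if "x \<in> K" for x
      using that by (rule SG_cases) (simp add: d0F bound)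
    ultimately show ?case by blast
  next
    case (Suc n)
    have IH: "continuous_on K (d n k)" "d n k (q i) = 0" "x \<in> K \<Longrightarrow> \<bar>d n k x\<bar> \<le> \<theta> ^ n * N k" for k i x
      using Suc by auto
    have dSF: "d (Suc n) k (F i x) = \<rho> * d n (child k i) x" if "x \<in> K" for k i x
      unfolding dS using that by (intro glue_F) (simp_all add: IH(2))
    have "continuous_on K (d (Suc n) k)" unfolding dS
      by (intro continuous_on_glue continuous_intros IH(1)) (simp add: IH(2))
    moreover have "d (Suc n) k (q i) = 0" for i using dSF[of "q i" k i] IH(2) by simp
    moreover have "\<bar>d (Suc n) k x\<bar> \<le> \<theta> ^ Suc n * N k" if x: "x \<in> K" for x
    proof -
      obtain i y where y: "y \<in> K" "x = F i y" using x by (rule SG_cases)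
      have "\<bar>d (Suc n) k x\<bar> = \<rho> * \<bar>d n (child k i) y\<bar>"
        using params by (simp add: y dSF abs_mult)
      also have "\<dots> \<le> \<rho> * (\<theta> ^ n * N (child k i))"
        by (intro mult_left_mono IH(3) y params)
      also have "\<dots> = \<theta> ^ n * (\<rho> * N (child k i))" by simp
      also have "\<dots> \<le> \<theta> ^ n * (\<theta> * N k)"
        by (intro mult_left_mono decay zero_le_power params)
      finally show ?thesis by (simp add: mult.assoc mult.left_commute)
    qed
    ultimately show ?case by blast
  qed
  have dc: "continuous_on K (d n k)" and dz: "d n k (q i) = 0"
    and db: "x \<in> K \<Longrightarrow> \<bar>d n k x\<bar> \<le> \<theta> ^ n * N k" for n k i x
    using all by blast+
  have dSF: "d (Suc n) k (F i x) = \<rho> * d n (child k i) x" if "x \<in> K" for n k i x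
    unfolding dS using that by (intro glue_F) (simp_all add: dz)
  have sM: "summable (\<lambda>n. \<theta> ^ n * N k)" for k
    using params by (intro summable_mult2 summable_geometric) simp
  have sd: "summable (\<lambda>n. d n k x)" if "x \<in> K" for k x
    by (rule summable_comparison_test'[OF sM[of k], of 0]) (simp add: db that)
  define u where "u k x = (\<Sum>n. d n k x)" for k x
  have "continuous_on K (u k)" for k
  proof -
    have "uniform_limit K (\<lambda>n x. \<Sum>i<n. d i k x) (\<lambda>x. \<Sum>i. d i k x) sequentially"
      by (rule Weierstrass_m_test[OF _ sM[of k]]) (simp add: db)
    then have "continuous_on K (\<lambda>x. \<Sum>i. d i k x)"
      by (rule uniform_limit_theorem[rotated]) (auto intro!: continuous_intros dc always_eventually)
    then show ?thesis by (simp add: u_def[abs_def])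
  qed
  moreover have "u k (q i) = 0" for k i by (simp add: u_def dz)
  moreover have "u k (F i x) = g k i x + \<rho> * u (child k i) x" if x: "x \<in> K" for k i x
  proof -
    have "u k (F i x) = (\<Sum>n. d (Suc n) k (F i x)) + d 0 k (F i x)"
      unfolding u_def using suminf_split_head[OF sd[of "F i x" k]] x by simp
    also have "(\<Sum>n. d (Suc n) k (F i x)) = \<rho> * u (child k i) x"
      unfolding u_def using suminf_mult[OF sd[OF x], of \<rho> "child k i"] x by (simp add: dSF)
    finally show ?thesis by (simp add: d0F x)
  qed
  ultimately show ?thesis by (intro exI[of _ u] allI conjI ballI)
qed

lemma SG_bary_nonneg: "x \<in> K \<Longrightarrow> bary i x \<ge> 0"
  using SG_subset_S0 S0_nonneg by blast

text \<open>The harmonic function is sought as the affine interpolant \<open>A a\<close> plus a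
  correction. The forcing term \<open>g\<close> is the failure of \<open>A\<close> to obey the
  1/5-2/5 rule: on the cell of \<open>i\<close> the affine function has corner values
  \<open>(a i + a j) / 2\<close> instead of \<open>harm_cell i a j\<close>. It is bounded by
  \<open>osc3 a\<close>, so the general series lemma applies with \<rho> = 1 and ratio 3/5.\<close>

lemma harm_exists:
  "\<exists>h. \<forall>a. continuous_on K (h a) \<and> (\<forall>i. h a (q i) = a i) \<and>
        (\<forall>i. \<forall>x\<in>K. h a (F i x) = h (harm_cell i a) x)"
proof -
  define A where "A a x = (\<Sum>j\<in>UNIV. a j * bary j x)" for a :: "3 \<Rightarrow> real" and x
  define g where "g a i x = A (harm_cell i a) x - A a (F i x)" for a i x
  have Aq: "A a (q i) = a i" for a i
  proof -
    have "A a (q i) = (\<Sum>j\<in>UNIV. if j = i then a j else 0)" unfolding A_def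
      by (intro sum.cong) (auto simp: bary_q)
    then show ?thesis by simp
  qed
  have AF: "A a (F i x) = (\<Sum>j\<in>UNIV. ((a i + a j) / 2) * bary j x)" for a i x
  proof -
    have "A a (F i x) = (\<Sum>j\<in>UNIV. (a j / 2) * bary j x) + (\<Sum>j\<in>UNIV. if j = i then a j / 2 else 0)"
      unfolding A_def sum.distrib[symmetric] by (intro sum.cong) (auto simp: bary_F field_simps)
    also have "(\<Sum>j\<in>UNIV. if j = i then a j / 2 else 0) = (a i / 2) * (\<Sum>j\<in>UNIV. bary j x)"
      by (simp add: sum_bary)
    also have "\<dots> = (\<Sum>j\<in>UNIV. (a i / 2) * bary j x)" by (rule sum_distrib_left)
    finally show ?thesis unfolding sum.distrib[symmetric] by (simp add: algebra_simps add_divide_distrib)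
  qed
  have gb: "\<bar>g a i x\<bar> \<le> osc3 a" if x: "x \<in> K" for a i x
  proof -
    have le: "\<bar>harm_cell i a j - (a i + a j) / 2\<bar> \<le> osc3 a" for j
    proof -
      have "\<forall>i j. \<bar>harm_cell i a j - (a i + a j) / 2\<bar> \<le> osc3 a"
        unfolding all_3 osc3_def harm_cell_def by (auto simp: field_simps abs_if)
      then show ?thesis by blast
    qed
    have "g a i x = (\<Sum>j\<in>UNIV. (harm_cell i a j - (a i + a j) / 2) * bary j x)"
      unfolding g_def AF unfolding A_def sum_subtractf[symmetric] by (simp add: left_diff_distrib)
    also have "\<bar>\<dots>\<bar> \<le> (\<Sum>j\<in>UNIV. osc3 a * bary j x)"
      by (rule order_trans[OF sum_abs], rule sum_mono)
        (simp add: abs_mult SG_bary_nonneg[OF x] mult_right_mono le)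
    also have "\<dots> = osc3 a" unfolding sum_distrib_left[symmetric] sum_bary by simp
    finally show ?thesis .
  qed
  have Acont: "continuous_on S (A a)" for S a
    unfolding A_def by (intro continuous_intros continuous_on_bary)
  have gcont: "continuous_on K (g a i)" for a i
    unfolding g_def
    by (intro continuous_intros Acont continuous_on_compose2[OF Acont continuous_on_F subset_UNIV])
  have "\<exists>u. \<forall>a. continuous_on K (u a) \<and> (\<forall>i. u a (q i) = 0) \<and>
           (\<forall>i. \<forall>x\<in>K. u a (F i x) = g a i x + 1 * u (harm_cell i a) x)"
  proof (rule self_similar_system_exists[where N=osc3 and \<theta>="3/5"])
    show "g a i (q j) = g a j (q i)" for a i j
      unfolding g_def Aq F_q_commute[of i j] harm_cell_commute[of i a j] ..
    show "g a i (q i) = 0" for a i by (simp add: g_def Aq)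
    show "1 * osc3 (harm_cell i a) \<le> 3/5 * osc3 a" for a i using osc3_harm_cell by simp
  qed (simp_all add: gcont gb)
  then obtain u where u: "\<And>a. continuous_on K (u a)" "\<And>a i. u a (q i) = 0"
      "\<And>a i x. x \<in> K \<Longrightarrow> u a (F i x) = g a i x + 1 * u (harm_cell i a) x"
    by blast
  show ?thesis
    by (rule exI[of _ "\<lambda>a x. A a x + u a x"])
      (auto simp: u Aq g_def intro!: continuous_intros Acont)
qed

definition harm :: "(3 \<Rightarrow> real) \<Rightarrow> complex \<Rightarrow> real" where
  "harm = (SOME h. \<forall>a. continuous_on K (h a) \<and> (\<forall>i. h a (q i) = a i) \<and>
        (\<forall>i. \<forall>x\<in>K. h a (F i x) = h (harm_cell i a) x))"

lemma continuous_on_harm: "continuous_on K (harm a)"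
  and harm_q [simp]: "harm a (q i) = a i"
  and harm_F: "x \<in> K \<Longrightarrow> harm a (F i x) = harm (harm_cell i a) x"
  using someI_ex[OF harm_exists, folded harm_def] by blast+

lemma V_induct [consumes 1, case_names vertex cell]:
  assumes "x \<in> V" "\<And>i. P (q i)" "\<And>i y. y \<in> V \<Longrightarrow> P y \<Longrightarrow> P (F i y)"
  shows "P x"
proof -
  have "x \<in> sg_vertices q m \<Longrightarrow> P x" for m
  proof (induction m arbitrary: x)
    case 0 then show ?case using assms(2) by auto
  next
    case (Suc m)
    from Suc.prems obtain i y where y: "y \<in> sg_vertices q m" "x = F i y" by auto
    have "y \<in> V" unfolding V_def using y(1) by blast
    then show ?case unfolding y(2) by (rule assms(3)) (rule Suc.IH[OF y(1)])
  qed
  then show ?thesis using assms(1) by (auto simp: V_def)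
qed

lemma harm_linear:
  assumes "x \<in> K" shows "harm (\<lambda>j. r * a j + b j) x = r * harm a x + harm b x"
proof (rule continuous_on_SG_eqI[OF _ _ _ assms])
  show "continuous_on K (harm (\<lambda>j. r * a j + b j))" by (rule continuous_on_harm)
  show "continuous_on K (\<lambda>x. r * harm a x + harm b x)" by (intro continuous_intros continuous_on_harm)
  fix x assume "x \<in> V"
  \<comment> \<open>Passing to a cell changes the boundary values, so the induction needs all
    \<open>a\<close> and \<open>b\<close> at once.\<close>
  then have "\<forall>a b. harm (\<lambda>j. r * a j + b j) x = r * harm a x + harm b x"
  proof (induction rule: V_induct)
    case (cell i y)
    have "y \<in> K" using cell(1) V_subset_SG by blast
    then show ?case using cell(2) by (simp add: harm_F harm_cell_linear)
  qed simp
  then show "harm (\<lambda>j. r * a j + b j) x = r * harm a x + harm b x" by blast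
qed

lemma harm_bounds:
  assumes "x \<in> K" "\<And>j. lo \<le> a j" "\<And>j. a j \<le> hi"
  shows "lo \<le> harm a x \<and> harm a x \<le> hi"
proof -
  have *: "\<forall>a :: 3 \<Rightarrow> real. (\<forall>j. lo \<le> a j \<and> a j \<le> hi) \<longrightarrow> lo \<le> harm a x \<and> harm a x \<le> hi" if "x \<in> V" for x
    using that
  proof (induction rule: V_induct)
    case (cell i y)
    show ?case
    proof (intro allI impI)
      fix a :: "3 \<Rightarrow> real" assume a: "\<forall>j. lo \<le> a j \<and> a j \<le> hi"
      have "y \<in> K" using cell(1) V_subset_SG by blast
      moreover have "\<forall>j. lo \<le> harm_cell i a j \<and> harm_cell i a j \<le> hi"
        using a harm_cell_bounds[of lo a hi i] by blast
      ultimately show "lo \<le> harm a (F i y) \<and> harm a (F i y) \<le> hi"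
        using cell(2) by (simp add: harm_F)
    qed
  qed simp
  have c: "continuous_on (closure V) (harm a)" and x: "x \<in> closure V"
    using continuous_on_harm assms(1) by (simp_all add: SG_eq_closure)
  have "lo \<le> harm a x" by (rule continuous_ge_on_closure[OF c x]) (use * assms in blast)
  moreover have "harm a x \<le> hi" by (rule continuous_le_on_closure[OF c x]) (use * assms in blast)
  ultimately show ?thesis by blast
qed

lemma harm_const: "x \<in> K \<Longrightarrow> harm (\<lambda>_. c) x = c"
  using harm_bounds[of x c "\<lambda>_. c" c] by simp

lemma harm_sum_basis:
  assumes "x \<in> K"
  shows "harm a x = (\<Sum>j\<in>UNIV. a j * harm (\<lambda>k. if k = j then 1 else 0) x)"
proof -
  let ?e = "\<lambda>j k. if k = j then 1 else (0::real)"
  have "\<forall>k. a k = a 0 * ?e 0 k + (a 1 * ?e 1 k + (a 2 * ?e 2 k + 0))"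
    unfolding all_3 by simp
  then have "a = (\<lambda>k. a 0 * ?e 0 k + (a 1 * ?e 1 k + (a 2 * ?e 2 k + 0)))"
    by (intro ext) (rule spec)
  then have "harm a x = harm (\<lambda>k. a 0 * ?e 0 k + (a 1 * ?e 1 k + (a 2 * ?e 2 k + 0))) x" by (rule arg_cong)
  also have "\<dots> = a 0 * harm (?e 0) x + (a 1 * harm (?e 1) x + (a 2 * harm (?e 2) x + harm (\<lambda>_. 0) x))"
    by (simp only: harm_linear[OF assms])
  finally show ?thesis by (simp add: sum_UNIV_3 harm_const assms)
qed

text \<open>\<open>Qform_harm_cell\<close> iterated: against a harmonic function only the boundary
  values of \<open>v\<close> count, and the pairing is the same at every level.\<close>

lemma en_harm: "en n (harm a) v = Qform a (v \<circ> q)"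
proof (induction n arbitrary: a v)
  case 0
  have "harm a \<circ> q = a" by auto
  then show ?case by (simp add: o_def)
next
  case (Suc n)
  have "en n (harm a \<circ> F i) (v \<circ> F i) = Qform (harm_cell i a) (v \<circ> F i \<circ> q)" for i
  proof -
    have "en n (harm a \<circ> F i) (v \<circ> F i) = en n (harm (harm_cell i a)) (v \<circ> F i)"
      by (rule en_cong_SG) (simp_all add: harm_F)
    then show ?thesis by (simp only: Suc.IH)
  qed
  then show ?case using Qform_harm_cell[of "\<lambda>i. v \<circ> F i \<circ> q" "v \<circ> q" a]
    by (simp add: F_q_commute o_def)
qed

lemma harm_dom_energy: "harm a \<in> dom_energy q"
  unfolding dom_energy_iff by (auto simp: continuous_on_harm en_harm o_def)

lemma energy_harm: "energy q (harm a) = ereal (Qform a a)"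
proof (rule LIMSEQ_unique[OF tendsto_energy_ereal])
  show "(\<lambda>m. ereal (en m (harm a) (harm a))) \<longlonglongrightarrow> ereal (Qform a a)" by (simp add: en_harm o_def)
qed

lemma harmonic_harm: "harmonic q (harm a)"
  unfolding harmonic_def
proof (intro conjI ballI impI harm_dom_energy)
  fix v assume "\<forall>p\<in>sg_vertices q 0. v p = harm a p"
  then have "v \<circ> q = a" by auto
  then show "energy q (harm a) \<le> energy q v" using en_le_energy[of 0 v] by (simp add: energy_harm)
qed

text \<open>With \<open>a\<close> the boundary values of \<open>u\<close>, \<open>en_harm\<close>
  evaluates the cross term, so the energy of \<open>u - harm a\<close> is that of \<open>u\<close>
  minus \<open>Qform a a\<close>. Least energy makes this at most 0, and a function of zero energy
  with zero boundary values vanishes.\<close>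

lemma harmonic_imp_harm:
  assumes "harmonic q u" "x \<in> K" shows "u x = harm (u \<circ> q) x"
proof -
  define a where "a = u \<circ> q"
  have u: "u \<in> dom_energy q" and le: "energy q u \<le> energy q (harm a)"
    using assms harm_dom_energy[of a] unfolding harmonic_def by (auto simp: a_def)
  have "u x - harm a x = 0"
  proof (rule zero_energy_imp_vanish[OF _ _ _ assms(2), of "\<lambda>x. u x - harm a x"])
    show "continuous_on K (\<lambda>x. u x - harm a x)"
      by (intro continuous_intros continuous_on_harm dom_energy_continuous u)
    fix m
    have "ereal (en m u u) \<le> ereal (Qform a a)"
      using order_trans[OF en_le_energy le] by (simp add: energy_harm)
    moreover have "harm a \<circ> q = a" by auto
    ultimately show "en m (\<lambda>x. u x - harm a x) (\<lambda>x. u x - harm a x) \<le> 0"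
      unfolding en_diff_left en_diff_right en_commute[of m u "harm a"] en_harm a_def[symmetric] by simp
  qed (simp add: a_def)
  then show ?thesis by (simp add: a_def)
qed

lemma harmonic_basis_eq:
  assumes "x \<in> K" shows "harmonic_basis q j x = harm (\<lambda>i. if i = j then 1 else 0) x"
proof -
  have "harmonic q (harmonic_basis q j) \<and> (\<forall>i. harmonic_basis q j (q i) = (if i = j then 1 else 0))"
    unfolding harmonic_basis_def
    by (rule someI[of _ "harm (\<lambda>i. if i = j then 1 else 0)"]) (simp add: harmonic_harm)
  moreover from this have "harmonic_basis q j \<circ> q = (\<lambda>i. if i = j then 1 else 0)" by auto
  ultimately show ?thesis using harmonic_imp_harm[OF _ assms] by metis
qed

text \<open>The continuous function that agrees with \<open>v\<close> on V_n and is harmonic on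
  every cell of level n. It depends on \<open>v\<close> only through V_n, just as
  \<open>en n\<close> does.\<close>

primrec spline :: "nat \<Rightarrow> (complex \<Rightarrow> real) \<Rightarrow> complex \<Rightarrow> real" where
  "spline 0 v = harm (v \<circ> q)"
| "spline (Suc n) v = glue (\<lambda>i. spline n (v \<circ> F i))"

lemma spline_continuous_q: "continuous_on K (spline n v) \<and> (\<forall>i. spline n v (q i) = v (q i))"
proof (induction n arbitrary: v)
  case 0 then show ?case by (simp add: continuous_on_harm)
next
  case (Suc n)
  have compat: "spline n (v \<circ> F i) (q j) = spline n (v \<circ> F j) (q i)" for i j
    using Suc by (simp add: F_q_commute)
  have "spline (Suc n) v (q i) = v (q i)" for i
    using glue_F[of "\<lambda>i. spline n (v \<circ> F i)", OF compat, of "q i" i] Suc by simp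
  then show ?case using Suc compat by (auto intro!: continuous_on_glue)
qed

lemma continuous_on_spline: "continuous_on K (spline n v)" using spline_continuous_q by blast

lemma spline_F: "x \<in> K \<Longrightarrow> spline (Suc n) v (F i x) = spline n (v \<circ> F i) x"
  unfolding spline.simps by (rule glue_F) (simp_all add: spline_continuous_q F_q_commute)

lemma spline_FW:
  assumes "x \<in> K" shows "spline (length w) v (FW w x) = harm (v \<circ> FW w \<circ> q) x"
proof (induction w arbitrary: v)
  case (Cons i w)
  show ?case using Cons[of "v \<circ> F i"] assms by (simp add: spline_F o_def del: spline.simps)
qed simp

lemma SG_word_cases:
  assumes "x \<in> K" obtains w y where "length w = n" "y \<in> K" "x = FW w y"
proof -
  have "\<exists>w y. length w = n \<and> y \<in> K \<and> x = FW w y" using assms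
  proof (induction n arbitrary: x)
    case 0 then show ?case by auto
  next
    case (Suc n)
    obtain i y where y: "y \<in> K" "x = F i y" using Suc.prems by (rule SG_cases)
    obtain w z where "length w = n" "z \<in> K" "y = FW w z" using Suc.IH[OF y(1)] by blast
    then show ?case using y by (intro exI[of _ "i # w"] exI[of _ z]) simp
  qed
  then show ?thesis using that by blast
qed

lemma vertices_eq_words: "sg_vertices q m = {FW w (q i) | w i. length w = m}"
proof (induction m)
  case (Suc m)
  show ?case unfolding sg_vertices.simps Suc
  proof (intro equalityI subsetI)
    fix x assume "x \<in> {FW w (q i) | w i. length w = Suc m}"
    then obtain w i where "length w = Suc m" "x = FW w (q i)" by blast
    then show "x \<in> (\<Union>i. F i ` {FW w (q i) | w i. length w = m})"
      by (cases w) auto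
  next
    fix x assume "x \<in> (\<Union>i. F i ` {FW w (q i) | w i. length w = m})"
    then obtain j w i where "length w = m" "x = F j (FW w (q i))" by blast
    then show "x \<in> {FW w (q i) | w i. length w = Suc m}"
      by (intro CollectI exI[of _ "j # w"] exI[of _ i]) simp
  qed
qed auto

lemma spline_linear:
  assumes "x \<in> K" shows "spline n (\<lambda>x. r * u x + v x) x = r * spline n u x + spline n v x"
proof -
  obtain w y where w: "length w = n" "y \<in> K" "x = FW w y" using assms by (rule SG_word_cases)
  show ?thesis using spline_FW[OF w(2), of w] harm_linear[OF w(2), of r "u \<circ> FW w \<circ> q" "v \<circ> FW w \<circ> q"]
    by (simp add: w o_def)
qed

lemma dist_FW: "dist (FW w x) (FW w y) = dist x y / 2 ^ length w"
proof (induction w)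
  case (Cons i w)
  have "dist (F i a) (F i b) = dist a b / 2" for a b
    by (simp add: dist_norm sg_map_def diff_divide_distrib[symmetric] norm_divide)
  from this[of "FW w x" "FW w y"] show ?case unfolding sg_word.simps o_apply Cons by simp
qed simp

text \<open>On a cell of level n the maximum principle keeps the interpolant between the extreme
  corner values; cells have diameter at most \<open>D / 2^n\<close>, and uniform continuity does the
  rest.\<close>

lemma spline_uniform_approx:
  assumes "continuous_on K v" "e > 0"
  shows "\<exists>N. \<forall>n\<ge>N. \<forall>x\<in>K. \<bar>spline n v x - v x\<bar> \<le> e"
proof -
  have "uniformly_continuous_on K v" by (rule compact_uniformly_continuous[OF assms(1) compact_SG])
  then obtain d where d: "d > 0" "\<And>x y. x \<in> K \<Longrightarrow> y \<in> K \<Longrightarrow> dist x y < d \<Longrightarrow> dist (v x) (v y) < e"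
    unfolding uniformly_continuous_on_def using assms(2) by metis
  obtain D where D: "\<And>x y. x \<in> K \<Longrightarrow> y \<in> K \<Longrightarrow> dist x y \<le> D"
    using bounded_two_points[of K] compact_imp_bounded[OF compact_SG] by blast
  obtain N where N: "D / d < 2 ^ N" using real_arch_pow[of 2 "D / d"] by auto
  have "\<bar>spline n v x - v x\<bar> \<le> e" if n: "n \<ge> N" and x: "x \<in> K" for n x
  proof -
    obtain w y where w: "length w = n" "y \<in> K" "x = FW w y" using x by (rule SG_word_cases)
    have "dist (v (FW w (q j))) (v x) < e" for j
    proof (rule d(2))
      have "dist (FW w (q j)) x \<le> D / 2 ^ n"
        unfolding w(3) dist_FW w(1) by (intro divide_right_mono D w) auto
      also have "\<dots> < d"
      proof -
        have "(2::real) ^ N \<le> 2 ^ n" using n by (intro power_increasing) auto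
        then have "D / d < 2 ^ n" using N by linarith
        then show ?thesis using d(1) by (simp add: field_simps)
      qed
      finally show "dist (FW w (q j)) x < d" .
    qed (use w x in auto)
    then have b: "\<bar>v (FW w (q j)) - v x\<bar> < e" for j by (simp add: dist_real_def)
    have "v x - e \<le> harm (v \<circ> FW w \<circ> q) y \<and> harm (v \<circ> FW w \<circ> q) y \<le> v x + e"
    proof (rule harm_bounds[OF w(2)])
      show "v x - e \<le> (v \<circ> FW w \<circ> q) j" "(v \<circ> FW w \<circ> q) j \<le> v x + e" for j
        using b[of j] by auto
    qed
    moreover have "spline n v x = harm (v \<circ> FW w \<circ> q) y" using spline_FW[OF w(2), of w v] w by simp
    ultimately show ?thesis by (simp add: abs_le_iff)
  qed
  then show ?thesis by blast
qed

lemma spline_cong: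
  assumes "x \<in> K" "\<And>p. p \<in> sg_vertices q n \<Longrightarrow> u p = v p" shows "spline n u x = spline n v x"
proof -
  obtain w y where w: "length w = n" "y \<in> K" "x = FW w y" using assms(1) by (rule SG_word_cases)
  have "u (FW w (q i)) = v (FW w (q i))" for i using w(1) by (intro assms(2)) (auto simp: vertices_eq_words)
  then have "u \<circ> FW w \<circ> q = v \<circ> FW w \<circ> q" by auto
  then show ?thesis using spline_FW[OF w(2), of w u] spline_FW[OF w(2), of w v] w by simp
qed

lemma spline_1_harm:
  assumes "x \<in> K" shows "spline 1 (harm a) x = harm a x"
proof -
  obtain i y where y: "y \<in> K" "x = F i y" using assms by (rule SG_cases)
  have "harm a \<circ> F i \<circ> q = harm_cell i a" by (auto simp: harm_F)
  then show ?thesis using spline_F[OF y(1), of 0 "harm a" i] y by (simp add: harm_F del: spline.simps(2))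
qed

lemma spline_bounds:
  assumes "x \<in> K" "\<And>p. p \<in> K \<Longrightarrow> lo \<le> v p" "\<And>p. p \<in> K \<Longrightarrow> v p \<le> hi"
  shows "lo \<le> spline n v x \<and> spline n v x \<le> hi"
proof -
  obtain w y where w: "length w = n" "y \<in> K" "x = FW w y" using assms(1) by (rule SG_word_cases)
  have "lo \<le> harm (v \<circ> FW w \<circ> q) y \<and> harm (v \<circ> FW w \<circ> q) y \<le> hi"
    by (rule harm_bounds[OF w(2)]) (simp_all add: assms)
  then show ?thesis using spline_FW[OF w(2), of w v] w by simp
qed

lemma spline_diff:
  assumes "x \<in> K" shows "spline n (\<lambda>x. u x - v x) x = spline n u x - spline n v x"
  using spline_linear[OF assms, of n "-1" v u] by simp

text \<open>Discontinuous itself and used only through vertex values;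
  \<open>spline 1 (vtent p)\<close> is the piecewise harmonic tent at \<open>p\<close>.\<close>

definition vtent :: "complex \<Rightarrow> complex \<Rightarrow> real" where "vtent p x = (if x = p then 1 else 0)"

lemma vertices_1_cases:
  assumes "p \<in> sg_vertices q 1"
  obtains i where "p = q i" | "p = F 0 (q 1)" | "p = F 0 (q 2)" | "p = F 1 (q 2)"
proof -
  obtain i j where p: "p = F i (q j)" using assms by auto
  have "\<forall>i j. (\<exists>k. F i (q j) = q k) \<or> F i (q j) = F 0 (q 1) \<or> F i (q j) = F 0 (q 2) \<or> F i (q j) = F 1 (q 2)"
    unfolding all_3 using F_q_commute[of 1 0] F_q_commute[of 2 0] F_q_commute[of 2 1] F_q_self by metis
  then show ?thesis using p that by metis
qed

lemma F_q_eq_iff: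
  assumes "i \<noteq> j" shows "F k (q l) = F i (q j) \<longleftrightarrow> (k = i \<and> l = j) \<or> (k = j \<and> l = i)"
proof
  assume *: "F k (q l) = F i (q j)"
  show "(k = i \<and> l = j) \<or> (k = j \<and> l = i)"
  proof (cases "k = i")
    case True with * show ?thesis by simp
  next
    case False
    from F_eq_F[OF _ _ * False] show ?thesis by simp
  qed
qed (use F_q_commute in auto)

lemma q_eq_F_q_iff: "q k = F i (q j) \<longleftrightarrow> k = i \<and> k = j"
proof
  assume *: "q k = F i (q j)"
  then have **: "F k (q k) = F i (q j)" unfolding F_q_self .
  show "k = i \<and> k = j"
  proof (cases "k = i")
    case True with ** show ?thesis by (simp only: F_eq_iff q_eq_iff)
  next
    case False
    from F_eq_F(1)[OF _ _ ** False] F_eq_F(2)[OF _ _ ** False] show ?thesis by simp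
  qed
qed auto

lemma q_neq_F_q: "i \<noteq> j \<Longrightarrow> q k \<noteq> F i (q j)"
  by (metis q_eq_F_q_iff)

text \<open>The left side is piecewise harmonic of level one and vanishes at the corners, so it is a
  combination of the three midpoint tents; the coefficients are the deviations of \<open>v\<close>
  from the 1/5-2/5 rule. The nesting and the final \<open>+ 0\<close> fit the shape
  \<open>r * u + v\<close> of the linearity lemmas.\<close>

lemma spline_1_expand:
  assumes "x \<in> K"
  shows "spline 1 v x - harm (v \<circ> q) x =
     (v (F 0 (q 1)) - harm_cell 0 (v \<circ> q) 1) * spline 1 (vtent (F 0 (q 1))) x +
     ((v (F 0 (q 2)) - harm_cell 0 (v \<circ> q) 2) * spline 1 (vtent (F 0 (q 2))) x +
     ((v (F 1 (q 2)) - harm_cell 1 (v \<circ> q) 2) * spline 1 (vtent (F 1 (q 2))) x + 0))"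
    (is "?L = ?a * ?A + (?b * ?B + (?c * ?C + 0))")
proof -
  have z: "spline 1 (\<lambda>_. 0) x = 0" using spline_bounds[OF assms, of 0 "\<lambda>_. 0" 0 1] by (simp del: spline.simps One_nat_def)
  have "?L = spline 1 (\<lambda>x. v x - harm (v \<circ> q) x) x"
    unfolding spline_diff[OF assms] spline_1_harm[OF assms] ..
  also have "\<dots> = spline 1 (\<lambda>x. ?a * vtent (F 0 (q 1)) x + (?b * vtent (F 0 (q 2)) x + (?c * vtent (F 1 (q 2)) x + 0))) x"
  proof (rule spline_cong[OF assms])
    fix p assume "p \<in> sg_vertices q 1"
    then show "v p - harm (v \<circ> q) p = ?a * vtent (F 0 (q 1)) p + (?b * vtent (F 0 (q 2)) p + (?c * vtent (F 1 (q 2)) p + 0))"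
      by (rule vertices_1_cases) (simp_all add: vtent_def q_neq_F_q F_q_eq_iff harm_F)
  qed
  also have "\<dots> = ?a * ?A + (?b * ?B + (?c * ?C + 0))"
    unfolding spline_linear[OF assms] z ..
  finally show ?thesis .
qed

section \<open>Transplanting functions to cells\<close>

primrec winv :: "3 list \<Rightarrow> complex \<Rightarrow> complex" where
  "winv [] x = x"
| "winv (i # w) x = winv w (Finv i x)"

lemma winv_FW [simp]: "winv w (FW w x) = x" by (induction w arbitrary: x) auto

lemma FW_eq_iff [simp]: "FW w x = FW w y \<longleftrightarrow> x = y" by (metis winv_FW)

lemma continuous_on_FW: "continuous_on S (FW w)"
proof (induction w)
  case (Cons i w)
  then show ?case unfolding sg_word.simps by (rule continuous_on_compose[OF _ continuous_on_F])
qed (simp add: continuous_on_id id_def)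

lemma continuous_on_winv: "continuous_on S (winv w)"
proof (induction w arbitrary: S)
  case (Cons i w)
  have "winv (i # w) = winv w \<circ> Finv i" by auto
  then show ?case using continuous_on_compose[OF continuous_on_Finv Cons] by metis
qed (simp add: continuous_on_id id_def)

definition cell :: "3 list \<Rightarrow> complex set" where "cell w = FW w ` K"

lemma cell_Nil [simp]: "cell [] = K" by (simp add: cell_def)

lemma closed_cell: "closed (cell w)"
  unfolding cell_def by (intro compact_imp_closed compact_continuous_image continuous_on_FW compact_SG)

lemma cell_subset: "cell w \<subseteq> K" by (auto simp: cell_def)

lemma cell_append_subset: "cell (w @ v) \<subseteq> cell w"
  by (auto simp: cell_def sg_word_append)

definition ext :: "3 list \<Rightarrow> (complex \<Rightarrow> real) \<Rightarrow> complex \<Rightarrow> real" where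
  "ext w v x = (if x \<in> cell w then v (winv w x) else 0)"

lemma ext_FW: "y \<in> K \<Longrightarrow> ext w v (FW w y) = v y" by (simp add: ext_def cell_def)

lemma ext_bound: "(\<And>x. x \<in> K \<Longrightarrow> \<bar>v x\<bar> \<le> B) \<Longrightarrow> 0 \<le> B \<Longrightarrow> \<bar>ext w v x\<bar> \<le> B * indicator (cell w) x"
  by (auto simp: ext_def cell_def)

lemma ext_cong: "(\<And>x. x \<in> K \<Longrightarrow> u x = v x) \<Longrightarrow> ext w u = ext w v"
  unfolding fun_eq_iff by (auto simp: ext_def cell_def)

lemma ext_linear: "ext w (\<lambda>x. r * u x + v x) = (\<lambda>x. r * ext w u x + ext w v x)"
  by (auto simp: ext_def)

text \<open>The excluded points are the midpoints inside the cell, which belong to two subcells and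
  would be counted twice. They are finitely many, hence null for the measure.\<close>

lemma ext_split:
  assumes "\<And>i j. i \<noteq> j \<Longrightarrow> x \<noteq> FW w (F i (q j))"
  shows "ext w v x = (\<Sum>i\<in>UNIV. ext (w @ [i]) (v \<circ> F i) x)"
proof (cases "x \<in> cell w")
  case True
  then obtain y where y: "y \<in> K" "x = FW w y" by (auto simp: cell_def)
  obtain i z where z: "z \<in> K" "y = F i z" using y(1) by (rule SG_cases)
  have "ext (w @ [k]) (v \<circ> F k) x = (if k = i then v y else 0)" for k
  proof (cases "k = i")
    case True
    have "x = FW (w @ [i]) z" using y z by (simp add: sg_word_append)
    then show ?thesis using True z by (simp add: ext_FW)
  next
    case False
    have "x \<notin> cell (w @ [k])"
    proof
      assume "x \<in> cell (w @ [k])"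
      then obtain z' where z': "z' \<in> K" "x = FW w (F k z')" by (auto simp: cell_def sg_word_append)
      then have e: "F k z' = F i z" using y z by simp
      from F_eq_F(1)[OF z'(1) z(1) e False] have "x = FW w (F k (q i))" using z' by simp
      then show False using assms[OF False] by simp
    qed
    then show ?thesis using False by (simp add: ext_def)
  qed
  then show ?thesis using y by (simp add: ext_FW)
next
  case False
  then have "ext (w @ [k]) (v \<circ> F k) x = 0" for k using cell_append_subset[of w "[k]"] by (auto simp: ext_def)
  then show ?thesis using False by (simp add: ext_def)
qed

lemma ext_measurable:
  assumes "continuous_on K v" shows "ext w v \<in> borel_measurable borel"
proof -
  have "continuous_on (cell w) (v \<circ> winv w)"
    by (intro continuous_on_compose continuous_on_winv continuous_on_subset[OF assms]) (auto simp: cell_def)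
  then have "(\<lambda>x. indicator (cell w) x *\<^sub>R (v \<circ> winv w) x) \<in> borel_measurable borel"
    by (intro borel_measurable_continuous_on_indicator) (use closed_cell in auto)
  moreover have "(\<lambda>x. indicator (cell w) x *\<^sub>R (v \<circ> winv w) x) = ext w v"
    by (auto simp: ext_def indicator_def)
  ultimately show ?thesis by simp
qed

lemma continuous_SG_bounded:
  fixes v :: "complex \<Rightarrow> real"
  assumes "continuous_on K v" obtains B where "0 \<le> B" "\<And>x. x \<in> K \<Longrightarrow> \<bar>v x\<bar> \<le> B"
proof -
  have "bounded (v ` K)" by (intro compact_imp_bounded compact_continuous_image assms compact_SG)
  then obtain B where "\<And>x. x \<in> K \<Longrightarrow> \<bar>v x\<bar> \<le> B" by (auto simp: bounded_iff)
  then show ?thesis using that[of "max 0 B"] by (meson max.cobounded1 max.coboundedI2)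
qed

end

section \<open>Green potentials\<close>

locale gasket_measure = gasket +
  fixes \<zeta> :: "complex measure"
  assumes fpc: "finite_positive_continuous_measure q \<zeta>"
begin

lemma sets_zeta: "sets \<zeta> = sets (restrict_space borel K)"
  using fpc by (simp add: finite_positive_continuous_measure_def)

lemma space_zeta: "space \<zeta> = K"
  using sets_eq_imp_space_eq[OF sets_zeta] by (simp add: space_restrict_space)

sublocale zeta: finite_measure \<zeta>
  using fpc by (simp add: finite_positive_continuous_measure_def)

lemma in_sets_zeta: "A \<in> sets borel \<Longrightarrow> A \<subseteq> K \<Longrightarrow> A \<in> sets \<zeta>"
  unfolding sets_zeta by (subst sets_restrict_space_iff) (use closed_SG in auto)

lemma measurable_zeta: "f \<in> borel_measurable borel \<Longrightarrow> f \<in> borel_measurable \<zeta>"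
  unfolding measurable_cong_sets[OF sets_zeta refl] by (rule measurable_restrict_space1)

lemma cell_in_sets: "cell w \<in> sets \<zeta>"
  by (rule in_sets_zeta) (use closed_cell cell_subset in auto)

lemma cell_positive: "emeasure \<zeta> (cell w) > 0"
  using fpc by (simp add: finite_positive_continuous_measure_def cell_def)

lemma finite_null: "finite A \<Longrightarrow> A \<subseteq> K \<Longrightarrow> A \<in> null_sets \<zeta>"
proof (induction A rule: finite_induct)
  case (insert x A)
  have "{x} \<in> null_sets \<zeta>"
    using fpc insert by (intro null_setsI in_sets_zeta) (auto simp: finite_positive_continuous_measure_def)
  then show ?case using insert null_sets.Un[of "{x}" \<zeta> A] by simp
qed simp

lemma AE_not_finite: "finite A \<Longrightarrow> A \<subseteq> K \<Longrightarrow> AE x in \<zeta>. x \<notin> A"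
  using finite_null[THEN AE_not_in] by blast

lemma square_integrable_imp_integrable: "square_integrable \<zeta> f \<Longrightarrow> integrable \<zeta> f"
  unfolding square_integrable_def
proof (elim conjE)
  assume f: "f \<in> borel_measurable \<zeta>" "integrable \<zeta> (\<lambda>x. (f x)\<^sup>2)"
  show "integrable \<zeta> f"
  proof (rule Bochner_Integration.integrable_bound[of _ "\<lambda>x. 1 + (f x)\<^sup>2"])
    show "integrable \<zeta> (\<lambda>x. 1 + (f x)\<^sup>2)" using f by simp
    have "\<bar>t\<bar> \<le> 1 + t\<^sup>2" for t :: real
      using zero_le_power2[of "\<bar>t\<bar> - 1"] zero_le_power2[of t] by (simp add: power2_diff)
    then show "AE x in \<zeta>. norm (f x) \<le> norm (1 + (f x)\<^sup>2)" by (auto simp: abs_of_nonneg)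
  qed (rule f)
qed

text \<open>The integral over the cell of \<open>w\<close> as a functional on functions on the whole
  gasket. It takes the place of integration against a rescaled copy of the measure.\<close>

definition L :: "(complex \<Rightarrow> real) \<Rightarrow> 3 list \<Rightarrow> (complex \<Rightarrow> real) \<Rightarrow> real" where
  "L f w v = (\<integral>x. f x * ext w v x \<partial>\<zeta>)"

lemma L_integrable:
  assumes "integrable \<zeta> f" "continuous_on K v" shows "integrable \<zeta> (\<lambda>x. f x * ext w v x)"
proof -
  obtain B where B: "0 \<le> B" "\<And>x. x \<in> K \<Longrightarrow> \<bar>v x\<bar> \<le> B" using continuous_SG_bounded[OF assms(2)] by blast
  show ?thesis
  proof (rule Bochner_Integration.integrable_bound[of _ "\<lambda>x. f x * B"])
    show "integrable \<zeta> (\<lambda>x. f x * B)" using assms(1) by simp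
    show "(\<lambda>x. f x * ext w v x) \<in> borel_measurable \<zeta>"
      using measurable_zeta[OF ext_measurable[OF assms(2)]] assms(1) by (intro borel_measurable_times) auto
    have "\<bar>ext w v x\<bar> \<le> B" for x using B by (auto simp: ext_def cell_def)
    then show "AE x in \<zeta>. norm (f x * ext w v x) \<le> norm (f x * B)"
      using B(1) by (auto simp: abs_mult intro!: mult_left_mono)
  qed
qed

definition mass :: "(complex \<Rightarrow> real) \<Rightarrow> 3 list \<Rightarrow> real" where
  "mass f w = (\<integral>x. \<bar>f x\<bar> * indicator (cell w) x \<partial>\<zeta>)"

lemma mass_integrable:
  fixes f :: "complex \<Rightarrow> real" shows "integrable \<zeta> f \<Longrightarrow> integrable \<zeta> (\<lambda>x. \<bar>f x\<bar> * indicator (cell w) x)"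
  using integrable_mult_indicator[OF cell_in_sets, of "\<lambda>x. \<bar>f x\<bar>" w] by (simp add: mult.commute)

lemma L_bound:
  assumes "integrable \<zeta> f" "continuous_on K v" "0 \<le> B" "\<And>x. x \<in> K \<Longrightarrow> \<bar>v x\<bar> \<le> B"
  shows "\<bar>L f w v\<bar> \<le> B * mass f w"
proof -
  have "norm (L f w v) \<le> (\<integral>x. B * (\<bar>f x\<bar> * indicator (cell w) x) \<partial>\<zeta>)"
    unfolding L_def
  proof (rule order_trans[OF integral_norm_bound], rule integral_mono)
    show "integrable \<zeta> (\<lambda>x. norm (f x * ext w v x))"
      using L_integrable[OF assms(1,2)] by (rule integrable_norm)
    show "integrable \<zeta> (\<lambda>x. B * (\<bar>f x\<bar> * indicator (cell w) x))"
      using mass_integrable[OF assms(1)] by simp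
    show "norm (f x * ext w v x) \<le> B * (\<bar>f x\<bar> * indicator (cell w) x)" for x
      using mult_left_mono[OF ext_bound[of v B w x, OF assms(4,3)], of "\<bar>f x\<bar>"]
      by (simp add: abs_mult algebra_simps)
  qed
  then show ?thesis by (simp add: mass_def)
qed

lemma mass_nonneg: "0 \<le> mass f w" unfolding mass_def by (intro integral_nonneg_AE) auto

lemma mass_le: "integrable \<zeta> f \<Longrightarrow> mass f w \<le> (\<integral>x. \<bar>f x\<bar> \<partial>\<zeta>)"
  unfolding mass_def by (intro integral_mono mass_integrable) (auto simp: indicator_def)

lemma L_cong: "(\<And>x. x \<in> K \<Longrightarrow> u x = v x) \<Longrightarrow> L f w u = L f w v"
  unfolding L_def using ext_cong[of u v w] by simp

lemma L_linear:
  assumes "integrable \<zeta> f" "continuous_on K u" "continuous_on K v"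
  shows "L f w (\<lambda>x. r * u x + v x) = r * L f w u + L f w v"
proof -
  have "L f w (\<lambda>x. r * u x + v x) = (\<integral>x. r * (f x * ext w u x) + f x * ext w v x \<partial>\<zeta>)"
    unfolding L_def ext_linear by (simp add: algebra_simps)
  also have "\<dots> = r * L f w u + L f w v"
    unfolding L_def using L_integrable[OF assms(1,2)] L_integrable[OF assms(1,3)] by simp
  finally show ?thesis .
qed

lemma L_diff:
  assumes "integrable \<zeta> f" "continuous_on K u" "continuous_on K v"
  shows "L f w (\<lambda>x. u x - v x) = L f w u - L f w v"
  using L_linear[OF assms(1,3,2), of w "-1"] by simp

lemma L_zero: "L f w (\<lambda>_. 0) = 0" by (simp add: L_def ext_def)

lemma L_split:
  assumes "integrable \<zeta> f" "continuous_on K v"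
  shows "L f w v = (\<Sum>i\<in>UNIV. L f (w @ [i]) (v \<circ> F i))"
proof -
  have c: "continuous_on K (v \<circ> F i)" for i
    by (intro continuous_on_compose continuous_on_F continuous_on_subset[OF assms(2)]) auto
  let ?J = "(\<lambda>(i, j). FW w (F i (q j))) ` UNIV"
  have "AE x in \<zeta>. x \<notin> ?J" by (rule AE_not_finite) auto
  then have "L f w v = (\<integral>x. (\<Sum>i\<in>UNIV. f x * ext (w @ [i]) (v \<circ> F i) x) \<partial>\<zeta>)"
    unfolding L_def
  proof (intro integral_cong_AE)
    show "(\<lambda>x. f x * ext w v x) \<in> borel_measurable \<zeta>"
      using L_integrable[OF assms] by auto
    show "(\<lambda>x. \<Sum>i\<in>UNIV. f x * ext (w @ [i]) (v \<circ> F i) x) \<in> borel_measurable \<zeta>"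
      using L_integrable[OF assms(1) c] by (intro borel_measurable_sum) auto
    show "AE x in \<zeta>. f x * ext w v x = (\<Sum>i\<in>UNIV. f x * ext (w @ [i]) (v \<circ> F i) x)" if "AE x in \<zeta>. x \<notin> ?J"
      using that
    proof eventually_elim
      case (elim x)
      then have "ext w v x = (\<Sum>i\<in>UNIV. ext (w @ [i]) (v \<circ> F i) x)" by (intro ext_split) auto
      then show ?case by (simp add: sum_distrib_left)
    qed
  qed
  also have "\<dots> = (\<Sum>i\<in>UNIV. L f (w @ [i]) (v \<circ> F i))"
    unfolding L_def by (rule Bochner_Integration.integral_sum) (rule L_integrable[OF assms(1) c])
  finally show ?thesis .
qed

definition tent_moment :: "(complex \<Rightarrow> real) \<Rightarrow> 3 list \<Rightarrow> 3 \<Rightarrow> 3 \<Rightarrow> real" where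
  "tent_moment f w i j = L f w (spline 1 (vtent (F i (q j))))"

text \<open>The values at the three midpoints of a cell that solve the level-one problem
  \<open>4 t\<^sub>k - t\<^sub>l - t\<^sub>m = - (3/5) \<cdot> moment of the k-th tent\<close>; the factor \<open>3/5\<close> is the energy
  scaling of one subdivision.\<close>

definition green_data :: "(complex \<Rightarrow> real) \<Rightarrow> 3 list \<Rightarrow> 3 \<Rightarrow> 3 \<Rightarrow> real" where
  "green_data f w i j = (if j = i then 0 else
     - (3/25) * (tent_moment f w i j + (tent_moment f w 0 1 + tent_moment f w 0 2 + tent_moment f w 1 2) / 2))"

lemma tent_moment_commute: "tent_moment f w i j = tent_moment f w j i"
  by (simp only: tent_moment_def F_q_commute)

lemma green_data_commute: "green_data f w i j = green_data f w j i"
  by (auto simp: green_data_def tent_moment_commute)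

lemma green_data_self [simp]: "green_data f w i i = 0" by (simp add: green_data_def)

text \<open>Both sides vanish when \<open>v\<close> obeys the 1/5-2/5 rule, so only midpoint tents
  matter, and for these the claim is the level-one system of \<open>green_data\<close>. Adding its
  three equations gives twice the sum of the t_k as -3/5 times the sum S of the moments;
  substituting back yields t_k = -(3/25) (moment_k + S/2).\<close>

lemma green_data_form:
  assumes "integrable \<zeta> f"
  shows "5/3 * (\<Sum>i\<in>UNIV. Qform (green_data f w i) (v \<circ> F i \<circ> q)) = - L f w (\<lambda>x. spline 1 v x - harm (v \<circ> q) x)"
proof -
  let ?a = "v (F 0 (q 1)) - harm_cell 0 (v \<circ> q) 1"
  let ?b = "v (F 0 (q 2)) - harm_cell 0 (v \<circ> q) 2"
  let ?c = "v (F 1 (q 2)) - harm_cell 1 (v \<circ> q) 2"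
  have "L f w (\<lambda>x. spline 1 v x - harm (v \<circ> q) x) = L f w (\<lambda>x.
     ?a * spline 1 (vtent (F 0 (q 1))) x + (?b * spline 1 (vtent (F 0 (q 2))) x +
     (?c * spline 1 (vtent (F 1 (q 2))) x + 0)))"
    by (rule L_cong) (rule spline_1_expand)
  also have "\<dots> = ?a * tent_moment f w 0 1 + (?b * tent_moment f w 0 2 + (?c * tent_moment f w 1 2 + 0))"
    unfolding tent_moment_def
    by (simp only: L_linear[OF assms] L_zero continuous_on_spline continuous_on_add continuous_on_mult_left
      continuous_on_const)
  finally have R: "L f w (\<lambda>x. spline 1 v x - harm (v \<circ> q) x) =
     ?a * tent_moment f w 0 1 + (?b * tent_moment f w 0 2 + ?c * tent_moment f w 1 2)" by simp
  have e: "F 1 (q 0) = F 0 (q 1)" "F 2 (q 0) = F 0 (q 2)" "F 2 (q 1) = F 1 (q 2)" by (rule F_q_commute)+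
  have e': "tent_moment f w 1 0 = tent_moment f w 0 1" "tent_moment f w 2 0 = tent_moment f w 0 2"
    "tent_moment f w 2 1 = tent_moment f w 1 2" by (rule tent_moment_commute)+
  show ?thesis
    unfolding R sum_UNIV_3 Qform_def green_data_def harm_cell_def o_apply e e' F_q_self
    by (simp add: field_simps)
qed

lemma tent_moment_bound:
  assumes "integrable \<zeta> f" shows "\<bar>tent_moment f w i j\<bar> \<le> (\<integral>x. \<bar>f x\<bar> \<partial>\<zeta>)"
proof -
  have "\<bar>tent_moment f w i j\<bar> \<le> 1 * mass f w" unfolding tent_moment_def
  proof (rule L_bound[OF assms continuous_on_spline])
    fix x assume "x \<in> K"
    then show "\<bar>spline 1 (vtent (F i (q j))) x\<bar> \<le> 1"
      using spline_bounds[of x 0 "vtent (F i (q j))" 1 1] by (simp add: vtent_def abs_le_iff)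
  qed simp
  then show ?thesis using mass_le[OF assms, of w] by simp
qed

text \<open>The series lemma with cells as indices, subcells \<open>w @ [i]\<close> as children, and
  the constant bound given by the L^1 norm of \<open>f\<close>. Here the decay 3/5 comes entirely
  from \<rho>, the resistance scaling of one subdivision.\<close>

lemma green_exists:
  assumes "integrable \<zeta> f"
  shows "\<exists>u. \<forall>w. continuous_on K (u w) \<and> (\<forall>i. u w (q i) = 0) \<and>
           (\<forall>i. \<forall>x\<in>K. u w (F i x) = harm (green_data f w i) x + 3/5 * u (w @ [i]) x)"
proof (rule self_similar_system_exists[where \<theta>="3/5" and N="\<lambda>_. \<integral>x. \<bar>f x\<bar> \<partial>\<zeta>"])
  define B where "B = (\<integral>x. \<bar>f x\<bar> \<partial>\<zeta>)"
  show "continuous_on K (harm (green_data f w i))" for w i by (rule continuous_on_harm)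
  show "harm (green_data f w i) (q j) = harm (green_data f w j) (q i)" for w i j
    using green_data_commute by simp
  show "harm (green_data f w i) (q i) = 0" for w i by simp
  show "\<bar>harm (green_data f w i) x\<bar> \<le> (\<integral>x. \<bar>f x\<bar> \<partial>\<zeta>)" if "x \<in> K" for w i x
  proof -
    have "- B \<le> green_data f w i j" "green_data f w i j \<le> B" for j
    proof -
      note this = tent_moment_bound[OF assms, of w i j] tent_moment_bound[OF assms, of w 0 1]
        tent_moment_bound[OF assms, of w 0 2] tent_moment_bound[OF assms, of w 1 2]
      note b = this[folded B_def]
      have "- B \<le> green_data f w i j \<and> green_data f w i j \<le> B"
      proof (cases "j = i")
        case True
        then show ?thesis using b(1) by simp
      next
        case False
        \<comment> \<open>With denominators cleared, the right side is at most \<open>15 * B\<close>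
          in absolute value, well within \<open>50 * B\<close>.\<close>
        then have "50 * green_data f w i j = - 6 * tent_moment f w i j
            - 3 * tent_moment f w 0 1 - 3 * tent_moment f w 0 2 - 3 * tent_moment f w 1 2"
          by (simp add: green_data_def field_simps)
        then show ?thesis using b by (smt (verit))
      qed
      then show "- B \<le> green_data f w i j" "green_data f w i j \<le> B" by auto
    qed
    then have "- B \<le> harm (green_data f w i) x \<and> harm (green_data f w i) x \<le> B"
      by (rule harm_bounds[OF that])
    then have "\<bar>harm (green_data f w i) x\<bar> \<le> B" by (simp add: abs_le_iff)
    then show ?thesis by (simp only: B_def)
  qed
qed auto

text \<open>\<open>green f []\<close> is the potential with Laplacian \<open>f\<close> and zero
  boundary values. On the cell of \<open>w\<close>, pulled back, it is a harmonic function plus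
  \<open>(3/5) ^ length w\<close> times \<open>green f w\<close>.\<close>

definition green :: "(complex \<Rightarrow> real) \<Rightarrow> 3 list \<Rightarrow> complex \<Rightarrow> real" where
  "green f = (SOME u. \<forall>w. continuous_on K (u w) \<and> (\<forall>i. u w (q i) = 0) \<and>
           (\<forall>i. \<forall>x\<in>K. u w (F i x) = harm (green_data f w i) x + 3/5 * u (w @ [i]) x))"

lemma
  assumes "integrable \<zeta> f"
  shows continuous_on_green: "continuous_on K (green f w)"
    and green_q: "green f w (q i) = 0"
    and green_F: "x \<in> K \<Longrightarrow> green f w (F i x) = harm (green_data f w i) x + 3/5 * green f (w @ [i]) x"
  using someI_ex[OF green_exists[OF assms], folded green_def] by blast+

text \<open>The interpolant telescopes: the increment from \<open>harm\<close> to
  \<open>spline 1 v\<close> is covered by \<open>green_data_form\<close>, and the increment from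
  \<open>spline 1 v\<close> to \<open>spline (Suc n) v\<close> restricts on each subcell to the
  induction hypothesis. The 5/3 of the energy and the 3/5 of the potential cancel, and
  \<open>L_split\<close> reassembles the subcells.\<close>

lemma en_green:
  assumes "integrable \<zeta> f"
  shows "en n (green f w) v = - L f w (\<lambda>x. spline n v x - harm (v \<circ> q) x)"
proof (induction n arbitrary: w v)
  case 0
  show ?case by (simp add: L_zero Qform_def o_def green_q[OF assms])
next
  case (Suc n)
  have 1: "en n (green f w \<circ> F i) (v \<circ> F i) = Qform (green_data f w i) (v \<circ> F i \<circ> q)
      - 3/5 * L f (w @ [i]) (\<lambda>x. spline n (v \<circ> F i) x - harm (v \<circ> F i \<circ> q) x)" for i
  proof -
    have "en n (green f w \<circ> F i) (v \<circ> F i)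
        = en n (\<lambda>x. harm (green_data f w i) x + 3/5 * green f (w @ [i]) x) (v \<circ> F i)"
      by (rule en_cong_SG) (simp_all add: green_F[OF assms])
    then show ?thesis unfolding en_add_left en_scale_left en_harm Suc.IH by simp
  qed
  have "L f (w @ [i]) (\<lambda>x. spline n (v \<circ> F i) x - harm (v \<circ> F i \<circ> q) x)
      = L f (w @ [i]) ((\<lambda>x. spline (Suc n) v x - spline 1 v x) \<circ> F i)" for i
  proof (rule L_cong)
    fix x assume x: "x \<in> K"
    show "spline n (v \<circ> F i) x - harm (v \<circ> F i \<circ> q) x = ((\<lambda>x. spline (Suc n) v x - spline 1 v x) \<circ> F i) x"
      using spline_F[OF x, of n v i] spline_F[OF x, of 0 v i] by (simp add: o_def del: spline.simps(2))
  qed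
  then have 2: "(\<Sum>i\<in>UNIV. L f (w @ [i]) (\<lambda>x. spline n (v \<circ> F i) x - harm (v \<circ> F i \<circ> q) x))
      = L f w (\<lambda>x. spline (Suc n) v x - spline 1 v x)"
    by (subst L_split[OF assms]) (auto intro!: continuous_intros continuous_on_spline simp del: spline.simps)
  have "en (Suc n) (green f w) v = 5/3 * (\<Sum>i\<in>UNIV. Qform (green_data f w i) (v \<circ> F i \<circ> q))
      - (\<Sum>i\<in>UNIV. L f (w @ [i]) (\<lambda>x. spline n (v \<circ> F i) x - harm (v \<circ> F i \<circ> q) x))"
    unfolding en.simps 1 sum_subtractf sum_distrib_left[symmetric] by simp
  also have "\<dots> = - (L f w (\<lambda>x. spline 1 v x - harm (v \<circ> q) x) + L f w (\<lambda>x. spline (Suc n) v x - spline 1 v x))"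
    unfolding 2 green_data_form[OF assms] by simp
  also have "\<dots> = - L f w (\<lambda>x. spline (Suc n) v x - harm (v \<circ> q) x)"
    by (simp add: L_diff[OF assms] continuous_on_spline continuous_on_harm del: spline.simps)
  finally show ?case .
qed

text \<open>Testing \<open>en_green\<close> with the potential itself gives a bound that does not
  depend on the level, because interpolants never exceed the supremum of the function.\<close>

lemma green_dom_energy:
  assumes "integrable \<zeta> f" shows "green f w \<in> dom_energy q"
proof -
  obtain B where B: "0 \<le> B" "\<And>x. x \<in> K \<Longrightarrow> \<bar>green f w x\<bar> \<le> B"
    using continuous_SG_bounded[OF continuous_on_green[OF assms]] by metis
  have "en n (green f w) (green f w) \<le> B * mass f w" for n
  proof -
    have g: "green f w \<circ> q = (\<lambda>_. 0)" using green_q[OF assms] by auto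
    have "en n (green f w) (green f w) = - L f w (spline n (green f w))"
      unfolding en_green[OF assms] g by (intro arg_cong[of _ _ uminus] L_cong) (simp add: harm_const)
    also have "\<dots> \<le> \<bar>L f w (spline n (green f w))\<bar>" by simp
    also have "\<dots> \<le> B * mass f w"
    proof (rule L_bound[OF assms continuous_on_spline B(1)])
      fix x assume x: "x \<in> K"
      have "- B \<le> spline n (green f w) x \<and> spline n (green f w) x \<le> B"
        by (rule spline_bounds[OF x]) (use B(2) in \<open>auto simp: abs_le_iff minus_le_iff\<close>)
      then show "\<bar>spline n (green f w) x\<bar> \<le> B" by (simp add: abs_le_iff)
    qed
    finally show ?thesis .
  qed
  then show ?thesis unfolding dom_energy_iff using continuous_on_green[OF assms] by blast
qed

lemma L_spline_tendsto:
  assumes "integrable \<zeta> f" "continuous_on K v"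
  shows "(\<lambda>n. L f w (spline n v)) \<longlonglongrightarrow> L f w v"
proof (rule LIMSEQ_I)
  fix r :: real assume r: "r > 0"
  define e where "e = r / (mass f w + 1)"
  have e: "e > 0" "e * mass f w < r" using r mass_nonneg[of f w] by (auto simp: e_def field_simps)
  obtain N where N: "\<And>n x. n \<ge> N \<Longrightarrow> x \<in> K \<Longrightarrow> \<bar>spline n v x - v x\<bar> \<le> e"
    using spline_uniform_approx[OF assms(2) e(1)] by blast
  have "norm (L f w (spline n v) - L f w v) < r" if "n \<ge> N" for n
  proof -
    have "L f w (spline n v) - L f w v = L f w (\<lambda>x. spline n v x - v x)"
      by (rule L_diff[symmetric]) (intro assms continuous_on_spline)+
    also have "\<bar>\<dots>\<bar> \<le> e * mass f w"
      by (rule L_bound) (use assms e N[OF that] in \<open>auto intro!: continuous_intros continuous_on_spline\<close>)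
    finally show ?thesis using e(2) by simp
  qed
  then show "\<exists>no. \<forall>n\<ge>no. norm (L f w (spline n v) - L f w v) < r" by blast
qed

lemma L_Nil: "L f [] v = (\<integral>x. f x * v x \<partial>\<zeta>)"
  unfolding L_def by (intro Bochner_Integration.integral_cong) (auto simp: ext_def space_zeta)

lemma dom_energy_cong:
  assumes "\<And>x. x \<in> K \<Longrightarrow> u x = v x" "v \<in> dom_energy q" shows "u \<in> dom_energy q"
proof -
  have "en n u u = en n v v" for n by (rule en_cong_SG) (simp_all add: assms)
  then show ?thesis using assms by (simp add: dom_energy_iff cong: continuous_on_cong)
qed

lemma has_laplacian_green:
  assumes "square_integrable \<zeta> f" "\<And>x. x \<in> K \<Longrightarrow> u x = harm a x + green f [] x"
  shows "has_laplacian q \<zeta> u f"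
proof -
  note f = square_integrable_imp_integrable[OF assms(1)]
  have d: "(\<lambda>x. harm a x + green f [] x) \<in> dom_energy q"
    by (intro dom_energy_add harm_dom_energy green_dom_energy f)
  have u: "u \<in> dom_energy q" by (rule dom_energy_cong[OF assms(2) d])
  have "energy_form q u v = - (\<integral>x. f x * v x \<partial>\<zeta>)" if v: "v \<in> dom_energy q" "\<forall>p\<in>sg_vertices q 0. v p = 0" for v
  proof (rule LIMSEQ_unique)
    show "(\<lambda>n. en n u v) \<longlonglongrightarrow> energy_form q u v" by (rule tendsto_energy_form[OF u v(1)])
    have vq: "v \<circ> q = (\<lambda>_. 0)" using v(2) by auto
    have "en n u v = - L f [] (spline n v)" for n
    proof -
      have "en n u v = en n (\<lambda>x. harm a x + green f [] x) v" by (rule en_cong_SG) (simp_all add: assms(2))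
      also have "\<dots> = - L f [] (\<lambda>x. spline n v x - harm (v \<circ> q) x)"
        unfolding en_add_left en_harm en_green[OF f] by (simp add: vq Qform_def)
      also have "\<dots> = - L f [] (spline n v)" unfolding vq
        by (intro arg_cong[of _ _ uminus] L_cong) (simp add: harm_const)
      finally show ?thesis .
    qed
    then show "(\<lambda>n. en n u v) \<longlonglongrightarrow> - (\<integral>x. f x * v x \<partial>\<zeta>)"
      unfolding L_Nil[symmetric] by (simp only:) (intro tendsto_minus L_spline_tendsto f dom_energy_continuous v)
  qed
  then show ?thesis unfolding has_laplacian_def using u assms(1) by blast
qed

text \<open>The function \<open>u'\<close> built from the boundary values of \<open>u\<close> and
  the potential of \<open>f\<close> also has Laplacian \<open>f\<close>. The difference
  \<open>d\<close> vanishes on V_0, so it is an admissible test function for both; subtracting the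
  weak equations tested with \<open>d\<close> shows that \<open>d\<close> has zero energy.\<close>

lemma has_laplacian_imp_green:
  assumes "has_laplacian q \<zeta> u f" "x \<in> K"
  shows "u x = harm (u \<circ> q) x + green f [] x"
proof -
  have f2: "square_integrable \<zeta> f" and u: "u \<in> dom_energy q" using assms(1) by (simp_all add: has_laplacian_def)
  note f = square_integrable_imp_integrable[OF f2]
  define u' where "u' x = harm (u \<circ> q) x + green f [] x" for x
  have u': "has_laplacian q \<zeta> u' f" by (rule has_laplacian_green[OF f2]) (simp add: u'_def)
  then have u'd: "u' \<in> dom_energy q" by (simp add: has_laplacian_def)
  define d where "d x = u x - u' x" for x
  have d: "d \<in> dom_energy q" unfolding d_def by (intro dom_energy_diff u u'd)
  have dq: "d (q i) = 0" for i by (simp add: d_def u'_def green_q[OF f])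
  then have "\<forall>p\<in>sg_vertices q 0. d p = 0" by auto
  then have "energy_form q u d = energy_form q u' d" using assms(1) u' d unfolding has_laplacian_def by simp
  then have "(\<lambda>n. en n u d - en n u' d) \<longlonglongrightarrow> 0"
    using tendsto_diff[OF tendsto_energy_form[OF u d] tendsto_energy_form[OF u'd d]] by simp
  moreover have dd: "d = (\<lambda>x. u x - u' x)" by (auto simp: d_def)
  have "en n u d - en n u' d = en n d d" for n
    using en_diff_left[of n u u' d] unfolding dd[symmetric] by simp
  ultimately have *: "(\<lambda>n. en n d d) \<longlonglongrightarrow> 0" by simp
  have "d x = 0"
  proof (rule zero_energy_imp_vanish[OF dom_energy_continuous[OF d] _ dq assms(2)])
    fix m
    show "en m d d \<le> 0"
      \<comment> \<open>The level energies of \<open>d\<close> increase to 0, so none of them is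
        positive.\<close>
      by (rule LIMSEQ_le_const[OF *]) (use en_mono in blast)
  qed
  then show ?thesis by (simp add: d_def u'_def)
qed

end

section \<open>Normal derivatives\<close>

definition unit3 :: "3 \<Rightarrow> 3 \<Rightarrow> real" where "unit3 i j = (if j = i then 1 else 0)"

lemma unit3_simps [simp]: "unit3 i i = 1" "j \<noteq> i \<Longrightarrow> unit3 i j = 0" by (simp_all add: unit3_def)

text \<open>Pairing with a unit vector yields the difference expression in the definition of the
  normal derivative, which ties normal derivatives to energies.\<close>

lemma Qform_unit3: "Qform a (unit3 i) = 2 * a i - a (i + 1) - a (i - 1)"
proof -
  have e: "(0::3) + 1 = 1" "(0::3) - 1 = 2" "(1::3) + 1 = 2" "(1::3) - 1 = 0" "(2::3) + 1 = 0" "(2::3) - 1 = 1"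
    by simp_all
  have "\<forall>i. Qform a (unit3 i) = 2 * a i - a (i + 1) - a (i - 1)"
    unfolding all_3 e Qform_def by simp
  then show ?thesis by blast
qed

lemma Qform_unit3_expand: "Qform a c = (\<Sum>i\<in>UNIV. c i * Qform a (unit3 i))"
  by (simp add: sum_UNIV_3 Qform_def algebra_simps)

lemma Qform_zero_right [simp]: "Qform a (\<lambda>_. 0) = 0" by (simp add: Qform_def)

definition words :: "nat \<Rightarrow> 3 list set" where "words m = {w. length w = m}"

lemma words_0 [simp]: "words 0 = {[]}" by (auto simp: words_def)

lemma words_Suc: "words (Suc m) = (\<Union>i. (#) i ` words m)"
  by (auto simp: words_def length_Suc_conv)

lemma finite_words [simp]: "finite (words m)"
  by (induction m) (auto simp: words_Suc)

lemma sum_words_Suc: "(\<Sum>w\<in>words (Suc m). g w) = (\<Sum>i\<in>UNIV. \<Sum>w\<in>words m. g (i # w))"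
proof -
  have "(\<Sum>w\<in>words (Suc m). g w) = (\<Sum>i\<in>UNIV. \<Sum>w\<in>(#) i ` words m. g w)"
    unfolding words_Suc by (rule sum.UNION_disjoint) auto
  also have "\<dots> = (\<Sum>i\<in>UNIV. \<Sum>w\<in>words m. g (i # w))"
    by (rule sum.cong[OF refl], subst sum.reindex) auto
  finally show ?thesis .
qed

context gasket_measure
begin

lemma harm_unit3_sum: "x \<in> K \<Longrightarrow> harm a x = (\<Sum>j\<in>UNIV. a j * harm (unit3 j) x)"
  unfolding unit3_def[abs_def] by (rule harm_sum_basis)

lemma L_harm:
  assumes "integrable \<zeta> f" shows "L f w (harm a) = (\<Sum>j\<in>UNIV. a j * L f w (harm (unit3 j)))"
proof -
  have "L f w (harm a) = L f w (\<lambda>x. a 0 * harm (unit3 0) x + (a 1 * harm (unit3 1) x + (a 2 * harm (unit3 2) x + 0)))"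
    by (rule L_cong) (simp add: harm_unit3_sum[of _ a] sum_UNIV_3)
  also have "\<dots> = a 0 * L f w (harm (unit3 0)) + (a 1 * L f w (harm (unit3 1)) + (a 2 * L f w (harm (unit3 2)) + 0))"
    by (simp only: L_linear[OF assms] L_zero continuous_on_harm continuous_on_add continuous_on_mult_left
      continuous_on_const)
  finally show ?thesis by (simp add: sum_UNIV_3)
qed

text \<open>The two claims feed each other: the form on a cell, evaluated at the corners of a
  subcell, gives the boundary values there, and these turn the form on the cell into the form on the
  subcell. Subcells append a letter, hence the induction from the end of the word.\<close>

lemma
  assumes "has_laplacian q \<zeta> u f"
  shows has_laplacian_cell_form:
      "x \<in> K \<Longrightarrow> u (FW w x) = harm (u \<circ> FW w \<circ> q) x + (3/5) ^ length w * green f w x" (is "_ \<Longrightarrow> ?A w x")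
    and has_laplacian_cell_boundary:
      "u \<circ> FW (w @ [i]) \<circ> q = (\<lambda>j. (3/5) ^ length w * green_data f w i j + harm_cell i (u \<circ> FW w \<circ> q) j)" (is "?B w i")
proof -
  have f: "integrable \<zeta> f" using assms square_integrable_imp_integrable by (simp add: has_laplacian_def)
  have step: "u (FW (w @ [i]) x) = harm (\<lambda>j. (3/5) ^ length w * green_data f w i j + harm_cell i (u \<circ> FW w \<circ> q) j) x
      + (3/5) ^ Suc (length w) * green f (w @ [i]) x"
    if "\<And>x. x \<in> K \<Longrightarrow> ?A w x" "x \<in> K" for w i x
  proof -
    have "u (FW (w @ [i]) x) = u (FW w (F i x))" by (simp add: sg_word_append)
    also have "\<dots> = harm (u \<circ> FW w \<circ> q) (F i x) + (3/5) ^ length w * green f w (F i x)"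
      using that by blast
    finally show ?thesis
      unfolding green_F[OF f that(2)] harm_F[OF that(2)] harm_linear[OF that(2)] by (simp add: distrib_left)
  qed
  have stepB: "?B w i" if "\<And>x. x \<in> K \<Longrightarrow> ?A w x" for w i
    using step[OF that, of "q j" i for j] by (intro ext) (simp add: green_q[OF f] o_def)
  have A: "\<forall>x\<in>K. ?A w x" for w
  proof (induction w rule: rev_induct)
    case Nil
    show ?case
    proof
      fix x assume "x \<in> K"
      from has_laplacian_imp_green[OF assms this] show "?A [] x"
        by (simp only: sg_word.simps o_def id_apply list.size power_0 mult_1)
    qed
  next
    case (snoc i w)
    then have IH: "\<And>x. x \<in> K \<Longrightarrow> ?A w x" by blast
    show ?case
    proof
      fix x assume "x \<in> K"
      then have s: "u (FW (w @ [i]) x) = harm (\<lambda>j. (3/5) ^ length w * green_data f w i j + harm_cell i (u \<circ> FW w \<circ> q) j) x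
          + (3/5) ^ Suc (length w) * green f (w @ [i]) x"
        by (intro step IH)
      have B: "?B w i" by (intro stepB IH)
      show "?A (w @ [i]) x" unfolding B length_append_singleton by (rule s)
    qed
  qed
  then show "x \<in> K \<Longrightarrow> ?A w x" by blast
  show "?B w i" using A by (intro stepB) blast
qed

text \<open>The Gauss-Green expression for the normal derivative at a corner: the energy of
  \<open>u\<close> against the harmonic tent of that corner on the cell, plus the integral of
  \<open>f\<close> times the tent.\<close>

definition flux :: "(complex \<Rightarrow> real) \<Rightarrow> (complex \<Rightarrow> real) \<Rightarrow> 3 list \<Rightarrow> 3 \<Rightarrow> real" where
  "flux u f w i = (5/3) ^ length w * Qform (u \<circ> FW w \<circ> q) (unit3 i) + L f w (harm (unit3 i))"

lemma Qform_harm_cell_unit3: "5/3 * Qform (harm_cell i a) (unit3 i) = Qform a (unit3 i)"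
proof -
  let ?b = "\<lambda>k. if k = i then unit3 i else (\<lambda>_. 0)"
  have "Qform a (unit3 i) = 5/3 * (\<Sum>k\<in>UNIV. Qform (harm_cell k a) (?b k))"
    by (rule Qform_harm_cell[symmetric]) (auto simp: unit3_def)
  also have "(\<Sum>k\<in>UNIV. Qform (harm_cell k a) (?b k)) = (\<Sum>k\<in>UNIV. if k = i then Qform (harm_cell k a) (unit3 i) else 0)"
    by (rule sum.cong) auto
  finally show ?thesis by simp
qed

text \<open>\<open>green_data_form\<close> tested with the indicator of \<open>q i\<close>. Its
  level-one interpolant is \<open>harm (unit3 i)\<close> on the subcell of \<open>i\<close> and 0 on
  the other two, so the right side is a difference of moments on nested cells.\<close>

lemma Qform_green_data_unit3:
  assumes "integrable \<zeta> f"
  shows "5/3 * Qform (green_data f w i) (unit3 i) = L f w (harm (unit3 i)) - L f (w @ [i]) (harm (unit3 i))"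
proof -
  let ?v = "vtent (q i)"
  have vF: "?v \<circ> F k \<circ> q = (if k = i then unit3 i else (\<lambda>_. 0))" for k
  proof -
    have "F k (q j) = q i \<longleftrightarrow> k = i \<and> j = i" for j using q_eq_F_q_iff[of i k j] by auto
    then show ?thesis by (auto simp: vtent_def unit3_def fun_eq_iff)
  qed
  have vq: "?v \<circ> q = unit3 i" by (auto simp: vtent_def unit3_def)
  have "5/3 * Qform (green_data f w i) (unit3 i) = 5/3 * (\<Sum>k\<in>UNIV. if k = i then Qform (green_data f w k) (unit3 i) else 0)"
    by simp
  also have "(\<Sum>k\<in>UNIV. if k = i then Qform (green_data f w k) (unit3 i) else 0) = (\<Sum>k\<in>UNIV. Qform (green_data f w k) (?v \<circ> F k \<circ> q))"
    by (rule sum.cong) (simp_all add: vF)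
  also have "5/3 * \<dots> = - L f w (\<lambda>x. spline 1 ?v x - harm (unit3 i) x)"
    unfolding green_data_form[OF assms] vq ..
  also have "\<dots> = L f w (harm (unit3 i)) - L f w (spline 1 ?v)"
    by (subst L_diff[OF assms continuous_on_spline continuous_on_harm]) simp
  also have "L f w (spline 1 ?v) = (\<Sum>k\<in>UNIV. if k = i then L f (w @ [i]) (harm (unit3 i)) else 0)"
  proof (subst L_split[OF assms continuous_on_spline], rule sum.cong[OF refl])
    fix k
    have "L f (w @ [k]) (spline 1 ?v \<circ> F k) = L f (w @ [k]) (harm (?v \<circ> F k \<circ> q))"
      by (rule L_cong) (use spline_F[of _ 0 ?v] in \<open>simp del: spline.simps(2)\<close>)
    moreover have "L f (w @ [k]) (harm (\<lambda>_. 0)) = 0"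
      using L_harm[OF assms, of "w @ [k]" "\<lambda>_. 0"] by simp
    ultimately show "L f (w @ [k]) (spline 1 ?v \<circ> F k) = (if k = i then L f (w @ [i]) (harm (unit3 i)) else 0)"
      unfolding vF by auto
  qed
  finally show ?thesis by simp
qed

text \<open>The flux does not change when the cell shrinks to its vertex, while its integral term tends to \<open>0\<close>
  because the measure has no atoms; hence it is the normal derivative.\<close>

lemma flux_append:
  assumes "has_laplacian q \<zeta> u f" shows "flux u f (w @ [i]) i = flux u f w i"
proof -
  have f: "integrable \<zeta> f" using assms square_integrable_imp_integrable by (simp add: has_laplacian_def)
  have "(5/3) ^ length (w @ [i]) * Qform (u \<circ> FW (w @ [i]) \<circ> q) (unit3 i)
     = ((5/3) ^ length w * (3/5) ^ length w) * (5/3 * Qform (green_data f w i) (unit3 i))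
     + (5/3) ^ length w * (5/3 * Qform (harm_cell i (u \<circ> FW w \<circ> q)) (unit3 i))"
    unfolding has_laplacian_cell_boundary[OF assms] Qform_add_left Qform_scale_left
    by (simp add: algebra_simps)
  also have "(5/3) ^ length w * (3/5) ^ length w = (1::real)" by (simp add: power_mult_distrib[symmetric])
  finally have E: "(5/3) ^ length (w @ [i]) * Qform (u \<circ> FW (w @ [i]) \<circ> q) (unit3 i)
     = 1 * (5/3 * Qform (green_data f w i) (unit3 i))
     + (5/3) ^ length w * (5/3 * Qform (harm_cell i (u \<circ> FW w \<circ> q)) (unit3 i))" .
  show ?thesis
    unfolding flux_def E Qform_harm_cell_unit3 Qform_green_data_unit3[OF f] by simp
qed

lemma flux_append_replicate:
  assumes "has_laplacian q \<zeta> u f" shows "flux u f (w @ replicate k i) i = flux u f w i"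
proof (induction k)
  case (Suc k)
  have "w @ replicate (Suc k) i = (w @ replicate k i) @ [i]" by (simp add: replicate_append_same)
  then show ?case using flux_append[OF assms, of "w @ replicate k i" i] Suc by metis
qed simp

lemma FW_replicate_q: "FW (replicate k i) (q i) = q i"
  by (induction k) auto

lemma mass_replicate_tendsto:
  assumes "integrable \<zeta> f" shows "(\<lambda>k. mass f (w @ replicate k i)) \<longlonglongrightarrow> 0"
proof -
  let ?p = "FW w (q i)"
  obtain D where D: "\<And>x y. x \<in> K \<Longrightarrow> y \<in> K \<Longrightarrow> dist x y \<le> D"
    using bounded_two_points[of K] compact_imp_bounded[OF compact_SG] by blast
  have D0: "0 \<le> D" using D[of "q 0" "q 0"] by simp
  have ev: "\<forall>\<^sub>F k in sequentially. x \<notin> cell (w @ replicate k i)" if "x \<noteq> ?p" for x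
  proof -
    obtain N where N: "D / dist x ?p < 2 ^ N" using real_arch_pow[of 2 "D / dist x ?p"] by auto
    have "x \<notin> cell (w @ replicate k i)" if k: "k \<ge> N" for k
    proof
      assume "x \<in> cell (w @ replicate k i)"
      then obtain y where y: "y \<in> K" "x = FW (w @ replicate k i) y" by (auto simp: cell_def)
      have p: "?p = FW (w @ replicate k i) (q i)" by (simp add: sg_word_append FW_replicate_q)
      have "dist x ?p \<le> D / 2 ^ length (w @ replicate k i)"
        unfolding y(2) p dist_FW by (intro divide_right_mono D y) auto
      also have "\<dots> \<le> D / 2 ^ N" using k D0 by (intro divide_left_mono power_increasing) auto
      finally have "dist x ?p * 2 ^ N \<le> D" by (simp add: field_simps)
      moreover have "D < 2 ^ N * dist x ?p" using N \<open>x \<noteq> ?p\<close> by (simp add: field_simps)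
      ultimately show False by (simp add: mult.commute)
    qed
    then show ?thesis by (auto simp: eventually_sequentially)
  qed
  have "(\<lambda>k. mass f (w @ replicate k i)) \<longlonglongrightarrow> (\<integral>x. 0 \<partial>\<zeta>)"
    unfolding mass_def
  proof (rule integral_dominated_convergence[where w="\<lambda>x. \<bar>f x\<bar>"])
    show "AE x in \<zeta>. (\<lambda>k. \<bar>f x\<bar> * indicator (cell (w @ replicate k i)) x) \<longlonglongrightarrow> 0"
      using AE_not_finite[of "{?p}"]
    proof (rule AE_mp, simp_all, intro AE_I2 impI)
      fix x assume "x \<noteq> ?p"
      from ev[OF this] show "(\<lambda>k. \<bar>f x\<bar> * indicator (cell (w @ replicate k i)) x) \<longlonglongrightarrow> 0"
        by (intro tendsto_eventually, elim eventually_mono) simp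
    qed
    show "(\<lambda>x. \<bar>f x\<bar> * indicator (cell (w @ replicate k i)) x) \<in> borel_measurable \<zeta>" for k
      using mass_integrable[OF assms, of "w @ replicate k i"] by auto
  qed (use assms in \<open>auto simp: indicator_def\<close>)
  then show ?thesis by simp
qed

text \<open>The k-th quotient in the definition equals the flux minus a moment over the k-th
  shrinking cell, exactly. The moment is bounded by the mass of \<open>f\<close> there.\<close>

lemma normal_deriv_eq_flux:
  assumes "has_laplacian q \<zeta> u f" shows "normal_deriv q w i u = flux u f w i"
proof -
  have f: "integrable \<zeta> f" using assms square_integrable_imp_integrable by (simp add: has_laplacian_def)
  have 1: "(5/3) ^ (length w + k) * (2 * u (FW w (q i)) - u (FW w ((F i ^^ k) (q (i + 1)))) - u (FW w ((F i ^^ k) (q (i - 1)))))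
      = flux u f w i - L f (w @ replicate k i) (harm (unit3 i))" for k
  proof -
    have "(5/3) ^ (length w + k) * (2 * u (FW w (q i)) - u (FW w ((F i ^^ k) (q (i + 1)))) - u (FW w ((F i ^^ k) (q (i - 1)))))
      = (5/3) ^ length (w @ replicate k i) * Qform (u \<circ> FW (w @ replicate k i) \<circ> q) (unit3 i)"
      by (simp add: Qform_unit3 sg_word_append FW_replicate_q sg_word_replicate[symmetric])
    also have "\<dots> = flux u f (w @ replicate k i) i - L f (w @ replicate k i) (harm (unit3 i))"
      by (simp add: flux_def)
    finally show ?thesis by (simp only: flux_append_replicate[OF assms])
  qed
  have "(\<lambda>k. L f (w @ replicate k i) (harm (unit3 i))) \<longlonglongrightarrow> 0"
  proof (rule Lim_null_comparison[OF always_eventually mass_replicate_tendsto[OF f]], rule allI)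
    fix k
    have "\<bar>L f (w @ replicate k i) (harm (unit3 i))\<bar> \<le> 1 * mass f (w @ replicate k i)"
    proof (rule L_bound[OF f continuous_on_harm])
      fix x assume "x \<in> K"
      from harm_bounds[OF this, of 0 "unit3 i" 1] show "\<bar>harm (unit3 i) x\<bar> \<le> 1"
        by (simp add: unit3_def abs_le_iff)
    qed simp
    then show "norm (L f (w @ replicate k i) (harm (unit3 i))) \<le> mass f (w @ replicate k i)" by simp
  qed
  then have "(\<lambda>k. flux u f w i - L f (w @ replicate k i) (harm (unit3 i))) \<longlonglongrightarrow> flux u f w i - 0"
    by (intro tendsto_intros)
  then show ?thesis unfolding normal_deriv_def 1 by (simp add: limI)
qed

lemma L_spline_eq_sum:
  assumes "integrable \<zeta> f"
  shows "L f w0 (spline m v) = (\<Sum>w\<in>words m. \<Sum>i\<in>UNIV. v (FW w (q i)) * L f (w0 @ w) (harm (unit3 i)))"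
proof (induction m arbitrary: w0 v)
  case 0
  then show ?case using L_harm[OF assms, of w0 "v \<circ> q"] by simp
next
  case (Suc m)
  have "L f w0 (spline (Suc m) v) = (\<Sum>i\<in>UNIV. L f (w0 @ [i]) (spline m (v \<circ> F i)))"
    by (subst L_split[OF assms continuous_on_spline], intro sum.cong refl L_cong)
      (simp add: spline_F del: spline.simps)
  then show ?case unfolding sum_words_Suc Suc.IH by simp
qed

lemma en_eq_sum:
  "en m u v = (\<Sum>w\<in>words m. \<Sum>i\<in>UNIV. v (FW w (q i)) * ((5/3) ^ length w * Qform (u \<circ> FW w \<circ> q) (unit3 i)))"
proof (induction m arbitrary: u v)
  case 0
  then show ?case using Qform_unit3_expand[of "u \<circ> q" "v \<circ> q"] by (simp add: o_def)
next
  case (Suc m)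
  then show ?case unfolding en.simps sum_words_Suc
    by (simp add: sum_distrib_left o_def mult.assoc mult.left_commute)
qed

text \<open>Summation by parts at level m, arranged by addresses \<open>(w, i)\<close>. A junction
  point appears once for each of its addresses, so its coefficient is the total flux there.\<close>

lemma flux_form:
  assumes "integrable \<zeta> f"
  shows "en m u v + L f [] (spline m v) = (\<Sum>w\<in>words m. \<Sum>i\<in>UNIV. v (FW w (q i)) * flux u f w i)"
  unfolding L_spline_eq_sum[OF assms] en_eq_sum flux_def distrib_left sum.distrib by simp

text \<open>Given \<open>f\<close>, the boundary values leave only one candidate \<open>u\<close>.
  The balance hypothesis, tested with the error \<open>d = u - \<alpha>\<close>, gives
  \<open>en m d d = 0\<close>, so the candidate already takes all prescribed values on V_m.\<close>

lemma exists_has_laplacian_with_values: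
  assumes "square_integrable \<zeta> f"
    and "\<And>v. (\<And>i. v (q i) = 0) \<Longrightarrow> (\<Sum>w\<in>words m. \<Sum>i\<in>UNIV. v (FW w (q i)) * flux \<alpha> f w i) = 0"
  obtains u where "has_laplacian q \<zeta> u f" "\<And>p. p \<in> sg_vertices q m \<Longrightarrow> u p = \<alpha> p"
proof
  note f = square_integrable_imp_integrable[OF assms(1)]
  define u where "u x = harm (\<alpha> \<circ> q) x + green f [] x" for x
  show "has_laplacian q \<zeta> u f" by (rule has_laplacian_green[OF assms(1)]) (simp add: u_def)
  define d where "d x = u x - \<alpha> x" for x
  have dd: "d = (\<lambda>x. u x - \<alpha> x)" and uu: "u = (\<lambda>x. harm (\<alpha> \<circ> q) x + green f [] x)" by (auto simp: d_def u_def)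
  have dq: "d (q i) = 0" for i by (simp add: d_def u_def green_q[OF f])
  then have dq': "d \<circ> q = (\<lambda>_. 0)" by auto
  have "en m u d = - L f [] (\<lambda>x. spline m d x - harm (\<lambda>_. 0) x)"
    unfolding uu en_add_left en_harm en_green[OF f] dq' by simp
  also have "\<dots> = - L f [] (spline m d)"
    by (intro arg_cong[of _ _ uminus] L_cong) (simp add: harm_const)
  finally have "en m u d - en m \<alpha> d = - (en m \<alpha> d + L f [] (spline m d))" by simp
  also have "\<dots> = 0" unfolding flux_form[OF f] using assms(2)[of d, OF dq] by simp
  finally have "en m d d = 0" using en_diff_left[of m u \<alpha> d] unfolding dd[symmetric] by simp
  then have "d p = 0" if "p \<in> sg_vertices q m" for p
    using en_le_0_imp_vanish[of m d p] dq that by simp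
  then show "u p = \<alpha> p" if "p \<in> sg_vertices q m" for p using that by (simp add: d_def)
qed

lemma has_laplacian_flux_sum:
  assumes "has_laplacian q \<zeta> u f" "\<And>i. v (q i) = 0"
  shows "(\<Sum>w\<in>words m. \<Sum>i\<in>UNIV. v (FW w (q i)) * flux u f w i) = 0"
proof -
  have f: "integrable \<zeta> f" using assms square_integrable_imp_integrable by (simp add: has_laplacian_def)
  have vq: "v \<circ> q = (\<lambda>_. 0)" using assms(2) by auto
  have "en m u v = en m (\<lambda>x. harm (u \<circ> q) x + green f [] x) v"
    by (rule en_cong_SG) (simp_all add: has_laplacian_imp_green[OF assms(1)])
  also have "\<dots> = - L f [] (\<lambda>x. spline m v x - harm (\<lambda>_. 0) x)"
    unfolding en_add_left en_harm en_green[OF f] vq by simp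
  also have "\<dots> = - L f [] (spline m v)"
    by (intro arg_cong[of _ _ uminus] L_cong) (simp add: harm_const)
  finally show ?thesis unfolding flux_form[OF f, symmetric] by simp
qed

section \<open>Square-integrable functions and uniqueness of the Laplacian\<close>

definition ip :: "(complex \<Rightarrow> real) \<Rightarrow> (complex \<Rightarrow> real) \<Rightarrow> real" where
  "ip f g = (\<integral>x. f x * g x \<partial>\<zeta>)"

abbreviation "L2 \<equiv> Collect (square_integrable \<zeta>)"

lemma L2_measurable: "f \<in> L2 \<Longrightarrow> f \<in> borel_measurable \<zeta>"
  by (simp add: square_integrable_def)

lemma ip_integrable:
  assumes "f \<in> L2" "g \<in> L2" shows "integrable \<zeta> (\<lambda>x. f x * g x)"
proof (rule Bochner_Integration.integrable_bound[of _ "\<lambda>x. (f x)\<^sup>2 + (g x)\<^sup>2"])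
  show "integrable \<zeta> (\<lambda>x. (f x)\<^sup>2 + (g x)\<^sup>2)" using assms by (simp add: square_integrable_def)
  show "(\<lambda>x. f x * g x) \<in> borel_measurable \<zeta>" by (intro borel_measurable_times L2_measurable assms)
  have "\<bar>a * b\<bar> \<le> a\<^sup>2 + b\<^sup>2" for a b :: real
  proof -
    have "2 * (\<bar>a\<bar> * \<bar>b\<bar>) \<le> a\<^sup>2 + b\<^sup>2"
      using zero_le_power2[of "\<bar>a\<bar> - \<bar>b\<bar>"] by (simp add: power2_diff)
    moreover have "0 \<le> \<bar>a\<bar> * \<bar>b\<bar>" by simp
    ultimately show ?thesis unfolding abs_mult by linarith
  qed
  then show "AE x in \<zeta>. norm (f x * g x) \<le> norm ((f x)\<^sup>2 + (g x)\<^sup>2)" by simp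
qed

lemma L2_linear:
  assumes "f \<in> L2" "g \<in> L2" shows "(\<lambda>x. r * f x + g x) \<in> L2"
proof -
  have "integrable \<zeta> (\<lambda>x. r\<^sup>2 * (f x)\<^sup>2 + 2 * r * (f x * g x) + (g x)\<^sup>2)"
    using assms ip_integrable[OF assms] by (simp add: square_integrable_def)
  also have "(\<lambda>x. r\<^sup>2 * (f x)\<^sup>2 + 2 * r * (f x * g x) + (g x)\<^sup>2) = (\<lambda>x. (r * f x + g x)\<^sup>2)"
    by (auto simp: power2_eq_square algebra_simps)
  moreover have "(\<lambda>x. r * f x + g x) \<in> borel_measurable \<zeta>"
    by (intro borel_measurable_add borel_measurable_times borel_measurable_const L2_measurable assms)
  ultimately show ?thesis by (simp add: square_integrable_def)
qed

lemma L2_zero: "(\<lambda>_. 0) \<in> L2" by (simp add: square_integrable_def)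

lemma L2_diff: "f \<in> L2 \<Longrightarrow> g \<in> L2 \<Longrightarrow> (\<lambda>x. f x - g x) \<in> L2"
  using L2_linear[of g f "-1"] by simp

lemma ip_commute: "ip f g = ip g f" by (simp add: ip_def mult.commute)

lemma ip_linear_left:
  assumes "f \<in> L2" "g \<in> L2" "h \<in> L2" shows "ip (\<lambda>x. r * f x + g x) h = r * ip f h + ip g h"
proof -
  have "ip (\<lambda>x. r * f x + g x) h = (\<integral>x. r * (f x * h x) + g x * h x \<partial>\<zeta>)"
    unfolding ip_def by (simp add: algebra_simps)
  then show ?thesis unfolding ip_def using ip_integrable[OF assms(1,3)] ip_integrable[OF assms(2,3)] by simp
qed

lemma ip_linear_right:
  assumes "f \<in> L2" "g \<in> L2" "h \<in> L2" shows "ip h (\<lambda>x. r * f x + g x) = r * ip h f + ip h g"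
  unfolding ip_commute[of h] by (rule ip_linear_left[OF assms])

lemma ip_diff_left:
  assumes "f \<in> L2" "g \<in> L2" "h \<in> L2" shows "ip (\<lambda>x. f x - g x) h = ip f h - ip g h"
  using ip_linear_left[OF assms(2,1,3), of "-1"] by simp

lemma ip_diff_right:
  assumes "f \<in> L2" "g \<in> L2" "h \<in> L2" shows "ip h (\<lambda>x. f x - g x) = ip h f - ip h g"
  using ip_linear_right[OF assms(2,1,3), of "-1"] by simp

lemma ip_nonneg: "0 \<le> ip f f" unfolding ip_def by (intro integral_nonneg_AE) auto

lemma ip_eq_0_AE:
  assumes "f \<in> L2" "ip f f = 0" shows "AE x in \<zeta>. f x = 0"
proof -
  have "AE x in \<zeta>. f x * f x = 0"
    using integral_nonneg_eq_0_iff_AE[OF ip_integrable[OF assms(1,1)]] assms(2) by (simp add: ip_def)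
  then show ?thesis by simp
qed

lemma ip_cong_AE:
  assumes "f \<in> L2" "f' \<in> L2" "g \<in> L2" "AE x in \<zeta>. f x = f' x" shows "ip f g = ip f' g"
  unfolding ip_def
proof (rule integral_cong_AE)
  show "(\<lambda>x. f x * g x) \<in> borel_measurable \<zeta>" "(\<lambda>x. f' x * g x) \<in> borel_measurable \<zeta>"
    by (intro borel_measurable_times L2_measurable assms)+
  show "AE x in \<zeta>. f x * g x = f' x * g x" using assms(4) by eventually_elim simp
qed

lemma ip_eq_0_right:
  assumes "f \<in> L2" "g \<in> L2" "ip f f = 0" shows "ip f g = 0"
  using ip_cong_AE[OF assms(1) L2_zero assms(2) ip_eq_0_AE[OF assms(1,3)]] by (simp add: ip_def)

text \<open>Indicators of closed sets are pointwise limits of continuous functions, Borel sets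
  follow by the Dynkin argument on the intersection-stable closed sets, and the sets where
  \<open>h\<close> is positive or negative are then null.\<close>

lemma integral_continuous_zero_imp_AE_zero:
  fixes h :: "complex \<Rightarrow> real"
  assumes h: "integrable \<zeta> h" and z: "\<And>v. continuous_on K v \<Longrightarrow> (\<integral>x. h x * v x \<partial>\<zeta>) = 0"
  shows "AE x in \<zeta>. h x = 0"
proof -
  have int: "integrable \<zeta> (\<lambda>x. h x * indicator A x)" if "A \<in> sets borel" for A
  proof (rule Bochner_Integration.integrable_bound[OF h])
    show "(\<lambda>x. h x * indicator A x) \<in> borel_measurable \<zeta>"
      using h measurable_zeta[OF borel_measurable_indicator[OF that]] by (intro borel_measurable_times) auto
  qed (auto simp: indicator_def)
  have closed: "(\<integral>x. h x * indicator C x \<partial>\<zeta>) = 0" if C: "closed C" for C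
  \<comment> \<open>\<open>infdist\<close> to the empty set is 0 by convention, so the approximating
    functions would be constantly 1 there.\<close>
  proof (cases "C = {}")
    case False
    let ?v = "\<lambda>n x. max 0 (1 - real n * infdist x C)"
    have c: "continuous_on S (?v n)" for n S by (intro continuous_intros)
    have "(\<lambda>n. \<integral>x. h x * ?v n x \<partial>\<zeta>) \<longlonglongrightarrow> (\<integral>x. h x * indicator C x \<partial>\<zeta>)"
    proof (rule integral_dominated_convergence[where w="\<lambda>x. \<bar>h x\<bar>"])
      show "(\<lambda>x. h x * indicator C x) \<in> borel_measurable \<zeta>" using int[of C] C by auto
      show "(\<lambda>x. h x * ?v n x) \<in> borel_measurable \<zeta>" for n
        using h measurable_zeta[OF borel_measurable_continuous_onI[OF c]] by (intro borel_measurable_times) auto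
      show "AE x in \<zeta>. (\<lambda>n. h x * ?v n x) \<longlonglongrightarrow> h x * indicator C x"
      proof (rule AE_I2)
        fix x
        have "(\<lambda>n. ?v n x) \<longlonglongrightarrow> indicator C x"
        proof (cases "x \<in> C")
          case True then show ?thesis by simp
        next
          case False
          then have p: "infdist x C > 0" using in_closed_iff_infdist_zero[OF C \<open>C \<noteq> {}\<close>] infdist_nonneg[of x C]
            by (simp add: order_less_le)
          obtain N where N: "1 / infdist x C < real N" using reals_Archimedean2 by blast
          have "?v n x = 0" if "n \<ge> N" for n
          proof -
            have "1 / infdist x C < real n" using N that by linarith
            then show ?thesis using p by (simp add: field_simps)
          qed
          then show ?thesis using False by (intro tendsto_eventually) (auto simp: eventually_sequentially)
        qed
        then show "(\<lambda>n. h x * ?v n x) \<longlonglongrightarrow> h x * indicator C x" by (rule tendsto_mult_left)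
      qed
      show "AE x in \<zeta>. norm (h x * ?v n x) \<le> \<bar>h x\<bar>" for n
      proof (rule AE_I2)
        fix x
        have "0 \<le> ?v n x" "?v n x \<le> 1" using infdist_nonneg[of x C] by auto
        then have "\<bar>h x\<bar> * ?v n x \<le> \<bar>h x\<bar> * 1" by (intro mult_left_mono) auto
        then show "norm (h x * ?v n x) \<le> \<bar>h x\<bar>" using \<open>0 \<le> ?v n x\<close> by (simp add: abs_mult)
      qed
    qed (use h in simp)
    then show ?thesis using z[OF c] by (simp add: LIMSEQ_const_iff)
  qed simp
  have borel: "(\<integral>x. h x * indicator A x \<partial>\<zeta>) = 0" if "A \<in> sets borel" for A
  proof -
    have st: "Int_stable (Collect closed :: complex set set)" by (auto simp: Int_stable_def)
    have sb: "sigma_sets UNIV (Collect closed) = sets (borel :: complex measure)"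
      by (simp add: borel_eq_closed)
    have sp: "Collect closed \<subseteq> Pow (UNIV :: complex set)" by simp
    have "A \<in> sigma_sets UNIV (Collect closed)" using that sb by simp
    from st sp this show ?thesis
    proof (induction rule: sigma_sets_induct_disjoint)
      case (basic A) then show ?case by (simp add: closed)
    next
      case (compl A)
      then have A: "A \<in> sets borel" using sb by simp
      have "(\<integral>x. h x * indicator (UNIV - A) x \<partial>\<zeta>) = (\<integral>x. h x - h x * indicator A x \<partial>\<zeta>)"
        by (intro Bochner_Integration.integral_cong) (auto simp: indicator_def)
      then show ?case using h int[OF A] compl(2) z[of "\<lambda>_. 1"] by simp
    next
      case (union B)
      then have B: "B i \<in> sets borel" for i using sb by auto
      have fin: "(\<integral>x. h x * indicator (\<Union>i<n. B i) x \<partial>\<zeta>) = 0" for n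
      proof -
        have "disjoint_family_on B {..<n}" using union(1) by (auto simp: disjoint_family_on_def)
        then have "(\<integral>x. h x * indicator (\<Union>i<n. B i) x \<partial>\<zeta>) = (\<integral>x. (\<Sum>i<n. h x * indicator (B i) x) \<partial>\<zeta>)"
          by (simp add: indicator_UN_disjoint sum_distrib_left)
        also have "\<dots> = 0" by (subst Bochner_Integration.integral_sum) (simp_all add: union(3) int[OF B])
        finally show ?thesis .
      qed
      have "(\<lambda>n. \<integral>x. h x * indicator (\<Union>i<n. B i) x \<partial>\<zeta>) \<longlonglongrightarrow> (\<integral>x. h x * indicator (\<Union>i. B i) x \<partial>\<zeta>)"
      proof (rule integral_dominated_convergence[where w="\<lambda>x. \<bar>h x\<bar>"])
        show "(\<lambda>x. h x * indicator (\<Union>i. B i) x) \<in> borel_measurable \<zeta>"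
          using int[of "\<Union>i. B i"] B by auto
        show "(\<lambda>x. h x * indicator (\<Union>i<n. B i) x) \<in> borel_measurable \<zeta>" for n
          using int[of "\<Union>i<n. B i"] B by auto
        show "AE x in \<zeta>. (\<lambda>n. h x * indicator (\<Union>i<n. B i) x) \<longlonglongrightarrow> h x * indicator (\<Union>i. B i) x"
          by (intro AE_I2 tendsto_mult_left LIMSEQ_indicator_UN)
      qed (use h in \<open>auto simp: indicator_def\<close>)
      then show ?case unfolding fin by (simp add: LIMSEQ_const_iff)
    qed auto
  qed
  have pos: "AE x in \<zeta>. r * h x \<le> 0" for r
  proof -
    let ?S = "{x \<in> space \<zeta>. r * h x > 0}"
    have "?S \<in> sets \<zeta>" using h by measurable
    then have S: "?S \<in> sets borel"
      unfolding sets_zeta by (subst (asm) sets_restrict_space_iff) (use closed_SG in auto)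
    have "AE x in \<zeta>. r * (h x * indicator ?S x) = 0"
    proof (subst integral_nonneg_eq_0_iff_AE[symmetric])
      show "(\<integral>x. r * (h x * indicator ?S x) \<partial>\<zeta>) = 0" using borel[OF S] by simp
    qed (use int[OF S] in \<open>auto simp: indicator_def\<close>)
    then show ?thesis
      by (rule AE_mp) (auto intro!: AE_I2 simp: indicator_def not_less[symmetric])
  qed
  show ?thesis using pos[of 1] pos[of "-1"] by eventually_elim simp
qed

lemma L_diff_fun:
  assumes "integrable \<zeta> f" "integrable \<zeta> g" "continuous_on K v"
  shows "L (\<lambda>x. f x - g x) w v = L f w v - L g w v"
  unfolding L_def using L_integrable[OF assms(1,3), of w] L_integrable[OF assms(2,3), of w]
  by (simp add: left_diff_distrib)

text \<open>Normal derivatives depend on \<open>u\<close> alone, so fluxes with \<open>f\<close> and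
  with \<open>g\<close> agree, and hence so do all moments against harmonic functions on cells.
  These span the interpolants, which approximate every continuous function uniformly; test functions
  need not vanish on V_0 here.\<close>

lemma laplacian_AE_unique:
  assumes "has_laplacian q \<zeta> u f" "has_laplacian q \<zeta> u g" shows "AE x in \<zeta>. f x = g x"
proof -
  have f: "integrable \<zeta> f" "integrable \<zeta> g"
    using assms square_integrable_imp_integrable by (simp_all add: has_laplacian_def)
  define h where "h x = f x - g x" for x
  have h: "integrable \<zeta> h" using f by (simp add: h_def[abs_def])
  have "L f w (harm (unit3 i)) = L g w (harm (unit3 i))" for w i
    using normal_deriv_eq_flux[OF assms(1), of w i] normal_deriv_eq_flux[OF assms(2), of w i] by (simp add: flux_def)
  then have 0: "L h w (harm (unit3 i)) = 0" for w i
    unfolding h_def[abs_def] by (simp add: L_diff_fun f continuous_on_harm)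
  have "AE x in \<zeta>. h x = 0"
  proof (rule integral_continuous_zero_imp_AE_zero[OF h])
    fix v :: "complex \<Rightarrow> real" assume v: "continuous_on K v"
    have "L h [] (spline n v) = 0" for n by (simp add: L_spline_eq_sum[OF h] 0)
    then have "L h [] v = 0" using L_spline_tendsto[OF h v, of "[]"] by (simp add: LIMSEQ_const_iff)
    then show "(\<integral>x. h x * v x \<partial>\<zeta>) = 0" by (simp add: L_Nil)
  qed
  then show ?thesis by eventually_elim (simp add: h_def)
qed

lemma has_laplacian_linear:
  assumes "has_laplacian q \<zeta> u f" "has_laplacian q \<zeta> v g"
  shows "has_laplacian q \<zeta> (\<lambda>x. r * u x + v x) (\<lambda>x. r * f x + g x)"
proof -
  have f: "f \<in> L2" "g \<in> L2" and u: "u \<in> dom_energy q" "v \<in> dom_energy q"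
    using assms by (simp_all add: has_laplacian_def)
  note fi = square_integrable_imp_integrable[of f] square_integrable_imp_integrable[of g]
  have d: "(\<lambda>x. r * u x + v x) \<in> dom_energy q" by (intro dom_energy_add dom_energy_scale u)
  have "energy_form q (\<lambda>x. r * u x + v x) z = - (\<integral>x. (r * f x + g x) * z x \<partial>\<zeta>)"
    if z: "z \<in> dom_energy q" "\<forall>p\<in>sg_vertices q 0. z p = 0" for z
  proof -
    have e: "(\<lambda>n. r * en n u z + en n v z) \<longlonglongrightarrow> r * energy_form q u z + energy_form q v z"
      by (intro tendsto_intros tendsto_energy_form u z)
    have "energy_form q (\<lambda>x. r * u x + v x) z = r * energy_form q u z + energy_form q v z"
      using tendsto_energy_form[OF d z(1)] e unfolding en_add_left en_scale_left by (rule LIMSEQ_unique)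
    also have "\<dots> = r * (- (\<integral>x. f x * z x \<partial>\<zeta>)) + (- (\<integral>x. g x * z x \<partial>\<zeta>))"
      using assms z unfolding has_laplacian_def by simp
    also have "\<dots> = - (\<integral>x. r * (f x * z x) + g x * z x \<partial>\<zeta>)"
    proof -
      have "integrable \<zeta> (\<lambda>x. k x * z x)" if "k \<in> L2" for k
      proof -
        have "integrable \<zeta> (\<lambda>x. k x * ext [] z x)"
          by (rule L_integrable) (use that square_integrable_imp_integrable dom_energy_continuous[OF z(1)] in auto)
        moreover have "integrable \<zeta> (\<lambda>x. k x * ext [] z x) \<longleftrightarrow> integrable \<zeta> (\<lambda>x. k x * z x)"
          by (intro Bochner_Integration.integrable_cong) (auto simp: ext_def space_zeta)
        ultimately show ?thesis by simp
      qed
      then show ?thesis using f by simp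
    qed
    finally show ?thesis by (simp add: algebra_simps)
  qed
  then show ?thesis unfolding has_laplacian_def using d L2_linear[OF f] by simp
qed

lemma has_laplacian_cong_AE:
  assumes "has_laplacian q \<zeta> u f" "g \<in> L2" "AE x in \<zeta>. f x = g x"
  shows "has_laplacian q \<zeta> u g"
proof -
  have "(\<integral>x. f x * v x \<partial>\<zeta>) = (\<integral>x. g x * v x \<partial>\<zeta>)" if "v \<in> dom_energy q" for v
  proof (rule integral_cong_AE)
    have v: "v \<in> borel_measurable \<zeta>"
      using borel_measurable_continuous_on_restrict[OF dom_energy_continuous[OF that]]
      unfolding measurable_cong_sets[OF sets_zeta refl] .
    show "(\<lambda>x. f x * v x) \<in> borel_measurable \<zeta>" "(\<lambda>x. g x * v x) \<in> borel_measurable \<zeta>"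
      by (rule borel_measurable_times[OF _ v], rule L2_measurable, use assms in \<open>simp add: has_laplacian_def\<close>)+
    show "AE x in \<zeta>. f x * v x = g x * v x" using assms(3) by eventually_elim simp
  qed
  then show ?thesis using assms unfolding has_laplacian_def by simp
qed

lemma laplacian_has_laplacian:
  assumes "u \<in> dom_laplacian q \<zeta>" shows "has_laplacian q \<zeta> u (laplacian q \<zeta> u)"
proof -
  obtain f where "has_laplacian q \<zeta> u f" using assms by (auto simp: dom_laplacian_def)
  then show ?thesis unfolding laplacian_def by (rule someI[of "has_laplacian q \<zeta> u"])
qed

lemma bending_eq:
  assumes "has_laplacian q \<zeta> u f" shows "bending q \<zeta> u = ip f f"
proof -
  have l: "has_laplacian q \<zeta> u (laplacian q \<zeta> u)"
    using assms by (intro laplacian_has_laplacian) (auto simp: dom_laplacian_def)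
  have a: "AE x in \<zeta>. laplacian q \<zeta> u x = f x" by (rule laplacian_AE_unique[OF l assms])
  have 2: "laplacian q \<zeta> u \<in> L2" "f \<in> L2" using l assms by (auto simp: has_laplacian_def)
  have "bending q \<zeta> u = ip (laplacian q \<zeta> u) (laplacian q \<zeta> u)"
    by (simp add: bending_def ip_def power2_eq_square)
  also have "\<dots> = ip f f" using ip_cong_AE[OF 2 2(1) a] ip_cong_AE[OF 2 2(2) a] ip_commute by metis
  finally show ?thesis .
qed

section \<open>Projections and moment problems in finite-dimensional spans\<close>

definition lin_span :: "('i \<Rightarrow> complex \<Rightarrow> real) \<Rightarrow> 'i set \<Rightarrow> (complex \<Rightarrow> real) set" where
  "lin_span g I = {\<lambda>x. \<Sum>i\<in>I. c i * g i x | c. True}"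

definition L2_subspace :: "(complex \<Rightarrow> real) set \<Rightarrow> bool" where
  "L2_subspace W \<longleftrightarrow> W \<subseteq> L2 \<and> (\<lambda>_. 0) \<in> W \<and> (\<forall>r. \<forall>u\<in>W. \<forall>v\<in>W. (\<lambda>x. r * u x + v x) \<in> W)"

lemma lin_span_linear: "u \<in> lin_span g I \<Longrightarrow> v \<in> lin_span g I \<Longrightarrow> (\<lambda>x. r * u x + v x) \<in> lin_span g I"
  unfolding lin_span_def
proof clarify
  fix c d
  show "\<exists>e. (\<lambda>x. r * (\<Sum>i\<in>I. c i * g i x) + (\<Sum>i\<in>I. d i * g i x)) = (\<lambda>x. \<Sum>i\<in>I. e i * g i x) \<and> True"
    by (rule exI[of _ "\<lambda>i. r * c i + d i"]) (simp add: sum_distrib_left distrib_right sum.distrib mult.assoc)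
qed

lemma lin_span_zero: "(\<lambda>_. 0) \<in> lin_span g I"
  unfolding lin_span_def by (intro CollectI exI[of _ "\<lambda>_. 0"]) simp

lemma lin_span_diff: "u \<in> lin_span g I \<Longrightarrow> v \<in> lin_span g I \<Longrightarrow> (\<lambda>x. u x - v x) \<in> lin_span g I"
  using lin_span_linear[of v g I u "-1"] by simp

lemma lin_span_mono:
  assumes "finite J" "I \<subseteq> J" shows "lin_span g I \<subseteq> lin_span g J"
proof
  fix u assume "u \<in> lin_span g I"
  then obtain c where u: "u = (\<lambda>x. \<Sum>i\<in>I. c i * g i x)" by (auto simp: lin_span_def)
  have "(\<Sum>i\<in>I. c i * g i x) = (\<Sum>i\<in>J. (if i \<in> I then c i else 0) * g i x)" for x
    by (rule sum.mono_neutral_cong_left) (use assms in auto)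
  then show "u \<in> lin_span g J" unfolding u lin_span_def by auto
qed

lemma lin_span_base: "finite I \<Longrightarrow> i \<in> I \<Longrightarrow> g i \<in> lin_span g I"
  unfolding lin_span_def
  by (intro CollectI exI[of _ "\<lambda>j. if j = i then 1 else 0"]) (auto simp: if_distrib[of "\<lambda>c. c * _"] sum.delta cong: if_cong)

lemma lin_span_L2:
  assumes "finite I" "\<And>i. i \<in> I \<Longrightarrow> g i \<in> L2" shows "lin_span g I \<subseteq> L2"
proof
  fix u assume "u \<in> lin_span g I"
  then obtain c where u: "u = (\<lambda>x. \<Sum>i\<in>I. c i * g i x)" by (auto simp: lin_span_def)
  show "u \<in> L2" unfolding u using assms
  proof (induction I rule: finite_induct)
    case (insert i I)
    then show ?case using L2_linear[of "g i" "\<lambda>x. \<Sum>i\<in>I. c i * g i x" "c i"] by simp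
  qed (use L2_zero in simp)
qed

lemma L2_subspace_lin_span:
  "finite I \<Longrightarrow> (\<And>i. i \<in> I \<Longrightarrow> g i \<in> L2) \<Longrightarrow> L2_subspace (lin_span g I)"
  using lin_span_L2[of I g] by (auto simp: L2_subspace_def lin_span_zero lin_span_linear)

text \<open>Stated for subspaces of a span because one application uses a subspace given by a
  condition, without known generators. Induction on the generators is Gram-Schmidt: if
  \<open>W\<close> is not inside the smaller span, it is its intersection \<open>W'\<close> with
  that span plus one direction \<open>w1\<close> orthogonal to \<open>W'\<close>.\<close>

lemma projection_exists:
  assumes "finite I" "L2_subspace W" "W \<subseteq> lin_span g I" "f \<in> L2"
  shows "\<exists>p\<in>W. \<forall>w\<in>W. ip (\<lambda>x. f x - p x) w = 0"
  using assms
proof (induction I arbitrary: W f rule: finite_induct)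
  case empty
  have z: "w = (\<lambda>_. 0)" if "w \<in> W" for w using that empty by (auto simp: lin_span_def)
  have "ip (\<lambda>x. f x - 0) w = 0" if "w \<in> W" for w unfolding z[OF that] by (simp add: ip_def)
  moreover have "(\<lambda>_. 0) \<in> W" using empty by (simp add: L2_subspace_def)
  ultimately show ?case by (intro bexI[of _ "\<lambda>_. 0"]) auto
next
  case (insert i I)
  have W: "W \<subseteq> L2" "(\<lambda>_. 0) \<in> W" "\<And>r u v. u \<in> W \<Longrightarrow> v \<in> W \<Longrightarrow> (\<lambda>x. r * u x + v x) \<in> W"
    using insert.prems by (auto simp: L2_subspace_def)
  show ?case
  proof (cases "W \<subseteq> lin_span g I")
    case True
    then show ?thesis using insert by blast
  next
    case False
    then obtain w0 where w0: "w0 \<in> W" "w0 \<notin> lin_span g I" by blast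
    have split: "\<exists>c s. s \<in> lin_span g I \<and> w = (\<lambda>x. c * g i x + s x)" if w: "w \<in> W" for w
    proof -
      obtain c where "w = (\<lambda>x. \<Sum>i\<in>insert i I. c i * g i x)" using w insert.prems(2) unfolding lin_span_def by blast
      then show ?thesis using insert.hyps
        by (intro exI[of _ "c i"] exI[of _ "\<lambda>x. \<Sum>i\<in>I. c i * g i x"]) (auto simp: lin_span_def)
    qed
    obtain c s where cs: "s \<in> lin_span g I" "w0 = (\<lambda>x. c * g i x + s x)" using split[OF w0(1)] by blast
    have c0: "c \<noteq> 0" using cs w0(2) by auto
    define W' where "W' = W \<inter> lin_span g I"
    have W': "L2_subspace W'" "W' \<subseteq> lin_span g I"
      using W lin_span_zero lin_span_linear by (auto simp: W'_def L2_subspace_def)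
    obtain p0 where p0: "p0 \<in> W'" "\<And>w. w \<in> W' \<Longrightarrow> ip (\<lambda>x. w0 x - p0 x) w = 0"
      using insert.IH[OF W', of w0] w0 W by blast
    define w1 where "w1 x = w0 x - p0 x" for x
    have w1: "w1 \<in> W" using W(3)[of p0 w0 "-1"] p0 w0 by (simp add: w1_def[abs_def] W'_def)
    have orth: "ip w1 w = 0" if "w \<in> W'" for w using p0(2)[OF that] by (simp add: w1_def[abs_def])
    have dec: "\<exists>t w'. w' \<in> W' \<and> w = (\<lambda>x. t * w1 x + w' x)" if w: "w \<in> W" for w
    proof -
      obtain d s' where ds: "s' \<in> lin_span g I" "w = (\<lambda>x. d * g i x + s' x)" using split[OF w] by blast
      \<comment> \<open>The factor \<open>d / c\<close> cancels the component along
        \<open>g i\<close>, so the remainder falls into the smaller span.\<close>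
      define w' where "w' x = (- (d / c)) * w1 x + w x" for x
      have "w' = (\<lambda>x. (d / c) * p0 x + ((- (d / c)) * s x + s' x))"
        using c0 by (auto simp: w'_def w1_def ds(2) cs(2) field_simps)
      moreover have "\<dots> \<in> lin_span g I"
        using p0(1) by (intro lin_span_linear cs ds) (auto simp: W'_def)
      moreover have "w' \<in> W" unfolding w'_def[abs_def] by (rule W(3)[OF w1 w])
      ultimately have "w' \<in> W'" by (simp add: W'_def)
      moreover have "w = (\<lambda>x. (d / c) * w1 x + w' x)" by (auto simp: w'_def)
      ultimately show ?thesis by blast
    qed
    obtain p' where p': "p' \<in> W'" "\<And>w. w \<in> W' \<Longrightarrow> ip (\<lambda>x. f x - p' x) w = 0"
      using insert.IH[OF W' insert.prems(3)] by blast
    \<comment> \<open>If \<open>w1\<close> vanishes almost everywhere, then \<open>t\<close> is 0 by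
      the convention on division, and orthogonality to \<open>w1\<close> is automatic.\<close>
    define t where "t = ip f w1 / ip w1 w1"
    define p where "p x = t * w1 x + p' x" for x
    have p'W: "p' \<in> W" using p' by (simp add: W'_def)
    have pW: "p \<in> W" using W(3)[OF w1 p'W] by (simp add: p_def[abs_def])
    have l2: "w1 \<in> L2" "p' \<in> L2" "p \<in> L2" using w1 p'W pW W(1) by blast+
    note f = insert.prems(3)
    have p_ip: "ip p z = t * ip w1 z + ip p' z" if "z \<in> L2" for z
      unfolding p_def[abs_def] by (rule ip_linear_left[OF l2(1,2) that])
    have 1: "ip (\<lambda>x. f x - p x) w1 = 0"
    proof (cases "ip w1 w1 = 0")
      case True
      have "ip (\<lambda>x. f x - p x) w1 = ip w1 (\<lambda>x. f x - p x)" by (rule ip_commute)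
      also have "\<dots> = 0" by (rule ip_eq_0_right[OF l2(1) L2_diff[OF f l2(3)] True])
      finally show ?thesis .
    next
      case False
      have "ip p' w1 = 0" using orth[OF p'(1)] ip_commute by metis
      then show ?thesis using False by (simp add: ip_diff_left[OF f l2(3,1)] p_ip[OF l2(1)] t_def)
    qed
    have 2: "ip (\<lambda>x. f x - p x) w = 0" if w: "w \<in> W'" for w
    proof -
      have wl: "w \<in> L2" using w W(1) by (auto simp: W'_def)
      show ?thesis using p'(2)[OF w] orth[OF w]
        by (simp add: ip_diff_left[OF f l2(3) wl] ip_diff_left[OF f l2(2) wl] p_ip[OF wl])
    qed
    have "ip (\<lambda>x. f x - p x) w = 0" if w: "w \<in> W" for w
    proof -
      obtain t' w' where tw: "w' \<in> W'" "w = (\<lambda>x. t' * w1 x + w' x)" using dec[OF w] by blast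
      have "w' \<in> L2" using tw W(1) by (auto simp: W'_def)
      then show ?thesis unfolding tw(2) using ip_linear_right[OF l2(1) _ L2_diff[OF f l2(3)]] 1 2[OF tw(1)] by simp
    qed
    then show ?thesis using pW by blast
  qed
qed

text \<open>A dual basis: the part of \<open>g i\<close> orthogonal to the other generators is not
  almost everywhere 0, since that would be a relation with coefficient 1 at \<open>i\<close>. After
  normalization the solution is the combination with coefficients \<open>D i\<close>.\<close>

lemma moment_problem_solvable:
  fixes D :: "'i \<Rightarrow> real"
  assumes fin: "finite I" and gL: "\<And>i. i \<in> I \<Longrightarrow> g i \<in> L2"
    and indep: "\<And>c i. AE x in \<zeta>. (\<Sum>i\<in>I. c i * g i x) = 0 \<Longrightarrow> i \<in> I \<Longrightarrow> c i = 0"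
  shows "\<exists>p\<in>lin_span g I. \<forall>i\<in>I. ip p (g i) = D i"
proof -
  have spL: "lin_span g I \<subseteq> L2" by (rule lin_span_L2[OF fin gL])
  have dual: "\<exists>r\<in>lin_span g I. ip r (g i) = 1 \<and> (\<forall>j\<in>I - {i}. ip r (g j) = 0)" if i: "i \<in> I" for i
  proof -
    have fin': "finite (I - {i})" using fin by simp
    obtain p where p: "p \<in> lin_span g (I - {i})" "\<And>w. w \<in> lin_span g (I - {i}) \<Longrightarrow> ip (\<lambda>x. g i x - p x) w = 0"
      using projection_exists[OF fin' L2_subspace_lin_span[OF fin'] order_refl gL[OF i]] gL by blast
    define r where "r x = g i x - p x" for x
    have pI: "p \<in> lin_span g I" using p(1) lin_span_mono[OF fin, of "I - {i}" g] by blast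
    have r: "r \<in> lin_span g I" unfolding r_def[abs_def] by (intro lin_span_diff lin_span_base fin i pI)
    have rL: "r \<in> L2" and pL: "p \<in> L2" using r pI spL by blast+
    have r0: "ip r w = 0" if "w \<in> lin_span g (I - {i})" for w using p(2)[OF that] by (simp add: r_def[abs_def])
    have "ip r r = ip r (g i)"
      using ip_diff_right[OF gL[OF i] pL rL] r0[OF p(1)] by (simp add: r_def[symmetric])
    moreover have "ip r r \<noteq> 0"
    proof
      assume "ip r r = 0"
      then have ae: "AE x in \<zeta>. r x = 0" by (rule ip_eq_0_AE[OF rL])
      obtain c where c: "p = (\<lambda>x. \<Sum>j\<in>I - {i}. c j * g j x)" using p(1) by (auto simp: lin_span_def)
      define c' where "c' j = (if j = i then 1 else - c j)" for j
      have "r x = (\<Sum>j\<in>I. c' j * g j x)" for x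
      proof -
        have "(\<Sum>j\<in>I. c' j * g j x) = c' i * g i x + (\<Sum>j\<in>I - {i}. c' j * g j x)"
          by (rule sum.remove[OF fin i])
        also have "(\<Sum>j\<in>I - {i}. c' j * g j x) = - (\<Sum>j\<in>I - {i}. c j * g j x)"
          unfolding sum_negf[symmetric] by (rule sum.cong) (auto simp: c'_def)
        finally show ?thesis by (simp add: r_def c c'_def)
      qed
      then have "c' i = 0" using indep[of c' i] ae i by simp
      then show False by (simp add: c'_def)
    qed
    ultimately have nz: "ip r (g i) \<noteq> 0" by simp
    define r' where "r' x = (1 / ip r (g i)) * r x + 0" for x
    have "r' \<in> lin_span g I" unfolding r'_def[abs_def] by (rule lin_span_linear[OF r lin_span_zero])
    moreover have ip': "ip r' z = (1 / ip r (g i)) * ip r z" if "z \<in> L2" for z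
      unfolding r'_def[abs_def] using ip_linear_left[OF rL L2_zero that] by (simp add: ip_def)
    moreover have "ip r' (g i) = 1" using ip'[OF gL[OF i]] nz by simp
    moreover have "ip r' (g j) = 0" if "j \<in> I - {i}" for j
      using ip'[of "g j"] gL that r0[OF lin_span_base[OF fin' that]] by simp
    ultimately show ?thesis by blast
  qed
  have "J \<subseteq> I \<Longrightarrow> \<exists>p\<in>lin_span g I. \<forall>i\<in>I. ip p (g i) = (if i \<in> J then D i else 0)" if "finite J" for J
    using that
  proof (induction J rule: finite_induct)
    case empty
    show ?case by (intro bexI[OF _ lin_span_zero]) (simp add: ip_def)
  next
    case (insert i J)
    then obtain p where p: "p \<in> lin_span g I" "\<And>j. j \<in> I \<Longrightarrow> ip p (g j) = (if j \<in> J then D j else 0)" by auto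
    obtain r where r: "r \<in> lin_span g I" "ip r (g i) = 1" "\<And>j. j \<in> I \<Longrightarrow> j \<noteq> i \<Longrightarrow> ip r (g j) = 0"
      using dual[of i] insert.prems by auto
    have "ip (\<lambda>x. D i * r x + p x) (g j) = (if j \<in> insert i J then D j else 0)" if j: "j \<in> I" for j
    proof -
      have "ip (\<lambda>x. D i * r x + p x) (g j) = D i * ip r (g j) + ip p (g j)"
        by (rule ip_linear_left) (use r p spL gL[OF j] in auto)
      then show ?thesis using r p(2)[OF j] insert.hyps j by (cases "j = i") auto
    qed
    then show ?case using lin_span_linear[OF r(1) p(1)] by blast
  qed
  from this[OF fin order_refl] show ?thesis by simp
qed

end

section \<open>Functions harmonic on each cell\<close>

context gasket
begin

lemma cell_Cons: "cell (i # w) = F i ` cell w" by (auto simp: cell_def)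

lemma finite_cell_Int:
  assumes "length w = length w'" "w \<noteq> w'" shows "finite (cell w \<inter> cell w')"
  using assms
proof (induction w w' rule: list_induct2)
  case (Cons i w j w')
  show ?case
  proof (cases "i = j")
    case True
    have "F i ` cell w \<inter> F i ` cell w' = F i ` (cell w \<inter> cell w')" by auto
    then show ?thesis using Cons True by (simp add: cell_Cons)
  next
    case False
    have "F i ` cell w \<inter> F j ` cell w' \<subseteq> {F i (q j)}"
    proof
      fix x assume "x \<in> F i ` cell w \<inter> F j ` cell w'"
      then obtain a b where ab: "a \<in> cell w" "b \<in> cell w'" "x = F i a" "F i a = F j b" by auto
      then have "a = q j" using F_eq_F(1)[OF _ _ ab(4) False] cell_subset by blast
      then show "x \<in> {F i (q j)}" using ab by simp
    qed
    then show ?thesis unfolding cell_Cons by (rule finite_subset) simp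
  qed
qed simp

definition overlap :: "nat \<Rightarrow> complex set" where
  "overlap m = (\<Union>(w, w')\<in>{(w, w'). w \<in> words m \<and> w' \<in> words m \<and> w \<noteq> w'}. cell w \<inter> cell w')"

lemma finite_overlap: "finite (overlap m)"
proof -
  have "{(w, w'). w \<in> words m \<and> w' \<in> words m \<and> w \<noteq> w'} \<subseteq> words m \<times> words m" by auto
  then have "finite {(w, w'). w \<in> words m \<and> w' \<in> words m \<and> w \<noteq> w'}" by (rule finite_subset) simp
  then show ?thesis unfolding overlap_def by (auto intro!: finite_cell_Int simp: words_def)
qed

lemma overlap_subset: "overlap m \<subseteq> K" using cell_subset by (auto simp: overlap_def)

text \<open>Needed so that a prescribed one-sided flux can be compensated at the same point. If the
  inner point \<open>FW w (q i)\<close> is a corner \<open>q l\<close>, then \<open>l\<close>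
  differs from \<open>j\<close>, and \<open>F j (q l) = F l (q j)\<close> gives the address
  \<open>l\<close> followed by copies of \<open>j\<close>; otherwise the inner point has a second
  address already.\<close>

lemma second_address:
  assumes "FW w (q i) \<notin> range q"
  shows "\<exists>w' i'. length w' = length w \<and> (w', i') \<noteq> (w, i) \<and> FW w' (q i') = FW w (q i)"
  using assms
proof (induction w)
  case (Cons j w)
  show ?case
  proof (cases "FW w (q i) \<in> range q")
    case True
    then obtain l where l: "FW w (q i) = q l" by auto
    have "l \<noteq> j"
    proof
      assume "l = j"
      then have "FW (j # w) (q i) = q j" using l by simp
      then show False using Cons.prems by blast
    qed
    have "FW (replicate k j) (q j) = q j" for k by (induction k) auto
    then have "FW (l # replicate (length w) j) (q j) = FW (j # w) (q i)"
      using l F_q_commute[of l j] by simp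
    then show ?thesis using \<open>l \<noteq> j\<close>
      by (intro exI[of _ "l # replicate (length w) j"] exI[of _ j]) simp
  next
    case False
    obtain w' i' where "length w' = length w" "(w', i') \<noteq> (w, i)" "FW w' (q i') = FW w (q i)"
      using Cons.IH[OF False] by blast
    then show ?thesis by (intro exI[of _ "j # w'"] exI[of _ i']) auto
  qed
qed auto

end

context gasket_measure
begin

definition cell_fun :: "3 list \<times> 3 \<Rightarrow> complex \<Rightarrow> real" where
  "cell_fun p = ext (fst p) (harm (unit3 (snd p)))"

definition cell_index :: "nat \<Rightarrow> (3 list \<times> 3) set" where "cell_index m = words m \<times> UNIV"

lemma finite_cell_index [simp]: "finite (cell_index m)" by (simp add: cell_index_def)

lemma ip_cell_fun: "ip f (cell_fun (w, i)) = L f w (harm (unit3 i))"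
  by (simp add: ip_def L_def cell_fun_def)

lemma cell_fun_L2: "cell_fun p \<in> L2"
proof -
  have m: "cell_fun p \<in> borel_measurable \<zeta>"
    unfolding cell_fun_def by (intro measurable_zeta ext_measurable continuous_on_harm)
  have b: "\<bar>cell_fun p x\<bar> \<le> 1" for x
  proof -
    have "\<bar>harm (unit3 i) y\<bar> \<le> 1" if "y \<in> K" for i y
      using harm_bounds[OF that, of 0 "unit3 i" 1] by (simp add: unit3_def abs_le_iff)
    then show ?thesis by (auto simp: cell_fun_def ext_def cell_def)
  qed
  have "integrable \<zeta> (\<lambda>x. (cell_fun p x)\<^sup>2)"
  proof (rule Bochner_Integration.integrable_bound[of _ "\<lambda>_. 1::real"])
    show "AE x in \<zeta>. norm ((cell_fun p x)\<^sup>2) \<le> norm (1::real)"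
      using b by (intro AE_I2) (simp add: abs_square_le_1)
  qed (use m in auto)
  then show ?thesis using m by (simp add: square_integrable_def)
qed

lemma span_on_cell:
  assumes "w \<in> words m" "x \<in> cell w" "x \<notin> overlap m"
  shows "(\<Sum>p\<in>cell_index m. c p * cell_fun p x) = harm (\<lambda>j. c (w, j)) (winv w x)"
proof -
  have K: "winv w x \<in> K" using assms(2) by (auto simp: cell_def)
  have "(\<Sum>p\<in>cell_index m. c p * cell_fun p x) = (\<Sum>w'\<in>words m. \<Sum>j\<in>UNIV. c (w', j) * ext w' (harm (unit3 j)) x)"
    unfolding cell_index_def cell_fun_def sum.cartesian_product by (simp add: case_prod_unfold)
  also have "\<dots> = (\<Sum>w'\<in>words m. if w' = w then harm (\<lambda>j. c (w, j)) (winv w x) else 0)"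
  proof (rule sum.cong[OF refl])
    fix w' assume w': "w' \<in> words m"
    show "(\<Sum>j\<in>UNIV. c (w', j) * ext w' (harm (unit3 j)) x) = (if w' = w then harm (\<lambda>j. c (w, j)) (winv w x) else 0)"
    proof (cases "w' = w")
      case True
      then show ?thesis using assms(2) harm_unit3_sum[OF K, of "\<lambda>j. c (w, j)"] by (simp add: ext_def)
    next
      case False
      then have "x \<notin> cell w'" using assms w' by (auto simp: overlap_def)
      then show ?thesis using False by (simp add: ext_def)
    qed
  qed
  also have "\<dots> = harm (\<lambda>j. c (w, j)) (winv w x)" using assms(1) by simp
  finally show ?thesis .
qed

lemma AE_not_overlap: "AE x in \<zeta>. x \<notin> overlap m"
  by (rule AE_not_finite[OF finite_overlap overlap_subset])

text \<open>If \<open>c (w, i)\<close> were nonzero, the combination would be nonzero, by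
  continuity, on a small cell around the corner \<open>i\<close> of the cell of \<open>w\<close>, up
  to finitely many points. Every cell has positive mass, so it could not vanish almost
  everywhere.\<close>

lemma cell_fun_independent:
  assumes "AE x in \<zeta>. (\<Sum>p\<in>cell_index m. c p * cell_fun p x) = 0" "p \<in> cell_index m"
  shows "c p = 0"
proof (rule ccontr)
  obtain w i where p: "p = (w, i)" "w \<in> words m" using assms(2) by (auto simp: cell_index_def)
  assume "c p \<noteq> 0"
  define a where "a j = c (w, j)" for j
  have ai: "a i \<noteq> 0" using \<open>c p \<noteq> 0\<close> by (simp add: a_def p)
  obtain d where d: "d > 0" "\<And>y. y \<in> K \<Longrightarrow> dist y (q i) < d \<Longrightarrow> dist (harm a y) (harm a (q i)) < \<bar>a i\<bar>"
    using continuous_on_harm[of a] ai unfolding continuous_on_iff by (metis q_in_SG zero_less_abs_iff)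
  obtain D where D: "\<And>x y. x \<in> K \<Longrightarrow> y \<in> K \<Longrightarrow> dist x y \<le> D"
    using bounded_two_points[of K] compact_imp_bounded[OF compact_SG] by blast
  obtain k where k: "D / d < 2 ^ k" using real_arch_pow[of 2 "D / d"] by auto
  have nz: "harm a (FW (replicate k i) z) \<noteq> 0" if z: "z \<in> K" for z
  proof -
    have "dist (FW (replicate k i) z) (q i) = dist z (q i) / 2 ^ k"
      using dist_FW[of "replicate k i" z "q i"] by (simp add: FW_replicate_q)
    also have "\<dots> \<le> D / 2 ^ k" by (intro divide_right_mono D z) auto
    also have "\<dots> < d" using k d(1) by (simp add: field_simps)
    finally have "dist (harm a (FW (replicate k i) z)) (a i) < \<bar>a i\<bar>" using d(2)[of "FW (replicate k i) z"] z by simp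
    then show ?thesis by (auto simp: dist_real_def)
  qed
  have "AE x in \<zeta>. x \<notin> cell (w @ replicate k i)"
    using assms(1) AE_not_overlap[of m]
  proof eventually_elim
    case (elim x)
    show ?case
    proof
      assume x: "x \<in> cell (w @ replicate k i)"
      then obtain z where z: "z \<in> K" "x = FW w (FW (replicate k i) z)" by (auto simp: cell_def sg_word_append)
      have "(\<Sum>p\<in>cell_index m. c p * cell_fun p x) = harm a (winv w x)"
        unfolding a_def by (rule span_on_cell[OF p(2) _ elim(2)]) (use x cell_append_subset in blast)
      then show False using elim(1) nz[OF z(1)] z by simp
    qed
  qed
  then have "cell (w @ replicate k i) \<in> null_sets \<zeta>" using AE_iff_null_sets[OF cell_in_sets] by blast
  then show False using cell_positive[of "w @ replicate k i"] by (simp add: null_sets_def)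
qed

lemma flux_linear:
  assumes "f \<in> L2" "g \<in> L2"
  shows "flux (\<lambda>x. r * u x + v x) (\<lambda>x. r * f x + g x) w i = r * flux u f w i + flux v g w i"
proof -
  have "Qform ((\<lambda>x. r * u x + v x) \<circ> FW w \<circ> q) (unit3 i) = r * Qform (u \<circ> FW w \<circ> q) (unit3 i) + Qform (v \<circ> FW w \<circ> q) (unit3 i)"
    by (simp add: Qform_unit3 algebra_simps)
  then show ?thesis
    unfolding flux_def ip_cell_fun[symmetric] ip_linear_left[OF assms cell_fun_L2] by (simp add: algebra_simps)
qed

text \<open>The balance condition on V_m involves the Laplacian only through fluxes. Equal moments
  make \<open>flux u g\<close> and \<open>flux u f\<close> equal, so the condition carries over from
  \<open>f\<close> to \<open>g\<close>.\<close>

lemma same_moments_has_laplacian: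
  assumes "has_laplacian q \<zeta> u f" "g \<in> L2"
    and "\<And>p. p \<in> cell_index m \<Longrightarrow> ip g (cell_fun p) = ip f (cell_fun p)"
  obtains v where "has_laplacian q \<zeta> v g" "\<And>p. p \<in> sg_vertices q m \<Longrightarrow> v p = u p"
    "\<And>w i. w \<in> words m \<Longrightarrow> flux v g w i = flux u f w i"
proof -
  have fl: "flux u g w i = flux u f w i" if "w \<in> words m" for w i
    using assms(3)[of "(w, i)"] that by (simp add: flux_def ip_cell_fun cell_index_def)
  have g: "square_integrable \<zeta> g" using assms(2) by simp
  obtain v where v: "has_laplacian q \<zeta> v g" "\<And>p. p \<in> sg_vertices q m \<Longrightarrow> v p = u p"
  proof (rule exists_has_laplacian_with_values[OF g, where m=m and \<alpha>=u])
    fix z :: "complex \<Rightarrow> real" assume "\<And>i. z (q i) = 0"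
    then show "(\<Sum>w\<in>words m. \<Sum>i\<in>UNIV. z (FW w (q i)) * flux u g w i) = 0"
      using has_laplacian_flux_sum[OF assms(1), of z m] by (simp add: fl)
  qed (rule that)
  have "flux v g w i = flux u f w i" if w: "w \<in> words m" for w i
  proof -
    have "FW w (q j) \<in> sg_vertices q m" for j using w by (auto simp: vertices_eq_words words_def)
    then have "v \<circ> FW w \<circ> q = u \<circ> FW w \<circ> q" using v(2) by auto
    then show ?thesis using fl[OF w, of i] by (simp add: flux_def)
  qed
  then show ?thesis using that v by blast
qed

text \<open>Choosing the moments of \<open>f\<close> makes all fluxes equal to \<open>D\<close>.
  Regrouping the balance sum by points then leaves, at each point outside V_0, the sum of
  \<open>D\<close> over its addresses.\<close>

lemma values_and_fluxes_exist:
  assumes "\<And>p. p \<notin> range q \<Longrightarrow> (\<Sum>(w, i)\<in>{(w, i). w \<in> words m \<and> FW w (q i) = p}. D w i) = 0"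
  obtains u f where "f \<in> lin_span cell_fun (cell_index m)" "has_laplacian q \<zeta> u f"
    "\<And>p. p \<in> sg_vertices q m \<Longrightarrow> u p = \<alpha> p" "\<And>w i. w \<in> words m \<Longrightarrow> flux u f w i = D w i"
proof -
  let ?T = "\<lambda>(w, i). D w i - (5/3) ^ length w * Qform (\<alpha> \<circ> FW w \<circ> q) (unit3 i)"
  obtain f where f: "f \<in> lin_span cell_fun (cell_index m)" "\<And>p. p \<in> cell_index m \<Longrightarrow> ip f (cell_fun p) = ?T p"
    using moment_problem_solvable[of "cell_index m" cell_fun ?T] cell_fun_L2 cell_fun_independent by auto
  have fL: "f \<in> L2" using f(1) lin_span_L2[of "cell_index m" cell_fun] cell_fun_L2 by auto
  then have f2: "square_integrable \<zeta> f" by simp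
  have fl: "flux \<alpha> f w i = D w i" if "w \<in> words m" for w i
    using f(2)[of "(w, i)"] that by (simp add: flux_def ip_cell_fun cell_index_def)
  obtain u where u: "has_laplacian q \<zeta> u f" "\<And>p. p \<in> sg_vertices q m \<Longrightarrow> u p = \<alpha> p"
  proof (rule exists_has_laplacian_with_values[OF f2, where m=m and \<alpha>=\<alpha>])
    fix v :: "complex \<Rightarrow> real" assume v: "\<And>i. v (q i) = 0"
    let ?g = "\<lambda>(w, i). FW w (q i)" and ?h = "\<lambda>(w, i). v (FW w (q i)) * D w i"
    have "(\<Sum>w\<in>words m. \<Sum>i\<in>UNIV. v (FW w (q i)) * flux \<alpha> f w i) = sum ?h (cell_index m)"
      unfolding cell_index_def sum.cartesian_product by (rule sum.cong) (auto simp: fl)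
    also have "\<dots> = (\<Sum>y\<in>?g ` cell_index m. sum ?h {x \<in> cell_index m. ?g x = y})"
      by (rule sum.image_gen) simp
    also have "\<dots> = 0"
    proof (rule sum.neutral, rule ballI)
      fix y
      have e: "{x \<in> cell_index m. ?g x = y} = {(w, i). w \<in> words m \<and> FW w (q i) = y}"
        by (auto simp: cell_index_def)
      have "sum ?h {x \<in> cell_index m. ?g x = y} = (\<Sum>(w, i)\<in>{(w, i). w \<in> words m \<and> FW w (q i) = y}. v y * D w i)"
        unfolding e by (rule sum.cong) auto
      also have "\<dots> = v y * (\<Sum>(w, i)\<in>{(w, i). w \<in> words m \<and> FW w (q i) = y}. D w i)"
        by (simp add: sum_distrib_left case_prod_unfold)
      also have "\<dots> = 0" using v assms[of y] by (cases "y \<in> range q") auto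
      finally show "sum ?h {x \<in> cell_index m. ?g x = y} = 0" .
    qed
    finally show "(\<Sum>w\<in>words m. \<Sum>i\<in>UNIV. v (FW w (q i)) * flux \<alpha> f w i) = 0" .
  qed (rule that)
  have "flux u f w i = D w i" if w: "w \<in> words m" for w i
  proof -
    have "FW w (q j) \<in> sg_vertices q m" for j using w by (auto simp: vertices_eq_words words_def)
    then have "u \<circ> FW w \<circ> q = \<alpha> \<circ> FW w \<circ> q" using u(2) by auto
    then show ?thesis using fl[OF w, of i] by (simp add: flux_def)
  qed
  then show ?thesis using that f(1) u by blast
qed

lemma interpolant_exists:
  fixes x :: "nat \<Rightarrow> complex"
  assumes inj: "inj_on x {1..n}" and addr: "\<And>k. k \<in> {1..n} \<Longrightarrow> length (c k) = m \<and> x k = FW (c k) (q (s k))"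
  obtains u f where "f \<in> lin_span cell_fun (cell_index m)" "has_laplacian q \<zeta> u f"
    "\<And>k. k \<in> {1..n} \<Longrightarrow> u (x k) = a k" "\<And>k. k \<in> {1..n} \<Longrightarrow> flux u f (c k) (s k) = b k"
proof -
  \<comment> \<open>Off the points \<open>x k\<close> this index is arbitrary; the values
    \<open>a (ix p)\<close> prescribed there are harmless, and \<open>D\<close> tests membership
    before using it.\<close>
  define ix where "ix p = inv_into {1..n} x p" for p
  have ix: "ix (x k) = k" if "k \<in> {1..n}" for k unfolding ix_def by (rule inv_into_f_f[OF inj that])
  define fib where "fib p = {(w, i). w \<in> words m \<and> FW w (q i) = p}" for p
  have fib_fin: "finite (fib p)" for p
    by (rule finite_subset[of _ "words m \<times> UNIV"]) (auto simp: fib_def)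
  \<comment> \<open>Only the sum of the normal derivatives over all addresses of a point has to vanish, so the value
    opposite to \<open>b k\<close> is shared equally by the other addresses.\<close>
  define D where "D w i = (let p = FW w (q i); k = ix p in if p \<in> x ` {1..n} then
      (if (w, i) = (c k, s k) then b k else - (b k / (real (card (fib p)) - 1))) else 0)" for w i
  have Dx: "D w i = (if (w, i) = (c k, s k) then b k else - (b k / (real (card (fib (x k))) - 1)))"
    if "k \<in> {1..n}" "FW w (q i) = x k" for w i k
    using that ix[OF that(1)] by (simp add: D_def Let_def)
  have z: "(\<Sum>(w, i)\<in>fib p. D w i) = 0" if p: "p \<notin> range q" for p
  proof (cases "p \<in> x ` {1..n}")
    case False
    then show ?thesis by (intro sum.neutral) (auto simp: fib_def D_def Let_def)
  next
    case True
    then obtain k where k: "k \<in> {1..n}" "p = x k" by blast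
    have ck: "(c k, s k) \<in> fib p" using addr[OF k(1)] by (simp add: fib_def words_def k(2))
    obtain w' i' where w': "length w' = length (c k)" "(w', i') \<noteq> (c k, s k)" "FW w' (q i') = FW (c k) (q (s k))"
      using second_address[of "c k" "s k"] p addr[OF k(1)] k(2) by auto
    have "(w', i') \<in> fib p" using w' addr[OF k(1)] by (simp add: fib_def words_def k(2))
    then have "{(w', i'), (c k, s k)} \<subseteq> fib p" using ck by simp
    then have "card {(w', i'), (c k, s k)} \<le> card (fib p)" by (rule card_mono[OF fib_fin])
    \<comment> \<open>There is another address to carry the opposite flux, so the denominator in
      \<open>D\<close> is not 0.\<close>
    then have c2: "card (fib p) \<ge> 2" using w'(2) by simp
    have "(\<Sum>(w, i)\<in>fib p. D w i) = D (c k) (s k) + (\<Sum>(w, i)\<in>fib p - {(c k, s k)}. D w i)"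
      using sum.remove[OF fib_fin ck, of "\<lambda>(w, i). D w i"] by simp
    also have "D (c k) (s k) = b k" using Dx[OF k(1)] addr[OF k(1)] by simp
    also have "(\<Sum>(w, i)\<in>fib p - {(c k, s k)}. D w i) = (\<Sum>_\<in>fib p - {(c k, s k)}. - (b k / (real (card (fib p)) - 1)))"
    proof (rule sum.cong[OF refl])
      fix y assume "y \<in> fib p - {(c k, s k)}"
      moreover obtain w i where y: "y = (w, i)" by force
      ultimately have "FW w (q i) = x k" "(w, i) \<noteq> (c k, s k)" by (simp_all add: fib_def k(2))
      with Dx[OF k(1) this(1)] show "(case y of (w, i) \<Rightarrow> D w i) = - (b k / (real (card (fib p)) - 1))"
        unfolding k(2) y by (simp only: if_False prod.case)
    qed
    also have "\<dots> = - b k"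
      using c2 ck fib_fin by (simp add: card_Diff_singleton of_nat_diff)
    finally show ?thesis by simp
  qed
  obtain u f where uf: "f \<in> lin_span cell_fun (cell_index m)" "has_laplacian q \<zeta> u f"
    "\<And>p. p \<in> sg_vertices q m \<Longrightarrow> u p = a (ix p)" "\<And>w i. w \<in> words m \<Longrightarrow> flux u f w i = D w i"
  proof (rule values_and_fluxes_exist[where m=m and D=D and \<alpha>="\<lambda>p. a (ix p)"])
    fix p assume "p \<notin> range q"
    from z[OF this] show "(\<Sum>(w, i)\<in>{(w, i). w \<in> words m \<and> FW w (q i) = p}. D w i) = 0"
      unfolding fib_def .
  qed (rule that)
  have "u (x k) = a k" if k: "k \<in> {1..n}" for k
  proof -
    have "x k \<in> sg_vertices q m" using addr[OF k] by (auto simp: vertices_eq_words)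
    then show ?thesis using uf(3) ix[OF k] by simp
  qed
  moreover have "flux u f (c k) (s k) = b k" if k: "k \<in> {1..n}" for k
    using uf(4)[of "c k" "s k"] addr[OF k] Dx[OF k, of "c k" "s k"] by (simp add: words_def)
  ultimately show ?thesis using that uf by blast
qed

end

section \<open>Minimization\<close>

locale interpolation_data = gasket_measure +
  fixes m n :: nat and x :: "nat \<Rightarrow> complex" and c :: "nat \<Rightarrow> 3 list" and s :: "nat \<Rightarrow> 3"
  assumes inj: "inj_on x {1..n}"
    and addr: "\<And>k. k \<in> {1..n} \<Longrightarrow> length (c k) = m \<and> x k = FW (c k) (q (s k))"
begin

text \<open>Carrying a Laplacian \<open>f\<close> along with \<open>u\<close> avoids the chosen
  representative \<open>laplacian q \<zeta> u\<close>, which is linear only up to null sets; pairs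
  combine linearly on the nose.\<close>

definition sol :: "(complex \<Rightarrow> real) \<Rightarrow> (complex \<Rightarrow> real) \<Rightarrow> (nat \<Rightarrow> real) \<Rightarrow> (nat \<Rightarrow> real) \<Rightarrow> bool" where
  "sol u f a b \<longleftrightarrow> has_laplacian q \<zeta> u f \<and> (\<forall>k\<in>{1..n}. u (x k) = a k \<and> flux u f (c k) (s k) = b k)"

lemma interpolants_iff: "u \<in> interpolants q \<zeta> n x c s a b \<longleftrightarrow> (\<exists>f. sol u f a b)"
  unfolding interpolants_def dom_laplacian_def sol_def using normal_deriv_eq_flux by auto

lemma sol_imp_interpolant: "sol u f a b \<Longrightarrow> u \<in> interpolants q \<zeta> n x c s a b"
  using interpolants_iff by blast

lemma sol_L2: "sol u f a b \<Longrightarrow> f \<in> L2" by (simp add: sol_def has_laplacian_def)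

lemma sol_linear:
  assumes "sol u f a b" "sol v g a' b'"
  shows "sol (\<lambda>x. r * u x + v x) (\<lambda>x. r * f x + g x) (\<lambda>k. r * a k + a' k) (\<lambda>k. r * b k + b' k)"
  using assms has_laplacian_linear[of u f v g r] flux_linear[OF sol_L2[OF assms(1)] sol_L2[OF assms(2)]]
  unfolding sol_def by simp

lemma sol_diff:
  assumes "sol u f a b" "sol v g a' b'"
  shows "sol (\<lambda>x. u x - v x) (\<lambda>x. f x - g x) (\<lambda>k. a k - a' k) (\<lambda>k. b k - b' k)"
  using sol_linear[OF assms(2,1), of "-1"] by simp

definition cell_span :: "(complex \<Rightarrow> real) set" where "cell_span = lin_span cell_fun (cell_index m)"

lemma cell_span_subspace: "L2_subspace cell_span"
  unfolding cell_span_def by (rule L2_subspace_lin_span) (simp_all only: finite_cell_index cell_fun_L2)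

lemma cell_span_L2: "f \<in> cell_span \<Longrightarrow> f \<in> L2"
  using cell_span_subspace by (auto simp: L2_subspace_def)

lemma cell_span_diff: "f \<in> cell_span \<Longrightarrow> g \<in> cell_span \<Longrightarrow> (\<lambda>x. f x - g x) \<in> cell_span"
  unfolding cell_span_def by (rule lin_span_diff)

lemma sol_project:
  assumes "sol u f a b"
  obtains v g where "sol v g a b" "g \<in> cell_span" "\<And>w. w \<in> cell_span \<Longrightarrow> ip (\<lambda>x. f x - g x) w = 0"
proof -
  note f = sol_L2[OF assms]
  obtain g where g: "g \<in> cell_span" "\<And>w. w \<in> cell_span \<Longrightarrow> ip (\<lambda>x. f x - g x) w = 0"
    using projection_exists[OF finite_cell_index cell_span_subspace equalityD1[OF cell_span_def] f] by blast
  have mom: "ip g (cell_fun p) = ip f (cell_fun p)" if "p \<in> cell_index m" for p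
  proof -
    have "cell_fun p \<in> cell_span" unfolding cell_span_def by (rule lin_span_base[OF finite_cell_index that])
    from g(2)[OF this] show ?thesis using ip_diff_left[OF f cell_span_L2[OF g(1)] cell_fun_L2] by simp
  qed
  have hu: "has_laplacian q \<zeta> u f" using assms by (simp add: sol_def)
  obtain v where v: "has_laplacian q \<zeta> v g" "\<And>p. p \<in> sg_vertices q m \<Longrightarrow> v p = u p"
    "\<And>w i. w \<in> words m \<Longrightarrow> flux v g w i = flux u f w i"
    proof (rule same_moments_has_laplacian[where m=m, OF hu cell_span_L2[OF g(1)]])
    fix p assume "p \<in> cell_index m" then show "ip g (cell_fun p) = ip f (cell_fun p)" by (rule mom)
  qed (rule that)
  have "sol v g a b" unfolding sol_def
  proof (intro conjI ballI v(1))
    fix k assume k: "k \<in> {1..n}"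
    have "x k \<in> sg_vertices q m" "c k \<in> words m" using addr[OF k] by (auto simp: vertices_eq_words words_def)
    then show "v (x k) = a k" "flux v g (c k) (s k) = b k" using v assms k by (auto simp: sol_def)
  qed
  then show ?thesis using that g by blast
qed

lemma ip_pythagoras:
  assumes "f \<in> L2" "g \<in> L2" "ip (\<lambda>x. f x - g x) g = 0"
  shows "ip f f = ip g g + ip (\<lambda>x. f x - g x) (\<lambda>x. f x - g x)"
proof -
  note d = L2_diff[OF assms(1,2)]
  have "ip f g = ip g g" using assms(3) ip_diff_left[OF assms(1,2,2)] by simp
  then show ?thesis
    unfolding ip_diff_left[OF assms(1,2) d] ip_diff_right[OF assms(1,2,1)] ip_diff_right[OF assms(1,2,2)]
    using ip_commute[of g f] by simp
qed

text \<open>\<open>W\<close> consists of the Laplacians in the cell span that admit zero data, and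
  \<open>f\<close> is an interpolating Laplacian made orthogonal to \<open>W\<close>. For a
  competitor \<open>g\<close> with projection \<open>h\<close> to the cell span,
  \<open>h - f\<close> lies in \<open>W\<close>, so Pythagoras applied twice gives the norms of
  \<open>f\<close>, \<open>h - f\<close> and \<open>g - h\<close> as summands; equality forces the
  last two to vanish.\<close>

lemma optimal_solution_exists:
  obtains u f where "sol u f a b" "f \<in> cell_span"
    "\<And>v g. sol v g a b \<Longrightarrow> ip f f \<le> ip g g"
    "\<And>v g. sol v g a b \<Longrightarrow> ip g g \<le> ip f f \<Longrightarrow> AE y in \<zeta>. g y = f y"
proof -
  obtain u0 f0 where "f0 \<in> lin_span cell_fun (cell_index m)" "has_laplacian q \<zeta> u0 f0"
    "\<And>k. k \<in> {1..n} \<Longrightarrow> u0 (x k) = a k" "\<And>k. k \<in> {1..n} \<Longrightarrow> flux u0 f0 (c k) (s k) = b k"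
    proof (rule interpolant_exists[where x=x and n=n and c=c and m=m and s=s and a=a and b=b, OF inj])
    fix k assume "k \<in> {1..n}" then show "length (c k) = m \<and> x k = FW (c k) (q (s k))" by (rule addr)
  qed (rule that)
  then have u0: "sol u0 f0 a b" "f0 \<in> cell_span" by (auto simp: sol_def cell_span_def)
  define W where "W = {g \<in> cell_span. \<exists>v. sol v g (\<lambda>_. 0) (\<lambda>_. 0)}"
  have W_sub: "L2_subspace W" unfolding L2_subspace_def
  proof (intro conjI allI ballI)
    show "W \<subseteq> L2" using cell_span_L2 by (auto simp: W_def)
    show "(\<lambda>_. 0) \<in> W"
      using sol_diff[OF u0(1) u0(1)] cell_span_subspace by (auto simp: W_def L2_subspace_def)
    fix r g h assume gh: "g \<in> W" "h \<in> W"
    then obtain u v where "sol u g (\<lambda>_. 0) (\<lambda>_. 0)" "sol v h (\<lambda>_. 0) (\<lambda>_. 0)" by (auto simp: W_def)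
    from sol_linear[OF this, of r] have "sol (\<lambda>x. r * u x + v x) (\<lambda>x. r * g x + h x) (\<lambda>_. 0) (\<lambda>_. 0)" by simp
    moreover have "(\<lambda>x. r * g x + h x) \<in> cell_span"
      using gh unfolding W_def cell_span_def by (intro lin_span_linear) auto
    ultimately show "(\<lambda>x. r * g x + h x) \<in> W" unfolding W_def by blast
  qed
  have W_span: "W \<subseteq> lin_span cell_fun (cell_index m)" by (auto simp: W_def cell_span_def)
  obtain w where w: "w \<in> W" "\<And>z. z \<in> W \<Longrightarrow> ip (\<lambda>x. f0 x - w x) z = 0"
    using projection_exists[OF finite_cell_index W_sub W_span sol_L2[OF u0(1)]] by blast
  obtain v0 where v0: "sol v0 w (\<lambda>_. 0) (\<lambda>_. 0)" using w(1) by (auto simp: W_def)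
  define u where "u y = u0 y - v0 y" for y
  define f where "f y = f0 y - w y" for y
  have sol_u: "sol u f a b" using sol_diff[OF u0(1) v0] by (simp add: u_def[abs_def] f_def[abs_def])
  have f_span: "f \<in> cell_span" using cell_span_diff[OF u0(2), of w] w(1) by (simp add: f_def[abs_def] W_def)
  have key: "\<exists>h\<in>L2. ip g g = ip f f + ip (\<lambda>x. h x - f x) (\<lambda>x. h x - f x) + ip (\<lambda>x. g x - h x) (\<lambda>x. g x - h x)"
    if g: "sol v g a b" for v g
  proof -
    obtain v' h where h: "sol v' h a b" "h \<in> cell_span" "\<And>w. w \<in> cell_span \<Longrightarrow> ip (\<lambda>x. g x - h x) w = 0"
    proof (rule sol_project[OF g])
    qed (rule that)
    note L2 = sol_L2[OF g] sol_L2[OF h(1)] sol_L2[OF sol_u]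
    have "(\<lambda>x. h x - f x) \<in> W"
      using sol_diff[OF h(1) sol_u] cell_span_diff[OF h(2) f_span] by (auto simp: W_def)
    from w(2)[OF this] have "ip f (\<lambda>x. h x - f x) = 0" by (simp add: f_def[abs_def])
    then have "ip (\<lambda>x. h x - f x) f = 0" by (simp add: ip_commute)
    then have "ip h h = ip f f + ip (\<lambda>x. h x - f x) (\<lambda>x. h x - f x)" by (rule ip_pythagoras[OF L2(2,3)])
    moreover have "ip g g = ip h h + ip (\<lambda>x. g x - h x) (\<lambda>x. g x - h x)"
      by (rule ip_pythagoras[OF L2(1,2) h(3)[OF h(2)]])
    ultimately show ?thesis using L2(2) by auto
  qed
  show ?thesis
  proof (rule that[OF sol_u f_span])
    fix v g assume g: "sol v g a b"
    obtain h where h: "h \<in> L2" "ip g g = ip f f + ip (\<lambda>x. h x - f x) (\<lambda>x. h x - f x) + ip (\<lambda>x. g x - h x) (\<lambda>x. g x - h x)"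
      using key[OF g] by blast
    note nn = ip_nonneg[of "\<lambda>x. h x - f x"] ip_nonneg[of "\<lambda>x. g x - h x"]
    show "ip f f \<le> ip g g" using h(2) nn by linarith
    assume "ip g g \<le> ip f f"
    then have z: "ip (\<lambda>x. h x - f x) (\<lambda>x. h x - f x) = 0" "ip (\<lambda>x. g x - h x) (\<lambda>x. g x - h x) = 0"
      using h(2) nn by linarith+
    have "AE x in \<zeta>. h x - f x = 0" "AE x in \<zeta>. g x - h x = 0"
      using ip_eq_0_AE[OF L2_diff[OF h(1) sol_L2[OF sol_u]] z(1)] ip_eq_0_AE[OF L2_diff[OF sol_L2[OF g] h(1)] z(2)]
      by auto
    then show "AE y in \<zeta>. g y = f y" by eventually_elim simp
  qed
qed

lemma cell_span_piecewise_biharmonic: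
  assumes "f \<in> cell_span" "AE y in \<zeta>. laplacian q \<zeta> u y = f y" shows "piecewise_biharmonic q \<zeta> m u"
  unfolding piecewise_biharmonic_def
proof (intro allI impI)
  fix w :: "3 list" assume w: "length w = m"
  obtain d where d: "f = (\<lambda>x. \<Sum>p\<in>cell_index m. d p * cell_fun p x)"
    using assms(1) by (auto simp: cell_span_def lin_span_def)
  show "\<exists>h. harmonic q h \<and> (AE x in \<zeta>. \<forall>y\<in>K. x = FW w y \<longrightarrow> laplacian q \<zeta> u x = h y)"
  proof (intro exI[of _ "harm (\<lambda>j. d (w, j))"] conjI harmonic_harm)
    show "AE x in \<zeta>. \<forall>y\<in>K. x = FW w y \<longrightarrow> laplacian q \<zeta> u x = harm (\<lambda>j. d (w, j)) y"
      using assms(2) AE_not_overlap[of m]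
    proof eventually_elim
      case (elim x)
      show ?case
      proof (intro ballI impI)
        fix y assume y: "y \<in> K" "x = FW w y"
        have "f x = harm (\<lambda>j. d (w, j)) (winv w x)"
          unfolding d by (rule span_on_cell[OF _ _ elim(2)]) (use w y in \<open>auto simp: words_def cell_def\<close>)
        then show "laplacian q \<zeta> u x = harm (\<lambda>j. d (w, j)) y" using elim(1) y by simp
      qed
    qed
  qed
qed

end

lemma (in gasket) harm_vanish_of_invertible:
  assumes inv: "invertible (vector
           [vector [harmonic_basis q 0 x1, harmonic_basis q 1 x1, harmonic_basis q 2 x1],
            vector [harmonic_basis q 0 x2, harmonic_basis q 1 x2, harmonic_basis q 2 x2],
            vector [harmonic_basis q 0 x3, harmonic_basis q 1 x3, harmonic_basis q 2 x3]]
           :: real ^ 3 ^ 3)" (is "invertible ?A")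
    and K: "x1 \<in> K" "x2 \<in> K" "x3 \<in> K" and z: "harm e x1 = 0" "harm e x2 = 0" "harm e x3 = 0"
  shows "e = (\<lambda>_. 0)"
proof -
  \<comment> \<open>\<open>vector\<close> fills the positions 1, 2, 3, so the coefficients are
    shifted in the same way as the columns of the matrix, which belong to \<open>h_0\<close>,
    \<open>h_1\<close>, \<open>h_2\<close>.\<close>
  define y where "y = (vector [e 0, e 1, e 2] :: real ^ 3)"
  have h: "harm e p = harmonic_basis q 0 p * e 0 + harmonic_basis q 1 p * e 1 + harmonic_basis q 2 p * e 2"
    if "p \<in> K" for p
    using harm_sum_basis[OF that, of e] by (simp add: sum_UNIV_3 harmonic_basis_eq[OF that] mult.commute)
  have "?A *v y = 0"
    using z unfolding h[OF K(1)] h[OF K(2)] h[OF K(3)]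
    by (simp add: vec_eq_iff forall_3 matrix_vector_mult_def sum_3 y_def)
  moreover obtain B where "B ** ?A = mat 1" using inv unfolding invertible_def by blast
  ultimately have "y = 0"
    using matrix_vector_mul_assoc[of B ?A y] by simp
  then have "y $ 1 = 0" "y $ 2 = 0" "y $ 3 = 0" by simp_all
  then have "\<forall>i. e i = 0" unfolding all_3 by (simp add: y_def)
  then show ?thesis by auto
qed

theorem lemma3p6:
  fixes q :: "3 \<Rightarrow> complex"
    and \<zeta> :: "complex measure"
    and m n :: nat
    and x :: "nat \<Rightarrow> complex"
    and c :: "nat \<Rightarrow> 3 list"
    and s :: "nat \<Rightarrow> 3"
    and a b :: "nat \<Rightarrow> real"
  assumes "equilateral q"
    and "finite_positive_continuous_measure q \<zeta>"
    and "cell_laplacian_bound q \<zeta>"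
    and "n \<ge> 3"
    and "inj_on x {1..n}"
    and "x ` {1..n} \<subseteq> sg_vertices q m"
    and "invertible (vector
           [vector [harmonic_basis q 0 (x 1), harmonic_basis q 1 (x 1), harmonic_basis q 2 (x 1)],
            vector [harmonic_basis q 0 (x 2), harmonic_basis q 1 (x 2), harmonic_basis q 2 (x 2)],
            vector [harmonic_basis q 0 (x 3), harmonic_basis q 1 (x 3), harmonic_basis q 2 (x 3)]]
           :: real ^ 3 ^ 3)"
    and "\<forall>i\<in>{1..n}. length (c i) = m \<and> x i = sg_word q (c i) (q (s i))"
  shows "(\<exists>u. is_minimizer (bending q \<zeta>) (interpolants q \<zeta> n x c s a b) u) \<and>
         (\<forall>u v. is_minimizer (bending q \<zeta>) (interpolants q \<zeta> n x c s a b) u \<longrightarrow>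
                is_minimizer (bending q \<zeta>) (interpolants q \<zeta> n x c s a b) v \<longrightarrow>
                (\<forall>y\<in>SG q. u y = v y)) \<and>
         (\<forall>u. is_minimizer (bending q \<zeta>) (interpolants q \<zeta> n x c s a b) u \<longrightarrow>
              piecewise_biharmonic q \<zeta> m u)"
proof -
  interpret interpolation_data q \<zeta> m n x c s
    by unfold_locales (use assms in auto)
  obtain u0 f0 where opt: "sol u0 f0 a b" "f0 \<in> cell_span"
    "\<And>v g. sol v g a b \<Longrightarrow> ip f0 f0 \<le> ip g g"
    "\<And>v g. sol v g a b \<Longrightarrow> ip g g \<le> ip f0 f0 \<Longrightarrow> AE y in \<zeta>. g y = f0 y"
  proof (rule optimal_solution_exists[of a b])
  qed (rule that)
  have bend: "bending q \<zeta> u = ip f f" if "sol u f a b" for u f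
    using that by (intro bending_eq) (simp add: sol_def)
  have ex: "is_minimizer (bending q \<zeta>) (interpolants q \<zeta> n x c s a b) u0"
    unfolding is_minimizer_def
  proof (intro conjI ballI sol_imp_interpolant[OF opt(1)])
    fix v assume "v \<in> interpolants q \<zeta> n x c s a b"
    then obtain g where "sol v g a b" using interpolants_iff by blast
    then show "bending q \<zeta> u0 \<le> bending q \<zeta> v" using opt(1,3) bend by simp
  qed
  \<comment> \<open>Every minimizer admits the same function \<open>f0\<close> as its Laplacian, not
    merely one equal to it almost everywhere, so that all of them share one Green potential.\<close>
  have min: "has_laplacian q \<zeta> v f0 \<and> (\<forall>k\<in>{1..n}. v (x k) = a k) \<and> (AE y in \<zeta>. laplacian q \<zeta> v y = f0 y)"
    if v: "is_minimizer (bending q \<zeta>) (interpolants q \<zeta> n x c s a b) v" for v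
  proof -
    obtain g where g: "sol v g a b" using v interpolants_iff unfolding is_minimizer_def by blast
    have "bending q \<zeta> v \<le> bending q \<zeta> u0"
      using v sol_imp_interpolant[OF opt(1)] unfolding is_minimizer_def by blast
    then have "ip g g \<le> ip f0 f0" using bend[OF g] bend[OF opt(1)] by simp
    then have ae: "AE y in \<zeta>. g y = f0 y" by (rule opt(4)[OF g])
    have hv: "has_laplacian q \<zeta> v g" using g by (simp add: sol_def)
    have hf: "has_laplacian q \<zeta> v f0" by (rule has_laplacian_cong_AE[OF hv sol_L2[OF opt(1)] ae])
    have "has_laplacian q \<zeta> v (laplacian q \<zeta> v)"
      by (rule laplacian_has_laplacian) (use hf in \<open>auto simp: dom_laplacian_def\<close>)
    from laplacian_AE_unique[OF this hf] show ?thesis using hf g by (simp add: sol_def)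
  qed
  have uniq: "u y = v y"
    if u: "is_minimizer (bending q \<zeta>) (interpolants q \<zeta> n x c s a b) u"
      and v: "is_minimizer (bending q \<zeta>) (interpolants q \<zeta> n x c s a b) v" and y: "y \<in> K" for u v y
  proof -
    \<comment> \<open>The boundary values of the difference, once the common potential has
      cancelled; the form matches \<open>harm_linear\<close> with factor -1.\<close>
    define e where "e j = (-1) * v (q j) + u (q j)" for j
    have d: "u p - v p = harm e p" if "p \<in> K" for p
    proof -
      have hl: "has_laplacian q \<zeta> u f0" "has_laplacian q \<zeta> v f0" using min[OF u] min[OF v] by blast+
      have "u p - v p = (-1) * harm (v \<circ> q) p + harm (u \<circ> q) p"
        unfolding has_laplacian_imp_green[OF hl(1) that] has_laplacian_imp_green[OF hl(2) that] by simp
      also have "\<dots> = harm e p" using harm_linear[OF that, of "-1" "v \<circ> q" "u \<circ> q"] by (simp add: e_def[abs_def])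
      finally show ?thesis .
    qed
    have xk: "x k \<in> K" "harm e (x k) = 0" if "k \<in> {1, 2, 3}" for k
    proof -
      have k: "k \<in> {1..n}" using that assms(4) by auto
      show xK: "x k \<in> K" using addr[OF k] by simp
      show "harm e (x k) = 0" using d[OF xK] min[OF u] min[OF v] k by simp
    qed
    have "e = (\<lambda>_. 0)"
      by (rule harm_vanish_of_invertible[OF assms(7)]) (simp_all add: xk)
    then show ?thesis using d[OF y] harm_const[OF y, of 0] by simp
  qed
  have bih: "piecewise_biharmonic q \<zeta> m u"
    if u: "is_minimizer (bending q \<zeta>) (interpolants q \<zeta> n x c s a b) u" for u
    using min[OF u] by (intro cell_span_piecewise_biharmonic[OF opt(2)]) blast
  show ?thesis
  proof (intro conjI allI impI ballI)
    show "\<exists>u. is_minimizer (bending q \<zeta>) (interpolants q \<zeta> n x c s a b) u" by (intro exI[of _ u0] ex)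
  next
    fix u v y
    assume "is_minimizer (bending q \<zeta>) (interpolants q \<zeta> n x c s a b) u"
      "is_minimizer (bending q \<zeta>) (interpolants q \<zeta> n x c s a b) v" "y \<in> K"
    then show "u y = v y" by (rule uniq[of u v y])
  next
    fix u assume "is_minimizer (bending q \<zeta>) (interpolants q \<zeta> n x c s a b) u"
    then show "piecewise_biharmonic q \<zeta> m u" by (rule bih)
  qed
qed

end
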